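(* Let $d,s\ge 1$ be integers and $f:\mathbb{R}^d\to\mathbb{R}$. For $\mathbf{a}=(a_1,\dots,a_d)\in\{-\infty,+\infty\}^d$ and $S\subseteq[d]$, consider the condition $$(\mathrm{I}_{\mathbf{a},S})\qquad \sum_{\boldsymbol{\delta}\in\{0,1\}^{|S|}}(-1)^{\sum_{j\in S}\delta_j}\cdot f^S_{(a_j,j\in S^c)}\big((1-\delta_j)w_j+\delta_jv_j,\ j\in S\big)=0\quad\text{for all } v_j<w_j,\ j\in S.$$ The following statements are equivalent: (a) $f\in\mathcal{F}^{d,s}_{\infty-\text{ST}}$. (b) $\mathrm{HK}_{\mathbf{a}}(f)<\infty$ for some $\mathbf{a}\in\{-\infty,+\infty\}^d$, and $f$ is right-continuous and satisfies $(\mathrm{I}_{\mathbf{a},S})$ for all subsets $S\subseteq[d]$ with $|S|>s$. (c) $\mathrm{HK}_{\mathbf{a}}(f)<\infty$ for all $\mathbf{a}\in\{-\infty,+\infty\}^d$, and $f$ is right-continuous and satisfies $(\mathrm{I}_{\mathbf{a},S})$ (for all such $\mathbf{a}$) for all subsets $S\subseteq[d]$ with $|S|>s$.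
   Context: Notation: $[d]=\{1,\dots,d\}$; "right-continuous" means coordinate-wise right-continuous. Function class. For (not necessarily disjoint) $L,U\subseteq[d]$ with $0<|L|+|U|\le s$ and $\mathbf{l}=(l_j,j\in L)$, $\mathbf{u}=(u_j,j\in U)$ real vectors, let $b^{L,U}_{\mathbf{l},\mathbf{u}}(x_1,\dots,x_d)=\prod_{j\in L}\mathbf{1}(x_j\ge l_j)\cdot\prod_{j\in U}\mathbf{1}(x_j<u_j)$. $\mathcal{F}^{d,s}_{\infty-\text{ST}}$ is the set of all functions $\mathbf{x}\mapsto c+\sum_{0<|L|+|U|\le s}\int_{\mathbb{R}^{|L|+|U|}}b^{L,U}_{\mathbf{l},\mathbf{u}}(\mathbf{x})\,d\nu_{L,U}(\mathbf{l},\mathbf{u})$ with $c\in\mathbb{R}$ and $\nu_{L,U}$ finite signed Borel measures on $\mathbb{R}^{|L|+|U|}$. Vitali variation. For $g:\mathbb{R}^m\to\mathbb{R}$ and $u_j<v_j$, the quasi-volume is $\Delta(g;\prod_{j=1}^m[u_j,v_j])=\sum_{\boldsymbol{\delta}\in\{0,1\}^m}(-1)^{\delta_1+\cdots+\delta_m}g((1-\delta_1)v_1+\delta_1u_1,\dots,(1-\delta_m)v_m+\delta_mu_m)$. An axis-aligned split of $\prod_{j=1}^m[a_j,b_j]$ ($a_j<b_j$ real) is the collection of all rectangles $\prod_{j=1}^m[u^{(j)}_{l_j},u^{(j)}_{l_j+1}]$, $l_j\in[n_j]$, obtained from partitions $a_j=u^{(j)}_1<\cdots<u^{(j)}_{n_j+1}=b_j$.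 $\mathrm{Vit}(g;\prod_j[a_j,b_j])=\sup_{\mathcal{P}}\sum_{R\in\mathcal{P}}|\Delta(g;R)|$ over all axis-aligned splits $\mathcal{P}$, and $\mathrm{Vit}(g)$ is the supremum of $\mathrm{Vit}(g;\prod_j[a_j,b_j])$ over all rectangles in $\mathbb{R}^m$. HK variation. For $\mathbf{a}\in\{-\infty,+\infty\}^d$, $S\subseteq[d]$, $S^c=[d]\setminus S$, let $f^S_{(a_j,j\in S^c)}(x_j,j\in S)=\lim_{(x_j,j\in S^c)\to(a_j,j\in S^c)}f(x_1,\dots,x_d)$; it is well defined if the limit exists and is finite for all $(x_j,j\in S)\in\mathbb{R}^{|S|}$. If $f^S_{(a_j,j\in S^c)}$ is well defined for all $S\subseteq[d]$, the Hardy–Krause variation anchored at $\mathbf{a}$ is $\mathrm{HK}_{\mathbf{a}}(f)=\sum_{\emptyset\ne S\subseteq[d]}\mathrm{Vit}(f^S_{(a_j,j\in S^c)})$. The statement $\mathrm{HK}_{\mathbf{a}}(f)<\infty$ includes the requirement that all these functions are well defined. *)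

theory Defs
  imports "HOL-Analysis.Analysis"
begin

definition finite_signed_measure :: "'a measure \<Rightarrow> ('a set \<Rightarrow> real) \<Rightarrow> bool" where
  "finite_signed_measure M \<nu> \<longleftrightarrow>
     \<nu> {} = 0 \<and>
     (\<forall>A :: nat \<Rightarrow> 'a set. range A \<subseteq> sets M \<longrightarrow> disjoint_family A \<longrightarrow>
        (\<lambda>i. \<nu> (A i)) sums \<nu> (\<Union>i. A i))"

text \<open>The positive part of the Jordan decomposition. Since \<open>ennreal\<close> sends negative reals to 0 and
  \<open>B = {}\<close> is admissible, truncation does not change the supremum.\<close>

definition jordan_pos :: "'a measure \<Rightarrow> ('a set \<Rightarrow> real) \<Rightarrow> 'a measure" where
  "jordan_pos M \<nu> =
     measure_of (space M) (sets M) (\<lambda>A. SUP B\<in>{B \<in> sets M. B \<subseteq> A}. ennreal (\<nu> B))"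

definition jordan_neg :: "'a measure \<Rightarrow> ('a set \<Rightarrow> real) \<Rightarrow> 'a measure" where
  "jordan_neg M \<nu> = jordan_pos M (\<lambda>A. - \<nu> A)"

definition signed_integral :: "'a measure \<Rightarrow> ('a set \<Rightarrow> real) \<Rightarrow> ('a \<Rightarrow> real) \<Rightarrow> real" where
  "signed_integral M \<nu> h = (\<integral>z. h z \<partial>jordan_pos M \<nu>) - (\<integral>z. h z \<partial>jordan_neg M \<nu>)"

definition basis_fun ::
    "'d set \<Rightarrow> 'd set \<Rightarrow> ('d \<Rightarrow> real) \<Rightarrow> ('d \<Rightarrow> real) \<Rightarrow> real ^ 'd::finite \<Rightarrow> real" where
  "basis_fun L U l u x =
     (\<Prod>j\<in>L. if x $ j \<ge> l j then 1 else 0) * (\<Prod>j\<in>U. if x $ j < u j then 1 else 0)"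

text \<open>The space of pairs \<open>(l, u)\<close> with its Borel sets: the Borel \<open>\<sigma>\<close>-algebra of a
  finite-dimensional Euclidean space is the product of the one-dimensional ones. Only the
  measurable-space structure of this object is used.\<close>

definition param_space :: "'d set \<Rightarrow> 'd set \<Rightarrow> (('d \<Rightarrow> real) \<times> ('d \<Rightarrow> real)) measure" where
  "param_space L U = Pi\<^sub>M L (\<lambda>_. borel) \<Otimes>\<^sub>M Pi\<^sub>M U (\<lambda>_. borel)"

definition st_class :: "nat \<Rightarrow> (real ^ 'd::finite \<Rightarrow> real) set" where
  "st_class s = {f. \<exists>c \<nu>.
     (\<forall>L U. 0 < card L + card U \<and> card L + card U \<le> s \<longrightarrow>
        finite_signed_measure (param_space L U) (\<nu> L U)) \<and>
     (\<forall>x. f x = c + (\<Sum>(L, U)\<in>{(L, U). 0 < card L + card U \<and> card L + card U \<le> s}.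
        signed_integral (param_space L U) (\<nu> L U) (\<lambda>(l, u). basis_fun L U l u x)))}"

text \<open>A real function of the coordinates indexed by a finite set \<open>J\<close> is a function
  \<open>g :: ('i \<Rightarrow> real) \<Rightarrow> real\<close> evaluated only at points of \<open>J \<rightarrow>\<^sub>E UNIV\<close>. A nondegenerate rectangle is
  represented by its pair of lower and upper corners.\<close>

definition quasi_volume ::
    "'i set \<Rightarrow> (('i \<Rightarrow> real) \<Rightarrow> real) \<Rightarrow> ('i \<Rightarrow> real) \<Rightarrow> ('i \<Rightarrow> real) \<Rightarrow> real" where
  "quasi_volume J g u v =
     (\<Sum>\<delta>\<in>J \<rightarrow>\<^sub>E {0, 1::nat}.
        (-1) ^ (\<Sum>j\<in>J. \<delta> j) *
        g (\<lambda>j\<in>J. (1 - real (\<delta> j)) * v j + real (\<delta> j) * u j))"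

definition axis_splits ::
    "'i set \<Rightarrow> ('i \<Rightarrow> real) \<Rightarrow> ('i \<Rightarrow> real) \<Rightarrow> (('i \<Rightarrow> real) \<times> ('i \<Rightarrow> real)) set set" where
  "axis_splits J a b =
     {(\<lambda>k. (\<lambda>j\<in>J. p j (k j), \<lambda>j\<in>J. p j (k j + 1))) ` (\<Pi>\<^sub>E j\<in>J. {1..n j}) |
       (p :: 'i \<Rightarrow> nat \<Rightarrow> real) (n :: 'i \<Rightarrow> nat).
       \<forall>j\<in>J. p j 1 = a j \<and> p j (n j + 1) = b j \<and> strict_mono_on {1..n j + 1} (p j)}"

definition vitali_on ::
    "'i set \<Rightarrow> (('i \<Rightarrow> real) \<Rightarrow> real) \<Rightarrow> ('i \<Rightarrow> real) \<Rightarrow> ('i \<Rightarrow> real) \<Rightarrow> ennreal" where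
  "vitali_on J g a b =
     (SUP P\<in>axis_splits J a b. ennreal (\<Sum>(u, v)\<in>P. \<bar>quasi_volume J g u v\<bar>))"

definition vitali :: "'i set \<Rightarrow> (('i \<Rightarrow> real) \<Rightarrow> real) \<Rightarrow> ennreal" where
  "vitali J g = (SUP (a, b)\<in>{(a, b). \<forall>j\<in>J. a j < b j}. vitali_on J g a b)"

text \<open>The filter expressing that the coordinates \<open>y j\<close>, \<open>j \<in> T\<close>, tend jointly to
  \<open>a j \<in> {-\<infinity>, \<infinity>}\<close>. For \<open>T = {}\<close> it is the top filter, under which a constant function has its
  value as unique limit.\<close>

definition anchor_filter :: "('d \<Rightarrow> ereal) \<Rightarrow> 'd set \<Rightarrow> ('d \<Rightarrow> real) filter" where
  "anchor_filter a T =
     (INF j\<in>T. filtercomap (\<lambda>y. y j) (if a j = \<infinity> then at_top else at_bot))"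

definition glue :: "'d set \<Rightarrow> ('d \<Rightarrow> real) \<Rightarrow> ('d \<Rightarrow> real) \<Rightarrow> real ^ 'd::finite" where
  "glue S x y = (\<chi> j. if j \<in> S then x j else y j)"

definition limit_section_exists ::
    "('d \<Rightarrow> ereal) \<Rightarrow> 'd set \<Rightarrow> (real ^ 'd::finite \<Rightarrow> real) \<Rightarrow> bool" where
  "limit_section_exists a S f \<longleftrightarrow>
     (\<forall>x\<in>S \<rightarrow>\<^sub>E UNIV. \<exists>c. ((\<lambda>y. f (glue S x y)) \<longlongrightarrow> c) (anchor_filter a (- S)))"

definition limit_section ::
    "('d \<Rightarrow> ereal) \<Rightarrow> 'd set \<Rightarrow> (real ^ 'd::finite \<Rightarrow> real) \<Rightarrow> ('d \<Rightarrow> real) \<Rightarrow> real" where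
  "limit_section a S f x = Lim (anchor_filter a (- S)) (\<lambda>y. f (glue S x y))"

definition hk_variation :: "('d \<Rightarrow> ereal) \<Rightarrow> (real ^ 'd::finite \<Rightarrow> real) \<Rightarrow> ennreal" where
  "hk_variation a f = (\<Sum>S\<in>{S. S \<noteq> {}}. vitali S (limit_section a S f))"

definition hk_finite :: "('d \<Rightarrow> ereal) \<Rightarrow> (real ^ 'd::finite \<Rightarrow> real) \<Rightarrow> bool" where
  "hk_finite a f \<longleftrightarrow> (\<forall>S. limit_section_exists a S f) \<and> hk_variation a f < \<infinity>"

definition anchors :: "('d \<Rightarrow> ereal) set" where
  "anchors = UNIV \<rightarrow> {-\<infinity>, \<infinity>}"

definition right_continuous :: "(real ^ 'd::finite \<Rightarrow> real) \<Rightarrow> bool" where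
  "right_continuous f \<longleftrightarrow>
     (\<forall>x j. ((\<lambda>t. f (\<chi> i. if i = j then t else x $ i)) \<longlongrightarrow> f x) (at_right (x $ j)))"

definition no_interaction ::
    "('d \<Rightarrow> ereal) \<Rightarrow> 'd set \<Rightarrow> (real ^ 'd::finite \<Rightarrow> real) \<Rightarrow> bool" where
  "no_interaction a S f \<longleftrightarrow>
     (\<forall>v w. (\<forall>j\<in>S. v j < w j) \<longrightarrow> quasi_volume S (limit_section a S f) v w = 0)"

end

theory Submission
  imports Defs
begin

text \<open>
  A function in the class is a constant plus integrals, against finite measures, of products of
  one-variable factors. Quasi-volumes and limits at infinity act on each factor separately, so
  every property in (c) follows by dominated convergence, the interactions of order above \<open>s\<close>
  vanishing because a product with at most \<open>s\<close> nonconstant factors has a trivial increment in the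
  remaining coordinates.

  For the converse, Moebius inversion over the faces at infinity writes \<open>f\<close> as a sum of components,
  each of which is a limit of quasi-volumes of one face of \<open>f\<close>. A component of order above \<open>s\<close> is
  therefore zero, and the others are values on orthants of a signed measure, as soon as the quasi-volume
  of a right-continuous function of finite Vitali variation extends to a signed Borel measure. On a
  finite grid the quasi-volume is a signed point measure; the limit of its positive part under
  refinement of the grid is a finitely additive box function, countably additive by right-continuity
  and compactness, to which Caratheodory's theorem applies.
\<close>

section \<open>Quasi-volumes on grids\<close>

text \<open>The two kinds of factor in the class come from the two kinds of anchor. Between minus
  infinity and x lies the half-line of all t <= x, between x and plus infinity that of all t > x;
  read as conditions on a threshold they are 1(x >= l) and 1(x < u). One anchor therefore suffices
  to return to the class, with disjoint L and U, and the class in turn yields every anchor; this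
  closes the circle between (a), (b) and (c). The obstacle is that right-continuity is given for f,
  one coordinate at a time, whereas measures are built from the faces of f, which are limits of f at
  infinity. Finite Vitali variation on the whole space makes quasi-volumes far out uniformly small,
  so f converges to its faces uniformly and they inherit right-continuity. Coordinate-wise
  continuity is then enough, because countable additivity needs it only for thin slabs, where a
  single face of a box moves. The positive variations of g and of - g are used because on every grid
  through the corners of a box their difference is exactly the quasi-volume.\<close>

lemma quasi_volume_prod:
  fixes \<phi> :: "'i \<Rightarrow> real \<Rightarrow> real"
  assumes "finite J"
  shows "quasi_volume J (\<lambda>x. \<Prod>j\<in>J. \<phi> j (x j)) u v = (\<Prod>j\<in>J. \<phi> j (v j) - \<phi> j (u j))"
proof -
  have "(\<Prod>j\<in>J. \<phi> j (v j) - \<phi> j (u j)) =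
      (\<Prod>j\<in>J. \<Sum>\<delta>\<in>{0, 1::nat}. (-1) ^ \<delta> * \<phi> j ((1 - real \<delta>) * v j + real \<delta> * u j))"
    by simp
  also have "\<dots> = (\<Sum>\<delta>\<in>J \<rightarrow>\<^sub>E {0, 1::nat}. \<Prod>j\<in>J. (-1) ^ \<delta> j * \<phi> j ((1 - real (\<delta> j)) * v j + real (\<delta> j) * u j))"
    using assms by (intro prod_sum_PiE) auto
  also have "\<dots> = quasi_volume J (\<lambda>x. \<Prod>j\<in>J. \<phi> j (x j)) u v"
    unfolding quasi_volume_def by (intro sum.cong refl) (simp add: prod.distrib power_sum)
  finally show ?thesis by simp
qed

text \<open>\<open>R\<close> collects the coordinates taken at the upper corner, those with index 0.
  This is the form that matches the alternating sums over faces in the Moebius inversion.\<close>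

lemma quasi_volume_Pow:
  assumes "finite J"
  shows "quasi_volume J g u v =
    (\<Sum>R\<in>Pow J. (-1) ^ card (J - R) * g (\<lambda>j\<in>J. if j \<in> R then v j else u j))"
  unfolding quasi_volume_def
proof (rule sum.reindex_bij_witness[where j = "\<lambda>\<delta>. {j \<in> J. \<delta> j = 0}"
      and i = "\<lambda>R. \<lambda>j\<in>J. if j \<in> R then 0 else 1"])
  fix \<delta> assume \<delta>: "\<delta> \<in> J \<rightarrow>\<^sub>E {0, 1::nat}"
  then show "(\<lambda>j\<in>J. if j \<in> {j \<in> J. \<delta> j = 0} then 0 else 1) = \<delta>"
    by (auto simp: PiE_iff extensional_def restrict_def fun_eq_iff)
  show "{j \<in> J. \<delta> j = 0} \<in> Pow J" by auto
  have "(\<Sum>j\<in>J. \<delta> j) = (\<Sum>j\<in>J - {j \<in> J. \<delta> j = 0}. \<delta> j)"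
    using assms by (intro sum.mono_neutral_right) auto
  also have "\<dots> = (\<Sum>j\<in>J - {j \<in> J. \<delta> j = 0}. 1)"
    using \<delta> by (intro sum.cong) (auto simp: PiE_iff)
  also have "\<dots> = card (J - {j \<in> J. \<delta> j = 0})" by simp
  finally have 1: "(\<Sum>j\<in>J. \<delta> j) = card (J - {j \<in> J. \<delta> j = 0})" .
  have 2: "(\<lambda>j\<in>J. if j \<in> {j \<in> J. \<delta> j = 0} then v j else u j) =
     (\<lambda>j\<in>J. (1 - real (\<delta> j)) * v j + real (\<delta> j) * u j)"
    using \<delta> by (auto simp: PiE_iff restrict_def fun_eq_iff)
  show "(-1) ^ card (J - {j \<in> J. \<delta> j = 0}) * g (\<lambda>j\<in>J. if j \<in> {j \<in> J. \<delta> j = 0} then v j else u j) =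
     (-1) ^ (\<Sum>j\<in>J. \<delta> j) * g (\<lambda>j\<in>J. (1 - real (\<delta> j)) * v j + real (\<delta> j) * u j)"
    unfolding 1 2 ..
qed auto

lemma quasi_volume_cong:
  assumes "finite J" "\<And>j. j \<in> J \<Longrightarrow> u j = u' j" "\<And>j. j \<in> J \<Longrightarrow> v j = v' j"
    and "\<And>x. x \<in> J \<rightarrow>\<^sub>E UNIV \<Longrightarrow> (\<And>j. j \<in> J \<Longrightarrow> x j = u' j \<or> x j = v' j) \<Longrightarrow> g x = h x"
  shows "quasi_volume J g u v = quasi_volume J h u' v'"
proof -
  have "(\<lambda>j\<in>J. if j \<in> R then v j else u j) = (\<lambda>j\<in>J. if j \<in> R then v' j else u' j)" for R
    using assms by (auto simp: restrict_def fun_eq_iff)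
  moreover have "g (\<lambda>j\<in>J. if j \<in> R then v' j else u' j) = h (\<lambda>j\<in>J. if j \<in> R then v' j else u' j)" for R
    by (rule assms(4)) auto
  ultimately show ?thesis
    by (simp add: quasi_volume_Pow[OF assms(1)])
qed

lemma quasi_volume_sum:
  "quasi_volume J (\<lambda>x. \<Sum>i\<in>I. c i * g i x) u v = (\<Sum>i\<in>I. c i * quasi_volume J (g i) u v)"
proof -
  have "quasi_volume J (\<lambda>x. \<Sum>i\<in>I. c i * g i x) u v = (\<Sum>\<delta>\<in>J \<rightarrow>\<^sub>E {0, 1::nat}. \<Sum>i\<in>I.
      c i * ((-1) ^ (\<Sum>j\<in>J. \<delta> j) * g i (\<lambda>j\<in>J. (1 - real (\<delta> j)) * v j + real (\<delta> j) * u j)))"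
    unfolding quasi_volume_def by (simp add: sum_distrib_left mult.left_commute)
  also have "\<dots> = (\<Sum>i\<in>I. c i * quasi_volume J (g i) u v)"
    unfolding quasi_volume_def by (subst sum.swap) (simp add: sum_distrib_left)
  finally show ?thesis .
qed

lemma quasi_volume_add_scaled:
  "quasi_volume J (\<lambda>x. f x + r * g x) u v = quasi_volume J f u v + r * quasi_volume J g u v"
  by (simp add: quasi_volume_def sum_distrib_left sum.distrib algebra_simps)

lemma quasi_volume_uminus: "quasi_volume J (\<lambda>x. - g x) u v = - quasi_volume J g u v"
  by (simp add: quasi_volume_def sum_negf)

text \<open>On the grid \<open>g\<close> is a combination of products of Kronecker deltas, and
  quasi-volumes are linear and multiplicative on products. Identities between quasi-volumes thereby
  reduce to identities between differences of deltas in one variable.\<close>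

lemma quasi_volume_kronecker:
  assumes "finite J" "\<And>j. j \<in> J \<Longrightarrow> finite (F j)" "\<And>j. j \<in> J \<Longrightarrow> u j \<in> F j" "\<And>j. j \<in> J \<Longrightarrow> v j \<in> F j"
  shows "quasi_volume J g u v =
    (\<Sum>y\<in>Pi\<^sub>E J F. g y * (\<Prod>j\<in>J. of_bool (v j = y j) - of_bool (u j = y j)))"
proof -
  have "quasi_volume J g u v =
      quasi_volume J (\<lambda>x. \<Sum>y\<in>Pi\<^sub>E J F. g y * (\<Prod>j\<in>J. of_bool (x j = y j))) u v"
  proof (rule quasi_volume_cong[OF assms(1) refl refl])
    fix x :: "'a \<Rightarrow> real"
    assume x: "x \<in> J \<rightarrow>\<^sub>E UNIV" "\<And>j. j \<in> J \<Longrightarrow> x j = u j \<or> x j = v j"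
    have xF: "x \<in> Pi\<^sub>E J F" using x assms(3,4) by (force simp: PiE_iff)
    have "(\<Prod>j\<in>J. of_bool (x j = y j)) = (if y = x then 1 else 0 :: real)" if yF: "y \<in> Pi\<^sub>E J F" for y
    proof (cases "y = x")
      case False
      then obtain j where "j \<in> J" "x j \<noteq> y j" using PiE_ext[OF xF yF] by metis
      then have "(\<Prod>j\<in>J. of_bool (x j = y j)) = (0 :: real)" using assms(1) by (intro prod_zero) auto
      with False show ?thesis by simp
    qed simp
    then have "(\<Sum>y\<in>Pi\<^sub>E J F. g y * (\<Prod>j\<in>J. of_bool (x j = y j))) =
        (\<Sum>y\<in>Pi\<^sub>E J F. if y = x then g y else 0)"
      by (intro sum.cong) auto
    also have "\<dots> = g x" using xF assms by (simp add: finite_PiE)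
    finally show "g x = (\<Sum>y\<in>Pi\<^sub>E J F. g y * (\<Prod>j\<in>J. of_bool (x j = y j)))" by simp
  qed
  then show ?thesis
    using quasi_volume_prod[OF assms(1), of "\<lambda>j t. of_bool (t = y j)" for y]
    by (simp add: quasi_volume_sum)
qed

lemma quasi_volume_degenerate:
  assumes "finite J" "j \<in> J" "u j = v j"
  shows "quasi_volume J g u v = 0"
  using assms
  by (subst quasi_volume_kronecker[of _ "\<lambda>j. {u j, v j}"])
    (auto intro!: sum.neutral bexI[of _ j])

text \<open>Exchanging the two ends in one coordinate flips the sign of one difference of deltas.
  This serves boxes with a corner running to the anchor, which may be above or below the other
  corner in each coordinate.\<close>

lemma quasi_volume_sort:
  assumes "finite J"
  shows "quasi_volume J g u v = (-1) ^ card {j \<in> J. v j < u j} *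
    quasi_volume J g (\<lambda>j. min (u j) (v j)) (\<lambda>j. max (u j) (v j))"
proof -
  let ?F = "\<lambda>j. {u j, v j}"
  have "(\<Prod>j\<in>J. of_bool (v j = y j) - of_bool (u j = y j)) = (-1) ^ card {j \<in> J. v j < u j} *
      (\<Prod>j\<in>J. of_bool (max (u j) (v j) = y j) - of_bool (min (u j) (v j) = y j) :: real)" for y
  proof -
    have "(-1) ^ card {j \<in> J. v j < u j} = (\<Prod>j\<in>J. if v j < u j then - 1 else 1 :: real)"
      using assms by (simp add: prod.If_cases Int_def)
    then show ?thesis
      by (simp add: prod.distrib[symmetric]) (intro prod.cong refl, auto simp: min_def max_def)
  qed
  then show ?thesis
    using assms
    by (subst (1 2) quasi_volume_kronecker[of _ "\<lambda>j. {u j, v j}"]) (auto simp: sum_distrib_left algebra_simps min_def max_def)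
qed

text \<open>The default \<open>t\<close> makes the cell at the least grid value degenerate: it has
  zero quasi-volume and is empty as a half-open box, so sums may run over the whole grid.\<close>

definition pred_in :: "real set \<Rightarrow> real \<Rightarrow> real" where
  "pred_in F t = (if \<exists>x\<in>F. x < t then Max {x \<in> F. x < t} else t)"

lemma pred_in_less:
  assumes "finite F" "x \<in> F" "x < t"
  shows "pred_in F t < t"
proof -
  have "Max {x \<in> F. x < t} \<in> {x \<in> F. x < t}"
    using assms by (intro Max_in) auto
  then show ?thesis
    using assms by (auto simp: pred_in_def)
qed

lemma pred_in_le: "finite F \<Longrightarrow> pred_in F t \<le> t"
  by (metis less_imp_le order_refl pred_in_def pred_in_less)

lemma pred_in_mem: "finite F \<Longrightarrow> t \<in> F \<Longrightarrow> pred_in F t \<in> F"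
proof (cases "\<exists>x\<in>F. x < t")
  case True
  assume "finite F"
  then have "Max {x \<in> F. x < t} \<in> {x \<in> F. x < t}" using True by (intro Max_in) auto
  then show ?thesis using True by (simp add: pred_in_def)
qed (auto simp: pred_in_def)

lemma le_pred_in: "finite F \<Longrightarrow> x \<in> F \<Longrightarrow> x < t \<Longrightarrow> x \<le> pred_in F t"
  by (auto simp: pred_in_def)

lemma sum_pred_in_telescope:
  fixes \<phi> :: "real \<Rightarrow> real"
  assumes "finite F" "u \<in> F" "v \<in> F" "u \<le> v"
  shows "(\<Sum>p\<in>F \<inter> {u<..v}. \<phi> p - \<phi> (pred_in F p)) = \<phi> v - \<phi> u"
  using assms(3,4)
proof (induction "card (F \<inter> {u<..v})" arbitrary: v rule: less_induct)
  case (less v)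
  show ?case
  proof (cases "u = v")
    case False
    with less.prems have uv: "u < v" by simp
    define w where "w = pred_in F v"
    have w: "w \<in> F" "u \<le> w" "w < v"
      using assms(1,2) uv less.prems unfolding w_def by (metis pred_in_mem, metis le_pred_in, metis pred_in_less)
    have eq: "F \<inter> {u<..v} = insert v (F \<inter> {u<..w})"
      using w uv less.prems le_pred_in[OF assms(1), of _ v] by (fastforce simp: w_def)
    have "card (F \<inter> {u<..w}) < card (F \<inter> {u<..v})"
      unfolding eq using assms w by (subst card_insert_disjoint) auto
    then have "(\<Sum>p\<in>F \<inter> {u<..w}. \<phi> p - \<phi> (pred_in F p)) = \<phi> w - \<phi> u"
      using less.hyps w by blast
    then show ?thesis
      unfolding eq using assms w by (subst sum.insert) (auto simp: w_def)
  qed auto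
qed

text \<open>Attaching the quasi-volume of a cell to its upper corner \<open>p\<close> turns the
  quasi-volume of \<open>g\<close> into a signed point measure on the grid.\<close>

definition cell_volume :: "'i set \<Rightarrow> (('i \<Rightarrow> real) \<Rightarrow> real) \<Rightarrow> ('i \<Rightarrow> real set) \<Rightarrow> ('i \<Rightarrow> real) \<Rightarrow> real" where
  "cell_volume J g F p = quasi_volume J g (\<lambda>j. pred_in (F j) (p j)) p"

text \<open>In one variable the difference of deltas telescopes over the grid values in
  \<open>{u j<..v j}\<close>; multiplying these sums out over \<open>J\<close> produces the
  cells.\<close>

lemma quasi_volume_grid:
  assumes J: "finite J" and F: "\<And>j. j \<in> J \<Longrightarrow> finite (F j)"
    and uv: "\<And>j. j \<in> J \<Longrightarrow> u j \<in> F j" "\<And>j. j \<in> J \<Longrightarrow> v j \<in> F j" "\<And>j. j \<in> J \<Longrightarrow> u j \<le> v j"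
  shows "quasi_volume J g u v = (\<Sum>p\<in>(\<Pi>\<^sub>E j\<in>J. F j \<inter> {u j<..v j}). cell_volume J g F p)"
proof -
  let ?c = "\<lambda>j s t. of_bool (s = t) - of_bool (pred_in (F j) s = t) :: real"
  have "(\<Prod>j\<in>J. of_bool (v j = y j) - of_bool (u j = y j)) =
      (\<Sum>p\<in>(\<Pi>\<^sub>E j\<in>J. F j \<inter> {u j<..v j}). \<Prod>j\<in>J. ?c j (p j) (y j))" for y
    using J F uv prod_sum_PiE[of J "\<lambda>j. F j \<inter> {u j<..v j}" "\<lambda>j s. ?c j s (y j)"]
    by (simp add: sum_pred_in_telescope[where \<phi> = "\<lambda>t. of_bool (t = y j)" for j])
  then have "quasi_volume J g u v =
      (\<Sum>y\<in>Pi\<^sub>E J F. \<Sum>p\<in>(\<Pi>\<^sub>E j\<in>J. F j \<inter> {u j<..v j}). g y * (\<Prod>j\<in>J. ?c j (p j) (y j)))"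
    using J F uv by (simp add: quasi_volume_kronecker[of J F] sum_distrib_left)
  also have "\<dots> = (\<Sum>p\<in>(\<Pi>\<^sub>E j\<in>J. F j \<inter> {u j<..v j}). \<Sum>y\<in>Pi\<^sub>E J F. g y * (\<Prod>j\<in>J. ?c j (p j) (y j)))"
    by (rule sum.swap)
  also have "\<dots> = (\<Sum>p\<in>(\<Pi>\<^sub>E j\<in>J. F j \<inter> {u j<..v j}). cell_volume J g F p)"
    unfolding cell_volume_def
    using J F uv
    by (intro sum.cong refl quasi_volume_kronecker[symmetric]) (auto simp: PiE_iff pred_in_mem)
  finally show ?thesis .
qed

lemma cell_volume_uminus: "cell_volume J (\<lambda>x. - g x) F p = - cell_volume J g F p"
  by (simp add: cell_volume_def quasi_volume_uminus)

text \<open>Translates between grids given as finite sets, which are easily refined, and the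
  enumerated partitions with indices \<open>1..n+1\<close> of \<open>axis_splits\<close>.\<close>

lemma finite_real_enumeration:
  fixes F :: "real set"
  assumes "card F = n + 1"
  obtains h where "strict_mono_on {1..n+1} h" "F = h ` {1..n+1}" "pred_in F (h 1) = h 1"
    "\<And>k. k \<in> {1..n} \<Longrightarrow> pred_in F (h (k + 1)) = h k"
proof -
  have fin: "finite F" using assms card.infinite by fastforce
  define xs where "xs = sorted_list_of_set F"
  have xs: "sorted_wrt (<) xs" "set xs = F" "length xs = n + 1"
    using fin assms by (simp_all add: xs_def)
  define h where "h k = xs ! (k - 1)" for k
  have h: "strict_mono_on {1..n+1} h"
    using sorted_wrt_nth_less[OF xs(1)] xs(3) by (auto simp: strict_mono_on_def h_def)
  have img: "F = h ` {1..n+1}"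
  proof -
    have "{..<n + 1} = (\<lambda>k. k - 1) ` {1..n+1}"
      by (auto intro!: image_eqI[where x = "Suc k" for k])
    moreover have "F = (!) xs ` {..<n + 1}"
      using xs(2,3) by (auto simp: in_set_conv_nth)
    ultimately show ?thesis
      by (simp only: h_def[abs_def] image_image)
  qed
  have mono: "h k < h l \<longleftrightarrow> k < l" if "k \<in> {1..n+1}" "l \<in> {1..n+1}" for k l
    using h that by (simp add: strict_mono_on_less)
  have "pred_in F (h (k + 1)) = h k" if "k \<in> {1..n}" for k
  proof -
    have "{x \<in> F. x < h (k + 1)} = h ` {1..k}"
      using that by (auto simp: img mono)
    moreover have "Max (h ` {1..k}) = h k"
      using that mono by (intro Max_eqI) (auto simp: not_less[symmetric])
    moreover have "h k \<in> F" "h k < h (k + 1)"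
      using that by (auto simp: img mono)
    ultimately show ?thesis
      by (auto simp: pred_in_def)
  qed
  moreover have "pred_in F (h 1) = h 1"
    using mono by (auto simp: pred_in_def img)
  ultimately show thesis
    using h img that by blast
qed

text \<open>A grid with at least two values on every axis is an axis-aligned split of the box from
  its least to its greatest point; otherwise every cell is degenerate.\<close>

lemma sum_abs_cell_volume_le:
  assumes J: "finite J" "J \<noteq> {}" and F: "\<And>j. j \<in> J \<Longrightarrow> finite (F j)"
    and V: "vitali J g \<le> ennreal V" "0 \<le> V"
  shows "(\<Sum>p\<in>Pi\<^sub>E J F. \<bar>cell_volume J g F p\<bar>) \<le> V"
proof (cases "\<forall>j\<in>J. 2 \<le> card (F j)")
  case False
  then obtain j where j: "j \<in> J" "card (F j) < 2" by auto
  then have F1: "s = t" if "s \<in> F j" "t \<in> F j" for s t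
    using that card_mono[of "F j" "{s, t}"] F by (force simp: card_insert_if split: if_splits)
  have "cell_volume J g F p = 0" if "p \<in> Pi\<^sub>E J F" for p
    unfolding cell_volume_def using J F j that
    by (intro quasi_volume_degenerate[of J j]) (auto intro!: F1 pred_in_mem simp: PiE_iff)
  then show ?thesis using V by simp
next
  case True
  define n where "n j = card (F j) - 1" for j
  have n: "card (F j) = n j + 1" "1 \<le> n j" if "j \<in> J" for j using that True by (force simp: n_def)+
  have "\<forall>j\<in>J. \<exists>h. strict_mono_on {1..n j+1} h \<and> F j = h ` {1..n j+1} \<and> pred_in (F j) (h 1) = h 1 \<and>
      (\<forall>k\<in>{1..n j}. pred_in (F j) (h (k + 1)) = h k)"
  proof
    fix j assume "j \<in> J"
    show "\<exists>h. strict_mono_on {1..n j+1} h \<and> F j = h ` {1..n j+1} \<and> pred_in (F j) (h 1) = h 1 \<and>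
        (\<forall>k\<in>{1..n j}. pred_in (F j) (h (k + 1)) = h k)"
      by (rule finite_real_enumeration[OF n(1)[OF \<open>j \<in> J\<close>]]) blast
  qed
  then have "\<exists>h. \<forall>j\<in>J. strict_mono_on {1..n j+1} (h j) \<and> F j = h j ` {1..n j+1} \<and>
      pred_in (F j) (h j 1) = h j 1 \<and> (\<forall>k\<in>{1..n j}. pred_in (F j) (h j (k + 1)) = h j k)"
    by (rule bchoice)
  then obtain h where "\<forall>j\<in>J. strict_mono_on {1..n j+1} (h j) \<and> F j = h j ` {1..n j+1} \<and>
      pred_in (F j) (h j 1) = h j 1 \<and> (\<forall>k\<in>{1..n j}. pred_in (F j) (h j (k + 1)) = h j k)" ..
  note H = this[rule_format]
  note h = H[THEN conjunct1] and img = H[THEN conjunct2, THEN conjunct1]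
    and min = H[THEN conjunct2, THEN conjunct2, THEN conjunct1]
    and pred = H[THEN conjunct2, THEN conjunct2, THEN conjunct2, rule_format]
  define a b where "a = (\<lambda>j. h j 1)" and "b = (\<lambda>j. h j (n j + 1))"
  define P where "P = (\<lambda>k. (\<lambda>j\<in>J. h j (k j), \<lambda>j\<in>J. h j (k j + 1))) ` (\<Pi>\<^sub>E j\<in>J. {1..n j})"
  have P: "P \<in> axis_splits J a b"
    unfolding axis_splits_def P_def
    by (rule CollectI, rule exI[of _ h], rule exI[of _ n]) (use h in \<open>auto simp: a_def b_def\<close>)
  have ab: "a j < b j" if "j \<in> J" for j
    using strict_mono_onD[OF h[OF that], of 1 "n j + 1"] n[OF that] by (simp add: a_def b_def)
  have finP: "finite P" unfolding P_def using J by (intro finite_imageI finite_PiE) auto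
  \<comment> \<open>Cells at the least value of some axis are degenerate and drop out; the remaining
    points are the upper corners of the rectangles of the split.\<close>
  let ?F = "\<lambda>j. F j - {h j 1}"
  have "(\<Sum>p\<in>Pi\<^sub>E J F. \<bar>cell_volume J g F p\<bar>) = (\<Sum>p\<in>Pi\<^sub>E J ?F. \<bar>cell_volume J g F p\<bar>)"
  proof (rule sum.mono_neutral_right)
    show "\<forall>p\<in>Pi\<^sub>E J F - Pi\<^sub>E J ?F. \<bar>cell_volume J g F p\<bar> = 0"
    proof
      fix p assume "p \<in> Pi\<^sub>E J F - Pi\<^sub>E J ?F"
      then obtain j where "j \<in> J" "p j = h j 1" by (auto simp: PiE_iff)
      then show "\<bar>cell_volume J g F p\<bar> = 0"
        unfolding cell_volume_def using J min by (subst quasi_volume_degenerate[of J j]) auto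
    qed
  qed (use J F in \<open>auto simp: finite_PiE PiE_iff\<close>)
  also have "\<dots> \<le> (\<Sum>(u, v)\<in>P. \<bar>quasi_volume J g u v\<bar>)"
  proof (rule sum_le_included[where i = snd])
    show "\<forall>p\<in>Pi\<^sub>E J ?F. \<exists>q\<in>P. snd q = p \<and> \<bar>cell_volume J g F p\<bar> \<le> (case q of (u, v) \<Rightarrow> \<bar>quasi_volume J g u v\<bar>)"
    proof
      fix p assume p: "p \<in> Pi\<^sub>E J ?F"
      have "\<exists>k\<in>{1..n j}. p j = h j (k + 1)" if "j \<in> J" for j
      proof -
        have pj: "p j \<in> F j - {h j 1}" using p that by auto
        then obtain l where l: "l \<in> {1..n j+1}" "p j = h j l" using img[OF \<open>j \<in> J\<close>] by auto
        moreover have "l \<noteq> 1" using l pj by auto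
        ultimately show ?thesis by (intro bexI[of _ "l - 1"]) auto
      qed
      then obtain k where k: "\<And>j. j \<in> J \<Longrightarrow> k j \<in> {1..n j}" "\<And>j. j \<in> J \<Longrightarrow> p j = h j (k j + 1)" by metis
      have *: "(\<lambda>j\<in>J. h j (k j + 1)) = p"
        using p k(2) by (auto simp: PiE_iff extensional_def fun_eq_iff)
      have "(\<lambda>j\<in>J. h j (k j), p) \<in> P"
        unfolding P_def using k(1)
        by (intro image_eqI[where x = "restrict k J"]) (auto simp: * [symmetric])
      moreover have "cell_volume J g F p = quasi_volume J g (\<lambda>j\<in>J. h j (k j)) p"
        unfolding cell_volume_def using J k pred by (intro quasi_volume_cong) auto
      ultimately show "\<exists>q\<in>P. snd q = p \<and> \<bar>cell_volume J g F p\<bar> \<le> (case q of (u, v) \<Rightarrow> \<bar>quasi_volume J g u v\<bar>)"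
        by force
    qed
  qed (use J F finP in \<open>auto simp: finite_PiE\<close>)
  finally have "ennreal (\<Sum>p\<in>Pi\<^sub>E J F. \<bar>cell_volume J g F p\<bar>) \<le> ennreal (\<Sum>(u, v)\<in>P. \<bar>quasi_volume J g u v\<bar>)"
    by (rule ennreal_leI)
  also have "\<dots> \<le> vitali_on J g a b"
    unfolding vitali_on_def using P by (rule SUP_upper)
  also have "\<dots> \<le> vitali J g"
    unfolding vitali_def using ab by (intro SUP_upper2[of "(a, b)"]) auto
  also note V(1)
  finally show ?thesis using V(2) by (simp add: ennreal_le_iff)
qed

section \<open>Half-open boxes and the cells of a grid\<close>

definition box_Ioc :: "'i set \<Rightarrow> ('i \<Rightarrow> real) \<Rightarrow> ('i \<Rightarrow> real) \<Rightarrow> ('i \<Rightarrow> real) set" where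
  "box_Ioc J u v = (\<Pi>\<^sub>E j\<in>J. {u j<..v j})"

abbreviation grid_cell :: "'i set \<Rightarrow> ('i \<Rightarrow> real set) \<Rightarrow> ('i \<Rightarrow> real) \<Rightarrow> ('i \<Rightarrow> real) set" where
  "grid_cell J F p \<equiv> box_Ioc J (\<lambda>j. pred_in (F j) (p j)) p"

lemma grid_cell_disjoint:
  assumes F: "\<And>j. j \<in> J \<Longrightarrow> finite (F j)" and p: "p \<in> Pi\<^sub>E J F" "p' \<in> Pi\<^sub>E J F" "p \<noteq> p'"
  shows "grid_cell J F p \<inter> grid_cell J F p' = {}"
proof -
  obtain j where j: "j \<in> J" "p j \<noteq> p' j" using PiE_ext[OF p(1,2)] p(3) by blast
  then have "p j \<in> F j" "p' j \<in> F j" using p by auto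
  then have "p j \<le> pred_in (F j) (p' j) \<or> p' j \<le> pred_in (F j) (p j)"
    using j le_pred_in[OF F, of j "p j" "p' j"] le_pred_in[OF F, of j "p' j" "p j"] by linarith
  moreover have "pred_in (F j) (p j) < q j \<and> q j \<le> p j" if "q \<in> grid_cell J F p" for q p
    using that j by (auto simp: box_Ioc_def PiE_iff)
  ultimately show ?thesis
    by (meson disjoint_iff leD order_less_le_trans order_trans)
qed

text \<open>No grid value lies strictly between \<open>p j\<close> and its predecessor, so a cell
  cannot straddle a face of a box whose corners are on the grid.\<close>

lemma grid_cell_mem_box_iff:
  assumes F: "\<And>j. j \<in> J \<Longrightarrow> finite (F j)" and p: "p \<in> Pi\<^sub>E J F" and q: "q \<in> grid_cell J F p"
    and uv: "\<And>j. j \<in> J \<Longrightarrow> u j \<in> F j" "\<And>j. j \<in> J \<Longrightarrow> v j \<in> F j"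
  shows "q \<in> box_Ioc J u v \<longleftrightarrow> p \<in> box_Ioc J u v"
proof -
  have "u j < q j \<and> q j \<le> v j \<longleftrightarrow> u j < p j \<and> p j \<le> v j" if j: "j \<in> J" for j
  proof -
    have "pred_in (F j) (p j) < q j" "q j \<le> p j" using q j by (auto simp: box_Ioc_def PiE_iff)
    moreover have "u j < p j \<Longrightarrow> u j \<le> pred_in (F j) (p j)" "v j < p j \<Longrightarrow> v j \<le> pred_in (F j) (p j)"
      using F uv j by (auto intro: le_pred_in)
    ultimately show ?thesis by linarith
  qed
  then show ?thesis
    using p q by (auto simp: box_Ioc_def PiE_iff)
qed

lemma ex_grid_cell:
  assumes F: "\<And>j. j \<in> J \<Longrightarrow> finite (F j)" and q: "q \<in> box_Ioc J u v"
    and uv: "\<And>j. j \<in> J \<Longrightarrow> u j \<in> F j" "\<And>j. j \<in> J \<Longrightarrow> v j \<in> F j"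
  shows "\<exists>p\<in>Pi\<^sub>E J F. q \<in> grid_cell J F p"
proof -
  have "\<exists>t\<in>F j. pred_in (F j) t < q j \<and> q j \<le> t" if j: "j \<in> J" for j
  proof -
    \<comment> \<open>The least grid value at or above \<open>q j\<close>. The value
      \<open>v j\<close> shows that there is one, and \<open>u j\<close> lies below it, so that its
      predecessor is a genuine one.\<close>
    define t where "t = Min {t \<in> F j. q j \<le> t}"
    have "v j \<in> {t \<in> F j. q j \<le> t}" using uv q j by (auto simp: box_Ioc_def PiE_iff)
    then have "t \<in> {t \<in> F j. q j \<le> t}"
      unfolding t_def using F j by (intro Min_in) auto
    then have t: "t \<in> F j" "q j \<le> t" by auto
    have least: "t \<le> s" if "s \<in> F j" "q j \<le> s" for s
      unfolding t_def using F j that by (intro Min_le) auto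
    have "u j < t" using q j t by (auto simp: box_Ioc_def PiE_iff)
    then have "pred_in (F j) t < t" "pred_in (F j) t \<in> F j"
      using F uv j t by (auto intro: pred_in_less pred_in_mem)
    then show ?thesis using t least by force
  qed
  then obtain p where p: "\<And>j. j \<in> J \<Longrightarrow> p j \<in> F j \<and> pred_in (F j) (p j) < q j \<and> q j \<le> p j"
    by metis
  show ?thesis
    using p q by (intro bexI[of _ "restrict p J"]) (auto simp: box_Ioc_def PiE_iff)
qed

text \<open>\<open>w\<close> will be \<open>abs\<close> for the total and \<open>max 0\<close> for
  the positive variation. A cell counts as soon as its upper corner lies in the box.\<close>

definition grid_mass :: "(real \<Rightarrow> real) \<Rightarrow> 'i set \<Rightarrow> (('i \<Rightarrow> real) \<Rightarrow> real) \<Rightarrow>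
    ('i \<Rightarrow> real set) \<Rightarrow> ('i \<Rightarrow> real) \<Rightarrow> ('i \<Rightarrow> real) \<Rightarrow> real" where
  "grid_mass w J g F u v = (\<Sum>p\<in>(\<Pi>\<^sub>E j\<in>J. F j \<inter> {u j<..v j}). w (cell_volume J g F p))"

lemma grid_mass_indicator:
  assumes "finite J" "\<And>j. j \<in> J \<Longrightarrow> finite (F j)"
  shows "grid_mass w J g F u v =
    (\<Sum>p\<in>Pi\<^sub>E J F. w (cell_volume J g F p) * indicator (box_Ioc J u v) p)"
proof -
  have "(\<Pi>\<^sub>E j\<in>J. F j \<inter> {u j<..v j}) = Pi\<^sub>E J F \<inter> box_Ioc J u v"
    by (auto simp: box_Ioc_def PiE_iff)
  then show ?thesis
    using assms by (simp add: grid_mass_def indicator_def if_distrib sum.inter_restrict finite_PiE cong: if_cong)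
qed

text \<open>Sub- and superadditivity over families of boxes are both instances of this lemma.\<close>

lemma grid_mass_mono:
  assumes J: "finite J" "\<And>j. j \<in> J \<Longrightarrow> finite (F j)" and w: "\<And>x. 0 \<le> w x"
    and le: "\<And>x. x \<in> J \<rightarrow>\<^sub>E UNIV \<Longrightarrow>
      (\<Sum>i\<in>I. indicator (box_Ioc J (u i) (v i)) x) \<le> (\<Sum>k\<in>K. indicator (box_Ioc J (u' k) (v' k)) x :: real)"
  shows "(\<Sum>i\<in>I. grid_mass w J g F (u i) (v i)) \<le> (\<Sum>k\<in>K. grid_mass w J g F (u' k) (v' k))"
proof -
  have eq: "(\<Sum>i\<in>I. grid_mass w J g F (u i) (v i)) =
      (\<Sum>p\<in>Pi\<^sub>E J F. w (cell_volume J g F p) * (\<Sum>i\<in>I. indicator (box_Ioc J (u i) (v i)) p))" for I :: "'z set" and u v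
    using J by (simp add: grid_mass_indicator sum_distrib_left sum.swap[of _ I])
  show ?thesis
    unfolding eq by (intro sum_mono mult_left_mono w le) (auto simp: PiE_iff)
qed

lemma grid_mass_disjoint:
  assumes J: "finite J" "\<And>j. j \<in> J \<Longrightarrow> finite (F j)" and w: "\<And>x. 0 \<le> w x"
    and "box_Ioc J u v \<subseteq> box_Ioc J a b" "box_Ioc J u' v' \<subseteq> box_Ioc J a b" "box_Ioc J u v \<inter> box_Ioc J u' v' = {}"
  shows "grid_mass w J g F u v + grid_mass w J g F u' v' \<le> grid_mass w J g F a b"
proof -
  have "(\<Sum>i\<in>{True, False}. grid_mass w J g F (if i then u else u') (if i then v else v')) \<le>
      (\<Sum>i\<in>{True}. grid_mass w J g F a b)"
  proof (rule grid_mass_mono[OF J w])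
    fix x :: "'a \<Rightarrow> real"
    have "indicator (box_Ioc J u v) x + indicator (box_Ioc J u' v') x \<le> (indicator (box_Ioc J a b) x :: real)"
      using assms(4-6) by (auto simp: indicator_def)
    then show "(\<Sum>i\<in>{True, False}. indicator (box_Ioc J (if i then u else u') (if i then v else v')) x) \<le>
        (\<Sum>i\<in>{True}. indicator (box_Ioc J a b) x :: real)"
      by simp
  qed
  then show ?thesis by simp
qed

text \<open>Each cell is cut into cells of the finer grid and \<open>w\<close> is subadditive. With
  \<open>u\<close> on the coarse grid the pieces of a counted cell stay in the box; a cell reaching
  below \<open>u\<close> could lose some of its mass on refinement.\<close>

lemma grid_mass_refine:
  assumes J: "finite J" and F': "\<And>j. j \<in> J \<Longrightarrow> finite (F' j)" and sub: "\<And>j. j \<in> J \<Longrightarrow> F j \<subseteq> F' j"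
    and u: "\<And>j. j \<in> J \<Longrightarrow> u j \<in> F j"
    and w: "\<And>x. 0 \<le> w x" "w 0 = 0" "\<And>x y. w (x + y) \<le> w x + w y"
  shows "grid_mass w J g F u v \<le> grid_mass w J g F' u v"
proof -
  have fin: "finite (F j)" if "j \<in> J" for j using that F' sub finite_subset by blast
  have wsum: "w (\<Sum>i\<in>A. f i) \<le> (\<Sum>i\<in>A. w (f i))" for A :: "('a \<Rightarrow> real) set" and f
    by (induction A rule: infinite_finite_induct) (auto simp: w(2) intro: order_trans[OF w(3)])
  define B where "B p = (\<Pi>\<^sub>E j\<in>J. F' j \<inter> {pred_in (F j) (p j)<..p j})" for p
  have B_cell: "B p \<subseteq> grid_cell J F p" for p by (auto simp: B_def box_Ioc_def PiE_iff)
  let ?A = "\<Pi>\<^sub>E j\<in>J. F j \<inter> {u j<..v j}"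
  have A: "?A \<subseteq> Pi\<^sub>E J F" by (auto simp: PiE_iff)
  have finA: "finite ?A" and finB: "finite (B p)" for p
    using J F' fin by (auto simp: B_def intro!: finite_PiE)
  have "grid_mass w J g F u v \<le> (\<Sum>p\<in>?A. \<Sum>q\<in>B p. w (cell_volume J g F' q))"
    unfolding grid_mass_def
  proof (rule sum_mono)
    fix p assume p: "p \<in> ?A"
    have "cell_volume J g F p = (\<Sum>q\<in>B p. cell_volume J g F' q)"
      unfolding cell_volume_def[of J g F] B_def
      using J F' fin p sub
      by (intro quasi_volume_grid) (auto simp: PiE_iff intro!: pred_in_le subsetD[OF sub] pred_in_mem)
    then show "w (cell_volume J g F p) \<le> (\<Sum>q\<in>B p. w (cell_volume J g F' q))"
      by (simp add: wsum)
  qed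
  also have "\<dots> = (\<Sum>q\<in>(\<Union>p\<in>?A. B p). w (cell_volume J g F' q))"
    using finA finB grid_cell_disjoint[of J F, OF fin] A B_cell
    by (intro sum.UNION_disjoint[symmetric]) (auto, blast)
  also have "\<dots> \<le> grid_mass w J g F' u v"
    unfolding grid_mass_def
  proof (rule sum_mono2)
    show "(\<Union>p\<in>?A. B p) \<subseteq> (\<Pi>\<^sub>E j\<in>J. F' j \<inter> {u j<..v j})"
    proof
      fix q assume "q \<in> (\<Union>p\<in>?A. B p)"
      then obtain p where p: "p \<in> ?A" "q \<in> B p" by auto
      have "q j \<in> F' j \<inter> {u j<..v j}" if "j \<in> J" for j
        using p that u le_pred_in[OF fin, of j "u j" "p j"] by (fastforce simp: B_def PiE_iff)
      then show "q \<in> (\<Pi>\<^sub>E j\<in>J. F' j \<inter> {u j<..v j})"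
        using p by (auto simp: B_def PiE_iff)
    qed
  qed (use J F' w in \<open>auto simp: finite_PiE\<close>)
  finally show ?thesis .
qed

lemma grid_mass_le_vitali:
  assumes J: "finite J" "J \<noteq> {}" and F: "\<And>j. j \<in> J \<Longrightarrow> finite (F j)"
    and V: "vitali J g \<le> ennreal V" "0 \<le> V" and w: "\<And>x. w x \<le> \<bar>x\<bar>"
  shows "grid_mass w J g F u v \<le> V"
proof -
  have "grid_mass w J g F u v \<le> (\<Sum>p\<in>(\<Pi>\<^sub>E j\<in>J. F j \<inter> {u j<..v j}). \<bar>cell_volume J g F p\<bar>)"
    unfolding grid_mass_def by (intro sum_mono w)
  also have "\<dots> \<le> (\<Sum>p\<in>Pi\<^sub>E J F. \<bar>cell_volume J g F p\<bar>)"
    using J F by (intro sum_mono2) (auto simp: finite_PiE PiE_iff)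
  also have "\<dots> \<le> V"
    by (rule sum_abs_cell_volume_le[OF J F V])
  finally show ?thesis .
qed

text \<open>A grid nearly attaining the total variation leaves little of it for boxes far away.\<close>

lemma quasi_volume_tail:
  assumes J: "finite J" "J \<noteq> {}" and V: "vitali J g < \<infinity>" and "0 < \<eta>"
  shows "\<exists>N. \<forall>u v. (\<forall>j\<in>J. u j \<le> v j) \<longrightarrow> (\<exists>j\<in>J. v j \<le> - N \<or> N \<le> u j) \<longrightarrow> \<bar>quasi_volume J g u v\<bar> \<le> \<eta>"
proof -
  define V where "V = enn2real (vitali J g)"
  have V: "vitali J g \<le> ennreal V" "0 \<le> V"
    unfolding V_def using assms(3) ennreal_enn2real[of "vitali J g"] by simp_all
  let ?m = "grid_mass abs J g"
  define S :: "(('a \<Rightarrow> real set) \<times> ('a \<Rightarrow> real) \<times> ('a \<Rightarrow> real)) set"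
    where "S = {(F, u, v). \<forall>j\<in>J. finite (F j) \<and> u j \<in> F j}"
  define C where "C = (SUP (F, u, v)\<in>S. ?m F u v)"
  have bdd: "bdd_above ((\<lambda>(F, u, v). ?m F u v) ` S)"
    using J V by (intro bdd_aboveI[of _ V]) (auto simp: S_def intro!: grid_mass_le_vitali)
  have "(\<lambda>_. {0}, \<lambda>_. 0, \<lambda>_. 0) \<in> S" by (simp add: S_def)
  then have ne: "S \<noteq> {}" by (rule ex_in_conv[THEN iffD1, OF exI])
  have "C - \<eta> < C" using \<open>0 < \<eta>\<close> by simp
  then obtain F u0 v0 where F: "\<And>j. j \<in> J \<Longrightarrow> finite (F j)" "\<And>j. j \<in> J \<Longrightarrow> u0 j \<in> F j"
      and big: "C - \<eta> < ?m F u0 v0"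
    unfolding C_def less_cSUP_iff[OF ne bdd] by (auto simp: S_def)
  \<comment> \<open>A box lying beyond this bound in some coordinate, on either side, is disjoint
    from the box with corners \<open>u0\<close> and \<open>v0\<close>.\<close>
  define N where "N = Max ((\<lambda>j. \<bar>u0 j\<bar> + \<bar>v0 j\<bar>) ` J)"
  have N: "\<bar>u0 j\<bar> + \<bar>v0 j\<bar> \<le> N" if "j \<in> J" for j
    using J that by (simp add: N_def)
  have "\<bar>quasi_volume J g u v\<bar> \<le> \<eta>"
    if uv: "\<forall>j\<in>J. u j \<le> v j" and far: "\<exists>j\<in>J. v j \<le> - N \<or> N \<le> u j" for u v
  proof -
    define F' where "F' j = insert (u j) (insert (v j) (F j))" for j
    have F': "finite (F' j)" "u j \<in> F' j" "v j \<in> F' j" "u0 j \<in> F' j" "F j \<subseteq> F' j" if "j \<in> J" for j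
      using F that by (auto simp: F'_def)
    have "?m F u0 v0 \<le> ?m F' u0 v0"
      using J F F' by (intro grid_mass_refine) auto
    moreover have "\<bar>quasi_volume J g u v\<bar> \<le> ?m F' u v"
      using J F' uv by (subst quasi_volume_grid[of J F']) (auto simp: grid_mass_def)
    \<comment> \<open>Both boxes lie in a common hull of mass at most \<open>C\<close>, and the
      first already takes more than \<open>C - \<eta>\<close>.\<close>
    moreover have "?m F' u0 v0 + ?m F' u v \<le> ?m F' (\<lambda>j. min (u0 j) (u j)) (\<lambda>j. max (v0 j) (v j))"
    proof -
      have disj: "box_Ioc J u0 v0 \<inter> box_Ioc J u v = {}"
      proof -
        obtain j where j: "j \<in> J" "v j \<le> - N \<or> N \<le> u j" using far by auto
        have False if "x \<in> box_Ioc J u0 v0" "x \<in> box_Ioc J u v" for x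
        proof -
          have "u0 j < x j" "x j \<le> v0 j" "u j < x j" "x j \<le> v j"
            using that j(1) by (auto simp: box_Ioc_def PiE_iff)
          then show False using j(2) N[OF j(1)] by linarith
        qed
        then show ?thesis by blast
      qed
      show ?thesis
        using J F' disj by (intro grid_mass_disjoint) (force simp: box_Ioc_def PiE_iff)+
    qed
    moreover have "?m F' (\<lambda>j. min (u0 j) (u j)) (\<lambda>j. max (v0 j) (v j)) \<le> C"
      unfolding C_def using F'
      by (intro cSUP_upper2[OF bdd, of "(F', \<lambda>j. min (u0 j) (u j), \<lambda>j. max (v0 j) (v j))"]) (auto simp: S_def min_def)
    ultimately show ?thesis using big by linarith
  qed
  then show ?thesis by blast
qed

section \<open>Finite signed measures\<close>

lemma finite_signed_measure_Un:
  assumes "finite_signed_measure M \<nu>" "A \<in> sets M" "B \<in> sets M" "A \<inter> B = {}"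
  shows "\<nu> (A \<union> B) = \<nu> A + \<nu> B"
proof -
  have "range (binaryset A B) \<subseteq> sets M" "disjoint_family (binaryset A B)"
    using assms by (auto simp: range_binaryset_eq disjoint_family_on_def binaryset_def)
  then have "(\<lambda>i. \<nu> (binaryset A B i)) sums \<nu> (A \<union> B)"
    using assms(1) unfolding finite_signed_measure_def by (metis UN_binaryset_eq)
  moreover have "(\<lambda>i. \<nu> (binaryset A B i)) sums (\<nu> A + \<nu> B)"
    using assms(1) by (intro binaryset_sums) (simp add: finite_signed_measure_def)
  ultimately show ?thesis by (rule sums_unique2)
qed

lemma finite_signed_measure_uminus:
  "finite_signed_measure M \<nu> \<Longrightarrow> finite_signed_measure M (\<lambda>A. - \<nu> A)"
  by (auto simp: finite_signed_measure_def intro: sums_minus)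

text \<open>If \<open>\<nu>\<close> is unbounded on subsets of \<open>E\<close>, split \<open>E\<close> into two parts of measure above 1 in modulus;
  \<open>\<nu>\<close> remains unbounded on one of them. The discarded parts are disjoint, and the series of their
  measures cannot converge.\<close>

lemma finite_signed_measure_bounded:
  assumes \<nu>: "finite_signed_measure M \<nu>"
  shows "\<exists>C. \<forall>A\<in>sets M. \<bar>\<nu> A\<bar> \<le> C"
proof (rule ccontr)
  define unb where "unb E \<longleftrightarrow> (\<forall>C. \<exists>B\<in>sets M. B \<subseteq> E \<and> C < \<bar>\<nu> B\<bar>)" for E
  assume "\<not> ?thesis"
  then have unb0: "unb (space M)"
    unfolding unb_def by (metis not_le sets.sets_into_space)
  have step: "\<exists>E'. (E' \<in> sets M \<and> unb E') \<and> E' \<subseteq> E \<and> 1 < \<bar>\<nu> (E - E')\<bar>"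
    if "E \<in> sets M \<and> unb E" for E
  proof -
    have E: "E \<in> sets M" "unb E" using that by auto
    \<comment> \<open>The margin is chosen so that additivity forces \<open>E - B\<close> above 1 in
      modulus as well.\<close>
    then obtain B where B: "B \<in> sets M" "B \<subseteq> E" "\<bar>\<nu> E\<bar> + 1 < \<bar>\<nu> B\<bar>"
      unfolding unb_def by blast
    have "\<nu> (B \<union> (E - B)) = \<nu> B + \<nu> (E - B)"
      using B E by (intro finite_signed_measure_Un[OF \<nu>]) auto
    then have big: "1 < \<bar>\<nu> B\<bar>" "1 < \<bar>\<nu> (E - B)\<bar>"
      using B by (auto simp: Un_absorb1)
    have "unb B \<or> unb (E - B)"
    proof (rule ccontr)
      assume "\<not> (unb B \<or> unb (E - B))"
      then obtain C1 C2 where C: "\<And>D. D \<in> sets M \<Longrightarrow> D \<subseteq> B \<Longrightarrow> \<bar>\<nu> D\<bar> \<le> C1"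
          "\<And>D. D \<in> sets M \<Longrightarrow> D \<subseteq> E - B \<Longrightarrow> \<bar>\<nu> D\<bar> \<le> C2"
        unfolding unb_def by (meson not_le)
      obtain D where D: "D \<in> sets M" "D \<subseteq> E" "C1 + C2 < \<bar>\<nu> D\<bar>"
        using E unfolding unb_def by blast
      have "\<nu> ((D \<inter> B) \<union> (D - B)) = \<nu> (D \<inter> B) + \<nu> (D - B)"
        using B D by (intro finite_signed_measure_Un[OF \<nu>]) auto
      moreover have "(D \<inter> B) \<union> (D - B) = D" by auto
      moreover have "\<bar>\<nu> (D \<inter> B)\<bar> \<le> C1" "\<bar>\<nu> (D - B)\<bar> \<le> C2"
        using B D by (auto intro!: C)
      ultimately show False using D by simp
    qed
    moreover have "E - (E - B) = B" using B by auto
    ultimately show ?thesis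
      using B E big by (metis Diff_subset sets.Diff)
  qed
  obtain E where E: "\<And>n. E n \<in> sets M \<and> unb (E n)"
      "\<And>n. E (Suc n) \<subseteq> E n \<and> 1 < \<bar>\<nu> (E n - E (Suc n))\<bar>"
    using dependent_nat_choice[of "\<lambda>_ E. E \<in> sets M \<and> unb E"
        "\<lambda>_ E E'. E' \<subseteq> E \<and> 1 < \<bar>\<nu> (E - E')\<bar>"] unb0 step by (metis sets.top)
  define D where "D n = E n - E (Suc n)" for n
  have anti: "E n \<subseteq> E m" if "m \<le> n" for m n
    using lift_Suc_antimono_le[of E, OF _ that] E(2) by blast
  have disj: "D m \<inter> D n = {}" if "m < n" for m n
    using anti[of "Suc m" n] that by (auto simp: D_def)
  have "disjoint_family D"
    unfolding disjoint_family_on_def by (metis disj inf_commute linorder_neqE_nat)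
  moreover have "range D \<subseteq> sets M" using E by (auto simp: D_def)
  ultimately have "(\<lambda>i. \<nu> (D i)) sums \<nu> (\<Union>i. D i)"
    using \<nu> by (auto simp: finite_signed_measure_def)
  then have "(\<lambda>i. \<nu> (D i)) \<longlonglongrightarrow> 0"
    by (intro summable_LIMSEQ_zero) (rule sums_summable)
  then have "eventually (\<lambda>i. \<bar>\<nu> (D i)\<bar> < 1) sequentially"
    using tendstoD[of "\<lambda>i. \<nu> (D i)" 0 sequentially 1] by (simp add: dist_real_def)
  then obtain i where "\<bar>\<nu> (D i)\<bar> < 1" by (auto simp: eventually_sequentially)
  with E(2)[of i] show False by (simp add: D_def)
qed

lemma sets_jordan_pos[simp, measurable_cong]: "sets (jordan_pos M \<nu>) = sets M"
  by (simp add: jordan_pos_def sets.space_closed)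

lemma space_jordan_pos[simp]: "space (jordan_pos M \<nu>) = space M"
  by (rule sets_eq_imp_space_eq) simp

text \<open>The bound on \<open>\<nu>\<close> bounds the supremum over \<open>space M\<close>. By
  \<open>emeasure_measure_of_conv\<close> the measure of the space is this supremum or 0, and the
  bound covers both cases.\<close>

lemma finite_measure_jordan_pos:
  assumes "finite_signed_measure M \<nu>"
  shows "finite_measure (jordan_pos M \<nu>)"
proof (rule finite_measureI)
  obtain C where C: "\<And>A. A \<in> sets M \<Longrightarrow> \<bar>\<nu> A\<bar> \<le> C"
    using finite_signed_measure_bounded[OF assms] by blast
  have "(SUP B\<in>{B \<in> sets M. B \<subseteq> space M}. ennreal (\<nu> B)) \<le> ennreal C"
    using C by (intro SUP_least ennreal_leI) fastforce
  then have "emeasure (jordan_pos M \<nu>) (space M) \<le> ennreal C"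
    by (simp add: jordan_pos_def emeasure_measure_of_conv)
  then show "emeasure (jordan_pos M \<nu>) (space (jordan_pos M \<nu>)) \<noteq> \<infinity>"
    by (auto simp: top_unique)
qed

text \<open>\<open>Y\<close> is a Hahn set, and the supremum is attained at
  \<open>A \<inter> Y\<close>: passing there from any \<open>B \<subseteq> A\<close> removes a part
  of nonpositive measure and adds one of nonnegative measure.\<close>

lemma measure_jordan_pos:
  assumes \<nu>: "finite_signed_measure M \<nu>" and Y: "Y \<in> sets M"
    and pos: "\<And>X. X \<in> sets M \<Longrightarrow> X \<subseteq> Y \<Longrightarrow> 0 \<le> \<nu> X"
    and neg: "\<And>X. X \<in> sets M \<Longrightarrow> X \<inter> Y = {} \<Longrightarrow> \<nu> X \<le> 0"
    and A: "A \<in> sets M"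
  shows "measure (jordan_pos M \<nu>) A = \<nu> (A \<inter> Y)"
proof -
  have eq: "(SUP B\<in>{B \<in> sets M. B \<subseteq> A}. ennreal (\<nu> B)) = ennreal (\<nu> (A \<inter> Y))"
    if A: "A \<in> sets M" for A
  proof (rule antisym)
    show "(SUP B\<in>{B \<in> sets M. B \<subseteq> A}. ennreal (\<nu> B)) \<le> ennreal (\<nu> (A \<inter> Y))"
    proof (intro SUP_least ennreal_leI)
      fix B assume "B \<in> {B \<in> sets M. B \<subseteq> A}"
      then have B: "B \<in> sets M" "B \<subseteq> A" by auto
      have "\<nu> ((B \<inter> Y) \<union> (B - Y)) = \<nu> (B \<inter> Y) + \<nu> (B - Y)"
        using B Y by (intro finite_signed_measure_Un[OF \<nu>]) auto
      moreover have "\<nu> ((B \<inter> Y) \<union> ((A - B) \<inter> Y)) = \<nu> (B \<inter> Y) + \<nu> ((A - B) \<inter> Y)"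
        using A B Y by (intro finite_signed_measure_Un[OF \<nu>]) auto
      moreover have "(B \<inter> Y) \<union> (B - Y) = B" "(B \<inter> Y) \<union> ((A - B) \<inter> Y) = A \<inter> Y"
        using B by auto
      moreover have "\<nu> (B - Y) \<le> 0" "0 \<le> \<nu> ((A - B) \<inter> Y)"
        using A B Y by (auto intro!: neg pos)
      ultimately show "\<nu> B \<le> \<nu> (A \<inter> Y)" by simp
    qed
    show "ennreal (\<nu> (A \<inter> Y)) \<le> (SUP B\<in>{B \<in> sets M. B \<subseteq> A}. ennreal (\<nu> B))"
      using A Y by (intro SUP_upper) auto
  qed
  have "jordan_pos M \<nu> = measure_of (space M) (sets M) (\<lambda>A. ennreal (\<nu> (A \<inter> Y)))"
    unfolding jordan_pos_def
    by (intro measure_of_eq) (auto simp: sets.space_closed sets.sigma_sets_eq eq)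
  moreover have "emeasure (measure_of (space M) (sets M) (\<lambda>A. ennreal (\<nu> (A \<inter> Y)))) A = ennreal (\<nu> (A \<inter> Y))"
  proof (rule emeasure_measure_of_sigma)
    show "countably_additive (sets M) (\<lambda>A. ennreal (\<nu> (A \<inter> Y)))"
    proof (rule countably_additiveI)
      fix B :: "nat \<Rightarrow> 'a set" assume B: "range B \<subseteq> sets M" "disjoint_family B"
      then have "range (\<lambda>i. B i \<inter> Y) \<subseteq> sets M" "disjoint_family (\<lambda>i. B i \<inter> Y)"
        using Y by (auto simp: disjoint_family_on_def)
      then have "(\<lambda>i. \<nu> (B i \<inter> Y)) sums \<nu> (\<Union>i. B i \<inter> Y)"
        using \<nu> unfolding finite_signed_measure_def by blast
      moreover have "(\<Union>i. B i \<inter> Y) = (\<Union>i. B i) \<inter> Y" by auto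
      ultimately show "(\<Sum>i. ennreal (\<nu> (B i \<inter> Y))) = ennreal (\<nu> ((\<Union>i. B i) \<inter> Y))"
        using B Y by (intro suminf_ennreal_eq) (auto intro!: pos)
    qed
    show "positive (sets M) (\<lambda>A. ennreal (\<nu> (A \<inter> Y)))"
      using \<nu> by (simp add: positive_def finite_signed_measure_def)
  qed (use A sets.sigma_algebra_axioms in auto)
  ultimately show ?thesis
    using A Y by (simp add: measure_def pos)
qed

lemma finite_signed_measure_diff:
  assumes "finite_measure M1" "finite_measure M2" "sets M1 = sets M" "sets M2 = sets M"
  shows "finite_signed_measure M (\<lambda>A. measure M1 A - measure M2 A)"
  using assms by (auto simp: finite_signed_measure_def intro!: sums_diff finite_measure.finite_measure_UNION)

text \<open>\<open>M1\<close> and \<open>M2\<close> may overlap, so they need not be the Jordan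
  parts of their difference. A Hahn set identifies those parts, and additivity over it and its
  complement recovers the value.\<close>

lemma signed_integral_indicator:
  assumes M: "finite_measure M1" "finite_measure M2" "sets M1 = sets M" "sets M2 = sets M"
    and B: "B \<in> sets M"
  shows "signed_integral M (\<lambda>A. measure M1 A - measure M2 A) (indicator B) = measure M1 B - measure M2 B"
proof -
  interpret M1: finite_measure M1 by fact
  interpret M2: finite_measure M2 by fact
  let ?\<nu> = "\<lambda>A. measure M1 A - measure M2 A"
  note sm = finite_signed_measure_diff[OF M]
  obtain Y where Y: "Y \<in> sets M" "\<And>X. X \<in> sets M \<Longrightarrow> X \<subseteq> Y \<Longrightarrow> 0 \<le> ?\<nu> X"
      "\<And>X. X \<in> sets M \<Longrightarrow> X \<inter> Y = {} \<Longrightarrow> ?\<nu> X \<le> 0"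
    using finite_unsigned_Hahn_decomposition[OF M(1,2)] M(3,4)
    by (auto simp: M1.emeasure_eq_measure M2.emeasure_eq_measure)
  have "measure (jordan_pos M ?\<nu>) B = ?\<nu> (B \<inter> Y)"
    using sm Y B by (intro measure_jordan_pos) auto
  moreover have "measure (jordan_neg M ?\<nu>) B = - ?\<nu> (B \<inter> (space M - Y))"
    unfolding jordan_neg_def
  proof (rule measure_jordan_pos)
    fix X assume X: "X \<in> sets M"
    show "0 \<le> - ?\<nu> X" if "X \<subseteq> space M - Y" using X that by (subst neg_0_le_iff_le) (intro Y, auto)
    show "- ?\<nu> X \<le> 0" if "X \<inter> (space M - Y) = {}"
      using X that sets.sets_into_space[OF X] by (subst neg_le_0_iff_le) (intro Y, auto)
  qed (use finite_signed_measure_uminus[OF sm] Y B in auto)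
  moreover have "?\<nu> ((B \<inter> Y) \<union> (B \<inter> (space M - Y))) = ?\<nu> (B \<inter> Y) + ?\<nu> (B \<inter> (space M - Y))"
    using Y B by (intro finite_signed_measure_Un[OF sm]) auto
  moreover have "(B \<inter> Y) \<union> (B \<inter> (space M - Y)) = B"
    using sets.sets_into_space[OF B] by auto
  moreover have "(\<integral>z. indicator B z \<partial>jordan_pos M \<mu>) = measure (jordan_pos M \<mu>) B" for \<mu>
    using sets.sets_into_space[OF B] by (simp add: Int_absorb2)
  ultimately show ?thesis
    by (simp add: signed_integral_def jordan_neg_def)
qed

section \<open>The positive variation of a quasi-volume\<close>

text \<open>Monotone convergence along the directed set of finite sets. Monotonicity is asked only
  above \<open>F0\<close> because refinement increases a mass only once the grid contains the lower
  corner of the box.\<close>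

lemma monotone_net_tendsto:
  fixes m :: "'b set \<Rightarrow> real"
  assumes "finite F0" and mono: "\<And>F F'. finite F' \<Longrightarrow> F0 \<subseteq> F \<Longrightarrow> F \<subseteq> F' \<Longrightarrow> m F \<le> m F'"
    and bound: "\<And>F. finite F \<Longrightarrow> m F \<le> V"
  shows "\<exists>L. (m \<longlongrightarrow> L) (finite_subsets_at_top UNIV)"
proof
  let ?S = "{F. finite F \<and> F0 \<subseteq> F}"
  have bdd: "bdd_above (m ` ?S)" using bound by (intro bdd_aboveI[of _ V]) auto
  have ne: "?S \<noteq> {}" using assms(1) by auto
  show "(m \<longlongrightarrow> (SUP F\<in>?S. m F)) (finite_subsets_at_top UNIV)"
  proof (rule order_tendstoI)
    fix a assume "a < (SUP F\<in>?S. m F)"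
    then obtain F where F: "finite F" "F0 \<subseteq> F" "a < m F" using less_cSUP_iff[OF ne bdd] by auto
    then show "eventually (\<lambda>F. a < m F) (finite_subsets_at_top UNIV)"
      unfolding eventually_finite_subsets_at_top
      by (intro exI[of _ F]) (auto intro: less_le_trans mono)
  next
    fix a assume a: "(SUP F\<in>?S. m F) < a"
    have "m F < a" if "finite F" "F0 \<subseteq> F" for F
      using cSUP_upper[OF _ bdd, of F] that a by auto
    then show "eventually (\<lambda>F. m F < a) (finite_subsets_at_top UNIV)"
      unfolding eventually_finite_subsets_at_top using assms(1) by (intro exI[of _ F0]) auto
  qed
qed

locale bounded_vitali =
  fixes J :: "'i set" and g :: "('i \<Rightarrow> real) \<Rightarrow> real" and V :: real
  assumes J: "finite J" "J \<noteq> {}"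
    and V: "vitali J g \<le> ennreal V" "0 \<le> V"
    and right_cont: "\<And>x i. i \<in> J \<Longrightarrow> ((\<lambda>t. g (restrict (x(i := t)) J)) \<longlongrightarrow> g (restrict x J)) (at_right (x i))"
begin

text \<open>Grids are indexed by finite subsets of \<open>'i \<times> real\<close>, so that \<open>finite_subsets_at_top\<close> is the
  filter of grid refinement.\<close>

definition slices :: "('i \<times> real) set \<Rightarrow> 'i \<Rightarrow> real set" where
  "slices F j = F `` {j}"

abbreviation mass :: "('i \<Rightarrow> real set) \<Rightarrow> ('i \<Rightarrow> real) \<Rightarrow> ('i \<Rightarrow> real) \<Rightarrow> real" where
  "mass \<equiv> grid_mass (max 0) J g"

definition pos_variation :: "('i \<Rightarrow> real) \<Rightarrow> ('i \<Rightarrow> real) \<Rightarrow> real" where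
  "pos_variation u v = Lim (finite_subsets_at_top UNIV) (\<lambda>F. mass (slices F) u v)"

lemma finite_slices: "finite F \<Longrightarrow> finite (slices F j)"
  by (simp add: slices_def finite_Image)

lemma slices_mono: "F \<subseteq> F' \<Longrightarrow> slices F j \<subseteq> slices F' j"
  by (auto simp: slices_def)

lemma finite_Sigma_J: "(\<And>j. j \<in> J \<Longrightarrow> finite (G j)) \<Longrightarrow> finite (Sigma J G)"
  using J by auto

lemma mass_refine:
  "(\<And>j. j \<in> J \<Longrightarrow> finite (F' j)) \<Longrightarrow> (\<And>j. j \<in> J \<Longrightarrow> F j \<subseteq> F' j) \<Longrightarrow> (\<And>j. j \<in> J \<Longrightarrow> u j \<in> F j) \<Longrightarrow>
    mass F u v \<le> mass F' u v"
  using J by (intro grid_mass_refine) auto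

lemma mass_nonneg: "0 \<le> mass F u v"
  unfolding grid_mass_def by (intro sum_nonneg) auto

lemma mass_le: "(\<And>j. j \<in> J \<Longrightarrow> finite (F j)) \<Longrightarrow> mass F u v \<le> V"
  by (intro grid_mass_le_vitali J V) auto

lemma pos_variation_tendsto:
  "((\<lambda>F. mass (slices F) u v) \<longlongrightarrow> pos_variation u v) (finite_subsets_at_top UNIV)"
proof -
  have "\<exists>L. ((\<lambda>F. mass (slices F) u v) \<longlongrightarrow> L) (finite_subsets_at_top UNIV)"
  proof (rule monotone_net_tendsto)
    show "finite (SIGMA j:J. {u j})" using J by auto
    fix F F' assume "finite F'" "(SIGMA j:J. {u j}) \<subseteq> F" "F \<subseteq> F'"
    then show "mass (slices F) u v \<le> mass (slices F') u v"
      by (intro mass_refine finite_slices slices_mono) (auto simp: slices_def)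
  next
    fix F :: "('i \<times> real) set" assume "finite F"
    then show "mass (slices F) u v \<le> V" by (intro mass_le finite_slices)
  qed
  then show ?thesis
    unfolding pos_variation_def by (auto simp: tendsto_Lim)
qed

lemma eventually_grid: "eventually (\<lambda>F. finite F \<and> F0 \<subseteq> F) (finite_subsets_at_top UNIV)" if "finite F0"
  using that by (auto simp: eventually_finite_subsets_at_top)

lemma pos_variation_nonneg: "0 \<le> pos_variation u v"
  by (rule tendsto_lowerbound[OF pos_variation_tendsto]) (auto intro: mass_nonneg)

lemma pos_variation_le: "pos_variation u v \<le> V"
  by (rule tendsto_upperbound[OF pos_variation_tendsto])
    (auto intro!: eventually_mono[OF eventually_grid[of "{}"]] mass_le finite_slices)

lemma mass_le_pos_variation:
  assumes "\<And>j. j \<in> J \<Longrightarrow> finite (F j)" "\<And>j. j \<in> J \<Longrightarrow> u j \<in> F j"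
  shows "mass F u v \<le> pos_variation u v"
proof (rule tendsto_lowerbound[OF pos_variation_tendsto])
  show "\<forall>\<^sub>F F' in finite_subsets_at_top UNIV. mass F u v \<le> mass (slices F') u v"
  proof (rule eventually_mono[OF eventually_grid[OF finite_Sigma_J]])
    fix F' assume "finite F' \<and> Sigma J F \<subseteq> F'"
    then show "mass F u v \<le> mass (slices F') u v"
      using assms by (intro mass_refine finite_slices) (auto simp: slices_def)
  qed (use assms in auto)
qed auto

lemma pos_variation_approx:
  assumes "0 < \<eta>" "\<And>j. j \<in> J \<Longrightarrow> finite (G j)"
  obtains F where "\<And>j. j \<in> J \<Longrightarrow> finite (F j)" "\<And>j. j \<in> J \<Longrightarrow> G j \<subseteq> F j" "pos_variation u v - \<eta> < mass F u v"
proof -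
  have "eventually (\<lambda>F. pos_variation u v - \<eta> < mass (slices F) u v) (finite_subsets_at_top UNIV)"
    using assms(1) by (intro order_tendstoD[OF pos_variation_tendsto]) auto
  moreover note eventually_grid[OF finite_Sigma_J[OF assms(2)]]
  ultimately have "eventually (\<lambda>F. pos_variation u v - \<eta> < mass (slices F) u v \<and> finite F \<and> Sigma J G \<subseteq> F)
      (finite_subsets_at_top UNIV)"
    by (rule eventually_conj)
  then obtain F where "pos_variation u v - \<eta> < mass (slices F) u v" "finite F" "Sigma J G \<subseteq> F"
    using eventually_happens'[OF finite_subsets_at_top_neq_bot] by blast
  then show thesis
    by (intro that[of "slices F"]) (auto simp: slices_def finite_slices[unfolded slices_def])
qed

text \<open>Families of boxes are compared by how often they cover each point, and the comparison
  survives the limit over grids. Monotonicity, sub- and superadditivity and independence of the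
  corners chosen for a box are all special cases.\<close>

lemma pos_variation_mono:
  assumes "\<And>x. x \<in> J \<rightarrow>\<^sub>E UNIV \<Longrightarrow>
      (\<Sum>i\<in>I. indicator (box_Ioc J (u i) (v i)) x) \<le> (\<Sum>k\<in>K. indicator (box_Ioc J (u' k) (v' k)) x :: real)"
  shows "(\<Sum>i\<in>I. pos_variation (u i) (v i)) \<le> (\<Sum>k\<in>K. pos_variation (u' k) (v' k))"
proof (rule tendsto_le)
  show "((\<lambda>F. \<Sum>i\<in>I. mass (slices F) (u i) (v i)) \<longlongrightarrow> (\<Sum>i\<in>I. pos_variation (u i) (v i))) (finite_subsets_at_top UNIV)"
    by (intro tendsto_sum pos_variation_tendsto)
  show "((\<lambda>F. \<Sum>i\<in>K. mass (slices F) (u' i) (v' i)) \<longlongrightarrow> (\<Sum>i\<in>K. pos_variation (u' i) (v' i))) (finite_subsets_at_top UNIV)"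
    by (intro tendsto_sum pos_variation_tendsto)
  show "\<forall>\<^sub>F F in finite_subsets_at_top UNIV.
      (\<Sum>i\<in>I. mass (slices F) (u i) (v i)) \<le> (\<Sum>i\<in>K. mass (slices F) (u' i) (v' i))"
    by (rule eventually_mono[OF eventually_grid[of "{}"]])
      (auto intro!: grid_mass_mono[OF J(1)] finite_slices assms)
qed auto

lemma pos_variation_cong:
  assumes "box_Ioc J u v = box_Ioc J u' v'"
  shows "pos_variation u v = pos_variation u' v'"
  using pos_variation_mono[where I = "{()}" and K = "{()}" and u = "\<lambda>_. u" and v = "\<lambda>_. v" and u' = "\<lambda>_. u'" and v' = "\<lambda>_. v'"]
    pos_variation_mono[where I = "{()}" and K = "{()}" and u = "\<lambda>_. u'" and v = "\<lambda>_. v'" and u' = "\<lambda>_. u" and v' = "\<lambda>_. v"]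
    assms by (intro antisym) simp_all

lemma pos_variation_empty:
  assumes "box_Ioc J u v = {}"
  shows "pos_variation u v = 0"
proof -
  have "(\<Sum>i\<in>{()}. pos_variation u v) \<le> (\<Sum>k\<in>({} :: unit set). pos_variation u v)"
    using assms by (intro pos_variation_mono) simp
  then show ?thesis using pos_variation_nonneg[of u v] by simp
qed

text \<open>The corners of \<open>box_Ioc J a (q(i := t))\<close> depend on \<open>t\<close> only through coordinate \<open>i\<close>.\<close>

lemma quasi_volume_right_cont:
  assumes "i \<in> J"
  shows "((\<lambda>t. quasi_volume J g a (q(i := t))) \<longlongrightarrow> quasi_volume J g a (q(i := c))) (at_right c)"
  unfolding quasi_volume_Pow[OF J(1)]
proof (intro tendsto_sum tendsto_mult tendsto_const)
  fix R
  let ?x = "\<lambda>t j. if j \<in> R then (q(i := t)) j else a j"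
  define x0 where "x0 = ?x c"
  show "((\<lambda>t. g (restrict (?x t) J)) \<longlongrightarrow> g (restrict (?x c) J)) (at_right c)"
  proof (cases "i \<in> R")
    case True
    then have upd: "?x t = x0(i := t)" for t by (auto simp: x0_def)
    have x0: "x0 i = c" using True by (simp add: x0_def)
    then have "x0(i := c) = x0" by auto
    then show ?thesis
      using right_cont[OF assms, of x0] unfolding upd x0 by simp
  next
    case False
    then have upd: "?x t = x0" for t by (auto simp: x0_def fun_eq_iff)
    show ?thesis unfolding upd by (rule tendsto_const)
  qed
qed

text \<open>A grid \<open>F\<close> nearly attains the positive variation of a wide slab. After
  adding \<open>t\<close> to it, the part above \<open>t\<close> keeps at least its mass on the
  grid, so by superadditivity the thin slab exceeds its own grid mass by at most
  \<open>\<eta>\<close>. That mass is a finite sum of quasi-volumes which vanish as \<open>t\<close>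
  decreases to \<open>u i\<close>, by right-continuity.\<close>

lemma pos_variation_slab:
  assumes i: "i \<in> J"
  shows "((\<lambda>t. pos_variation u (v(i := t))) \<longlongrightarrow> 0) (at_right (u i))"
proof (rule tendstoI)
  fix e :: real assume "0 < e"
  define \<eta> where "\<eta> = e / 2"
  have \<eta>: "0 < \<eta>" using \<open>0 < e\<close> by (simp add: \<eta>_def)
  \<comment> \<open>The wide slab; its thickness 1 is arbitrary, as long as it does not depend on
    \<open>t\<close>.\<close>
  define v' where "v' = v(i := u i + 1)"
  obtain F where F: "\<And>j. j \<in> J \<Longrightarrow> finite (F j)" "\<And>j. j \<in> J \<Longrightarrow> {u j, v' j} \<subseteq> F j"
      and approx: "pos_variation u v' - \<eta> < mass F u v'"
    using pos_variation_approx[OF \<eta>, of "\<lambda>j. {u j, v' j}"] by blast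
  \<comment> \<open>Lower corners of the cells in the layer next to the face at \<open>u i\<close>:
    the predecessor in the other coordinates, \<open>u i\<close> itself in coordinate
    \<open>i\<close>.\<close>
  define a where "a q = (\<lambda>j. pred_in (F j) (q j))(i := u i)" for q :: "'i \<Rightarrow> real"
  define h where "h t = (\<Sum>q\<in>Pi\<^sub>E J F. \<bar>quasi_volume J g (a q) (q(i := t))\<bar>)" for t
  have "(h \<longlongrightarrow> (\<Sum>q\<in>Pi\<^sub>E J F. \<bar>quasi_volume J g (a q) (q(i := u i))\<bar>)) (at_right (u i))"
    unfolding h_def by (intro tendsto_sum tendsto_rabs quasi_volume_right_cont i)
  moreover have "quasi_volume J g (a q) (q(i := u i)) = 0" for q
    using J i by (intro quasi_volume_degenerate[of J i]) (auto simp: a_def)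
  ultimately have "(h \<longlongrightarrow> 0) (at_right (u i))" by simp
  then have "eventually (\<lambda>t. h t < \<eta>) (at_right (u i))"
    using \<eta> by (rule order_tendstoD)
  \<comment> \<open>Such a \<open>t\<close> lies below the next grid value after \<open>u i\<close>,
    so the thin slab holds a single layer of cells of the grid with \<open>t\<close> added.\<close>
  moreover have "eventually (\<lambda>t. \<forall>x\<in>F i. u i < x \<longrightarrow> t < x) (at_right (u i))"
    using F(1)[OF i] by (intro eventually_ball_finite) (auto simp: eventually_at_right_less intro: eventually_at_rightI)
  moreover have "eventually (\<lambda>t. u i < t) (at_right (u i))"
    by (simp add: eventually_at_right_less)
  moreover have "eventually (\<lambda>t. t < u i + 1) (at_right (u i))"
    by (rule eventually_at_rightI[of _ "u i + 1"]) auto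
  ultimately show "eventually (\<lambda>t. dist (pos_variation u (v(i := t))) 0 < e) (at_right (u i))"
  proof eventually_elim
    case (elim t)
    define F' where "F' = F(i := insert t (F i))"
    have F': "finite (F' j)" "F j \<subseteq> F' j" if "j \<in> J" for j using F that i by (auto simp: F'_def)
    have ti: "t \<in> F' i" by (simp add: F'_def)
    have uF: "u j \<in> F j" if "j \<in> J" for j using F that by auto
    let ?u = "u(i := t)" and ?v = "v(i := t)"
    have sub: "box_Ioc J u ?v \<subseteq> box_Ioc J u v'" "box_Ioc J ?u v' \<subseteq> box_Ioc J u v'"
        "box_Ioc J u ?v \<inter> box_Ioc J ?u v' = {}" "box_Ioc J u v' \<subseteq> box_Ioc J u ?v \<union> box_Ioc J ?u v'"
    proof -
      have upd: "(\<forall>j\<in>J. u j < x j \<and> x j \<le> (w(i := s)) j) \<longleftrightarrow> (\<forall>j\<in>J - {i}. u j < x j \<and> x j \<le> w j) \<and> u i < x i \<and> x i \<le> s"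
        "(\<forall>j\<in>J. (u(i := s)) j < x j \<and> x j \<le> w j) \<longleftrightarrow> (\<forall>j\<in>J - {i}. u j < x j \<and> x j \<le> w j) \<and> s < x i \<and> x i \<le> w i"
        for x w s
        using i by auto
      have mem: "x \<in> box_Ioc J u ?v \<longleftrightarrow> x \<in> extensional J \<and> (\<forall>j\<in>J - {i}. u j < x j \<and> x j \<le> v j) \<and> u i < x i \<and> x i \<le> t"
        "x \<in> box_Ioc J u v' \<longleftrightarrow> x \<in> extensional J \<and> (\<forall>j\<in>J - {i}. u j < x j \<and> x j \<le> v j) \<and> u i < x i \<and> x i \<le> u i + 1"
        "x \<in> box_Ioc J ?u v' \<longleftrightarrow> x \<in> extensional J \<and> (\<forall>j\<in>J - {i}. u j < x j \<and> x j \<le> v j) \<and> t < x i \<and> x i \<le> u i + 1"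
        for x
        using i by (auto simp: box_Ioc_def PiE_iff upd v'_def)
      show "box_Ioc J u ?v \<subseteq> box_Ioc J u v'" "box_Ioc J ?u v' \<subseteq> box_Ioc J u v'"
        "box_Ioc J u ?v \<inter> box_Ioc J ?u v' = {}" "box_Ioc J u v' \<subseteq> box_Ioc J u ?v \<union> box_Ioc J ?u v'"
        using elim(3,4) by (auto simp: mem)
    qed
    have 1: "pos_variation u ?v + pos_variation ?u v' \<le> pos_variation u v'"
    proof -
      have "(\<Sum>b\<in>{True, False}. pos_variation (if b then u else ?u) (if b then ?v else v')) \<le> (\<Sum>b\<in>{True}. pos_variation u v')"
      proof (rule pos_variation_mono)
        fix x
        have "indicator (box_Ioc J u ?v) x + indicator (box_Ioc J ?u v') x \<le> (indicator (box_Ioc J u v') x :: real)"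
          using sub by (auto simp: indicator_def)
        then show "(\<Sum>b\<in>{True, False}. indicator (box_Ioc J (if b then u else ?u) (if b then ?v else v')) x) \<le>
            (\<Sum>b\<in>{True}. indicator (box_Ioc J u v') x :: real)"
          by simp
      qed
      then show ?thesis by simp
    qed
    have 2: "mass F' u v' \<le> mass F' u ?v + mass F' ?u v'"
    proof -
      have "(\<Sum>b\<in>{True}. mass F' u v') \<le> (\<Sum>b\<in>{True, False}. mass F' (if b then u else ?u) (if b then ?v else v'))"
      proof (rule grid_mass_mono)
        fix x
        have "indicator (box_Ioc J u v') x \<le> (indicator (box_Ioc J u ?v) x + indicator (box_Ioc J ?u v') x :: real)"
          using sub by (auto simp: indicator_def)
        then show "(\<Sum>b\<in>{True}. indicator (box_Ioc J u v') x) \<le>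
            (\<Sum>b\<in>{True, False}. indicator (box_Ioc J (if b then u else ?u) (if b then ?v else v')) x :: real)"
          by simp
      qed (use J F' in auto)
      then show ?thesis by simp
    qed
    have 3: "mass F u v' \<le> mass F' u v'"
      using F F' uF by (intro mass_refine) auto
    have 4: "mass F' ?u v' \<le> pos_variation ?u v'"
      using F' uF ti by (intro mass_le_pos_variation) (auto split: if_splits)
    have 5: "mass F' u ?v \<le> h t"
      unfolding grid_mass_def h_def
    proof (rule sum_le_included[where i = "\<lambda>q. q(i := t)"])
      show "\<forall>p\<in>\<Pi>\<^sub>E j\<in>J. F' j \<inter> {u j<..?v j}. \<exists>q\<in>Pi\<^sub>E J F. q(i := t) = p \<and>
          max 0 (cell_volume J g F' p) \<le> \<bar>quasi_volume J g (a q) (q(i := t))\<bar>"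
      proof
        fix p assume p: "p \<in> (\<Pi>\<^sub>E j\<in>J. F' j \<inter> {u j<..?v j})"
        have pi: "p i = t"
        proof -
          have "p i \<in> F' i" "u i < p i" "p i \<le> t" using PiE_mem[OF p i] by auto
          then show ?thesis using elim(2) by (force simp: F'_def)
        qed
        \<comment> \<open>\<open>p\<close> has the new value \<open>t\<close> in coordinate
          \<open>i\<close>; moving it back to \<open>u i\<close> gives a point of the old grid,
          which indexes the same cell for every \<open>t\<close>.\<close>
        define q where "q = p(i := u i)"
        have q: "q(i := t) = p" using pi by (auto simp: q_def)
        have "q \<in> Pi\<^sub>E J F"
          using p uF i by (auto simp: q_def PiE_iff F'_def extensional_def)
        moreover have "pred_in (F' i) t = u i"
        proof (rule antisym)
          have "u i \<in> F' i" using uF[OF i] F'(2)[OF i] by auto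
          then show "u i \<le> pred_in (F' i) t" using elim(3) F'(1)[OF i] by (intro le_pred_in)
          have "pred_in (F' i) t \<in> F' i" "pred_in (F' i) t < t"
            using F'(1)[OF i] ti \<open>u i \<in> F' i\<close> elim(3) by (auto intro: pred_in_mem pred_in_less)
          then show "pred_in (F' i) t \<le> u i" using elim(2) by (force simp: F'_def)
        qed
        then have "cell_volume J g F' p = quasi_volume J g (a q) p"
          unfolding cell_volume_def using J pi
          by (intro quasi_volume_cong) (auto simp: a_def q_def F'_def)
        ultimately show "\<exists>q\<in>Pi\<^sub>E J F. q(i := t) = p \<and>
            max 0 (cell_volume J g F' p) \<le> \<bar>quasi_volume J g (a q) (q(i := t))\<bar>"
          using q by (intro bexI[of _ q]) auto
      qed
    qed (use J F F' in \<open>auto intro!: finite_PiE\<close>)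
    have "pos_variation u ?v < e"
      using 1 2 3 4 5 approx elim(1) by (simp add: \<eta>_def)
    then show ?case using pos_variation_nonneg[of u ?v] by simp
  qed
qed

lemma pos_variation_slab_0:
  assumes "i \<in> J"
  shows "((\<lambda>\<delta>. pos_variation u (v(i := \<delta> + u i))) \<longlongrightarrow> 0) (at_right 0)"
  using pos_variation_slab[OF assms, of u v] by (simp add: filterlim_at_right_to_0[of _ _ "u i"])

text \<open>The part lost by raising the lower corner is covered by one thin slab per coordinate
  along the lower faces. In the sum \<open>None\<close> stands for the shrunken box,
  \<open>Some i\<close> for the slab in coordinate \<open>i\<close>.\<close>

lemma pos_variation_shrink:
  assumes "0 < e"
  obtains \<epsilon> where "0 < \<epsilon>" "pos_variation u v \<le> pos_variation (\<lambda>j. u j + \<epsilon>) v + e"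
proof -
  have "((\<lambda>\<delta>. \<Sum>i\<in>J. pos_variation u (v(i := \<delta> + u i))) \<longlongrightarrow> (\<Sum>i\<in>J. 0)) (at_right 0)"
    by (intro tendsto_sum pos_variation_slab_0)
  then have "eventually (\<lambda>\<delta>. (\<Sum>i\<in>J. pos_variation u (v(i := \<delta> + u i))) < e) (at_right 0)"
    using assms(1) by (intro order_tendstoD) auto
  moreover have "eventually (\<lambda>\<delta>::real. 0 < \<delta>) (at_right 0)"
    by (simp add: eventually_at_right_less)
  ultimately have "eventually (\<lambda>\<delta>. (\<Sum>i\<in>J. pos_variation u (v(i := \<delta> + u i))) < e \<and> 0 < \<delta>) (at_right 0)"
    by (rule eventually_conj)
  then obtain \<epsilon> where \<epsilon>: "(\<Sum>i\<in>J. pos_variation u (v(i := \<epsilon> + u i))) < e" "0 < \<epsilon>"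
    using eventually_happens'[OF trivial_limit_at_right_real] by blast
  have "(\<Sum>_\<in>{None :: 'i option}. pos_variation u v) \<le> (\<Sum>k\<in>insert None (Some ` J).
      pos_variation (case k of None \<Rightarrow> (\<lambda>j. u j + \<epsilon>) | Some i \<Rightarrow> u) (case k of None \<Rightarrow> v | Some i \<Rightarrow> v(i := \<epsilon> + u i)))"
  proof (rule pos_variation_mono)
    fix x :: "'i \<Rightarrow> real" assume x: "x \<in> J \<rightarrow>\<^sub>E UNIV"
    have "(indicator (box_Ioc J u v) x :: real) \<le> indicator (box_Ioc J (\<lambda>j. u j + \<epsilon>) v) x +
        (\<Sum>i\<in>J. indicator (box_Ioc J u (v(i := \<epsilon> + u i))) x)"
    proof (cases "x \<in> box_Ioc J u v \<and> x \<notin> box_Ioc J (\<lambda>j. u j + \<epsilon>) v")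
      case True
      then obtain i where i: "i \<in> J" "x i \<le> u i + \<epsilon>"
        by (auto simp: box_Ioc_def PiE_iff not_less)
      then have "x \<in> box_Ioc J u (v(i := \<epsilon> + u i))"
        using True by (auto simp: box_Ioc_def PiE_iff)
      then have "1 \<le> (\<Sum>i\<in>J. indicator (box_Ioc J u (v(i := \<epsilon> + u i))) x :: real)"
        using J i member_le_sum[of i J "\<lambda>i. indicator (box_Ioc J u (v(i := \<epsilon> + u i))) x :: real"] by simp
      then show ?thesis by (simp add: indicator_def)
    next
      case False
      then have "(indicator (box_Ioc J u v) x :: real) \<le> indicator (box_Ioc J (\<lambda>j. u j + \<epsilon>) v) x"
        by (auto simp: indicator_def)
      moreover have "0 \<le> (\<Sum>i\<in>J. indicator (box_Ioc J u (v(i := \<epsilon> + u i))) x :: real)"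
        by (intro sum_nonneg) auto
      ultimately show ?thesis by linarith
    qed
    then show "(\<Sum>_\<in>{None :: 'i option}. indicator (box_Ioc J u v) x) \<le> (\<Sum>k\<in>insert None (Some ` J).
      indicator (box_Ioc J (case k of None \<Rightarrow> (\<lambda>j. u j + \<epsilon>) | Some i \<Rightarrow> u) (case k of None \<Rightarrow> v | Some i \<Rightarrow> v(i := \<epsilon> + u i))) x :: real)"
      using J by (simp add: sum.reindex)
  qed
  then show thesis
    using J \<epsilon> by (intro that[of \<epsilon>]) (auto simp: sum.reindex)
qed

lemma pos_variation_enlarge:
  assumes "0 < e"
  obtains \<delta> where "0 < \<delta>" "pos_variation u (\<lambda>j. v j + \<delta>) \<le> pos_variation u v + e"
proof -
  \<comment> \<open>Slabs along the upper faces. They reach up to \<open>v j + 1\<close> in the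
    other coordinates, so that only coordinate \<open>i\<close> moves with \<open>\<delta>\<close>;
    they cover the added part because \<open>\<delta> < 1\<close>.\<close>
  let ?u = "\<lambda>i. u(i := v i)" and ?v = "\<lambda>\<delta> i. (\<lambda>j. v j + 1)(i := \<delta> + v i)"
  have "((\<lambda>\<delta>. pos_variation (?u i) (?v \<delta> i)) \<longlongrightarrow> 0) (at_right 0)" if "i \<in> J" for i
    using pos_variation_slab_0[OF that, of "?u i"] by simp
  then have "((\<lambda>\<delta>. \<Sum>i\<in>J. pos_variation (?u i) (?v \<delta> i)) \<longlongrightarrow> (\<Sum>i\<in>J. 0)) (at_right 0)"
    by (intro tendsto_sum)
  then have "eventually (\<lambda>\<delta>. (\<Sum>i\<in>J. pos_variation (?u i) (?v \<delta> i)) < e) (at_right 0)"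
    using assms(1) by (intro order_tendstoD) auto
  moreover have "eventually (\<lambda>\<delta>::real. 0 < \<delta> \<and> \<delta> < 1) (at_right 0)"
    by (rule eventually_at_rightI[of _ 1]) auto
  ultimately have "eventually (\<lambda>\<delta>. (\<Sum>i\<in>J. pos_variation (?u i) (?v \<delta> i)) < e \<and> 0 < \<delta> \<and> \<delta> < 1) (at_right 0)"
    by (rule eventually_conj)
  then obtain \<delta> where \<delta>: "(\<Sum>i\<in>J. pos_variation (?u i) (?v \<delta> i)) < e" "0 < \<delta>" "\<delta> < 1"
    using eventually_happens'[OF trivial_limit_at_right_real] by blast
  have "(\<Sum>_\<in>{None :: 'i option}. pos_variation u (\<lambda>j. v j + \<delta>)) \<le> (\<Sum>k\<in>insert None (Some ` J).
      pos_variation (case k of None \<Rightarrow> u | Some i \<Rightarrow> ?u i) (case k of None \<Rightarrow> v | Some i \<Rightarrow> ?v \<delta> i))"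
  proof (rule pos_variation_mono)
    fix x :: "'i \<Rightarrow> real" assume x: "x \<in> J \<rightarrow>\<^sub>E UNIV"
    have "(indicator (box_Ioc J u (\<lambda>j. v j + \<delta>)) x :: real) \<le> indicator (box_Ioc J u v) x +
        (\<Sum>i\<in>J. indicator (box_Ioc J (?u i) (?v \<delta> i)) x)"
    proof (cases "x \<in> box_Ioc J u (\<lambda>j. v j + \<delta>) \<and> x \<notin> box_Ioc J u v")
      case True
      then obtain i where i: "i \<in> J" "v i < x i"
        by (auto simp: box_Ioc_def PiE_iff not_le)
      then have "x \<in> box_Ioc J (?u i) (?v \<delta> i)"
        using True \<delta> by (fastforce simp: box_Ioc_def PiE_iff)
      then have "1 \<le> (\<Sum>i\<in>J. indicator (box_Ioc J (?u i) (?v \<delta> i)) x :: real)"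
        using J i member_le_sum[of i J "\<lambda>i. indicator (box_Ioc J (?u i) (?v \<delta> i)) x :: real"] by simp
      then show ?thesis by (simp add: indicator_def)
    next
      case False
      then have "(indicator (box_Ioc J u (\<lambda>j. v j + \<delta>)) x :: real) \<le> indicator (box_Ioc J u v) x"
        by (auto simp: indicator_def)
      moreover have "0 \<le> (\<Sum>i\<in>J. indicator (box_Ioc J (?u i) (?v \<delta> i)) x :: real)"
        by (intro sum_nonneg) auto
      ultimately show ?thesis by linarith
    qed
    then show "(\<Sum>_\<in>{None :: 'i option}. indicator (box_Ioc J u (\<lambda>j. v j + \<delta>)) x) \<le> (\<Sum>k\<in>insert None (Some ` J).
      indicator (box_Ioc J (case k of None \<Rightarrow> u | Some i \<Rightarrow> ?u i) (case k of None \<Rightarrow> v | Some i \<Rightarrow> ?v \<delta> i)) x :: real)"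
      using J by (simp add: sum.reindex)
  qed
  then show thesis
    using J \<delta> by (intro that[of \<delta>]) (auto simp: sum.reindex)
qed

end

section \<open>Extension to a Borel measure\<close>

lemma box_Ioc_Int:
  "box_Ioc J u v \<inter> box_Ioc J u' v' = box_Ioc J (\<lambda>j. max (u j) (u' j)) (\<lambda>j. min (v j) (v' j))"
  by (auto simp: box_Ioc_def PiE_iff)

text \<open>A box with corners in the wrong order is empty and is represented here by an ordered,
  degenerate pair.\<close>

lemma box_Ioc_clip: "box_Ioc J u v = box_Ioc J u (\<lambda>j. max (u j) (v j))"
proof -
  have "{u j<..v j} = {u j<..max (u j) (v j)}" for j by auto
  then show ?thesis by (simp add: box_Ioc_def)
qed

abbreviation "ordered_corners J \<equiv> {(u, v). \<forall>j\<in>J. u j \<le> v j}"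

text \<open>The corner coordinates of two boxes form a grid whose cells are inside or outside each
  of them; the difference is the disjoint union of the cells with upper corner in
  \<open>A - B\<close>.\<close>

lemma semiring_box_Ioc:
  assumes "finite J" "J \<noteq> {}"
  shows "semiring_of_sets (J \<rightarrow>\<^sub>E UNIV) ((\<lambda>(u, v). box_Ioc J u v) ` (ordered_corners J :: (('i \<Rightarrow> real) \<times> ('i \<Rightarrow> real)) set))"
    (is "semiring_of_sets _ ?M")
proof
  show "?M \<subseteq> Pow (J \<rightarrow>\<^sub>E UNIV)" by (auto simp: box_Ioc_def PiE_iff)
  have box: "box_Ioc J u v \<in> ?M" for u v
    by (subst box_Ioc_clip) (auto intro!: image_eqI[where x = "(u, \<lambda>j. max (u j) (v j))"])
  have E: "box_Ioc J (\<lambda>_. 0) (\<lambda>_. 0) = {}" using assms by (auto simp: box_Ioc_def PiE_iff)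
  show "{} \<in> ?M" using box[of "\<lambda>_. 0" "\<lambda>_. 0"] unfolding E .
  show "A \<inter> B \<in> ?M" if "A \<in> ?M" "B \<in> ?M" for A B
    using that box by (auto simp: box_Ioc_Int)
  fix A B assume "A \<in> ?M" "B \<in> ?M"
  then obtain u v u' v' where A: "A = box_Ioc J u v" and B: "B = box_Ioc J u' v'" by auto
  define F where "F j = {u j, v j, u' j, v' j}" for j
  let ?P = "Pi\<^sub>E J F \<inter> (A - B)"
  have fin: "finite (F j)" for j by (simp add: F_def)
  show "\<exists>C\<subseteq>?M. finite C \<and> disjoint C \<and> A - B = \<Union>C"
  proof (intro exI[of _ "grid_cell J F ` ?P"] conjI)
    show "grid_cell J F ` ?P \<subseteq> ?M" using box by auto
    show "finite (grid_cell J F ` ?P)" using assms fin by (intro finite_imageI finite_Int disjI1 finite_PiE)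
    show "disjoint (grid_cell J F ` ?P)"
    proof (rule disjointI)
      fix X Y assume XY: "X \<in> grid_cell J F ` ?P" "Y \<in> grid_cell J F ` ?P" "X \<noteq> Y"
      then obtain p q where "p \<in> Pi\<^sub>E J F" "q \<in> Pi\<^sub>E J F" "X = grid_cell J F p" "Y = grid_cell J F q" by auto
      with XY(3) show "X \<inter> Y = {}" using grid_cell_disjoint[of J F p q] fin by auto
    qed
    have mem: "q \<in> A \<longleftrightarrow> p \<in> A" "q \<in> B \<longleftrightarrow> p \<in> B" if "p \<in> Pi\<^sub>E J F" "q \<in> grid_cell J F p" for p q
      unfolding A B using that by (intro grid_cell_mem_box_iff[of J F]; simp add: F_def)+
    have "\<exists>p\<in>Pi\<^sub>E J F. q \<in> grid_cell J F p" if "q \<in> A" for q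
      using that unfolding A by (intro ex_grid_cell) (auto simp: F_def)
    then show "A - B = \<Union> (grid_cell J F ` ?P)"
      using mem by blast
  qed
qed

context bounded_vitali begin

text \<open>One inequality is superadditivity. For the other, the box is shrunk into a compact one
  and the members of the family are enlarged to open ones; a finite subcover and subadditivity leave
  an error of \<open>e\<close>, half from each side.\<close>

lemma pos_variation_suminf:
  fixes A :: "nat \<Rightarrow> ('i \<Rightarrow> real) \<times> ('i \<Rightarrow> real)"
  assumes disj: "disjoint_family (\<lambda>n. box_Ioc J (fst (A n)) (snd (A n)))"
    and Un: "(\<Union>n. box_Ioc J (fst (A n)) (snd (A n))) = box_Ioc J u v"
  shows "(\<Sum>n. ennreal (pos_variation (fst (A n)) (snd (A n)))) = ennreal (pos_variation u v)"
proof (rule antisym)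
  let ?u = "\<lambda>n. fst (A n)" and ?v = "\<lambda>n. snd (A n)"
  show "(\<Sum>n. ennreal (pos_variation (?u n) (?v n))) \<le> ennreal (pos_variation u v)"
    unfolding suminf_eq_SUP
  proof (rule SUP_least)
    fix N
    have "(\<Sum>n<N. pos_variation (?u n) (?v n)) \<le> (\<Sum>_\<in>{()}. pos_variation u v)"
    proof (rule pos_variation_mono)
      fix x
      have "(\<Sum>n<N. indicator (box_Ioc J (?u n) (?v n)) x) = (indicator (\<Union>n<N. box_Ioc J (?u n) (?v n)) x :: real)"
        using disj by (intro indicator_UN_disjoint[symmetric]) (auto simp: disjoint_family_on_def)
      also have "\<dots> \<le> indicator (box_Ioc J u v) x"
        using Un by (auto simp: indicator_def)
      finally show "(\<Sum>n<N. indicator (box_Ioc J (?u n) (?v n)) x) \<le> (\<Sum>_\<in>{()}. indicator (box_Ioc J u v) x :: real)"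
        by simp
    qed
    then show "(\<Sum>n<N. ennreal (pos_variation (?u n) (?v n))) \<le> ennreal (pos_variation u v)"
      by (simp add: pos_variation_nonneg sum_ennreal ennreal_leI)
  qed
  show "ennreal (pos_variation u v) \<le> (\<Sum>n. ennreal (pos_variation (?u n) (?v n)))"
  proof (rule ennreal_le_epsilon)
    fix e :: real assume e: "0 < e"
    obtain \<epsilon> where \<epsilon>: "0 < \<epsilon>" "pos_variation u v \<le> pos_variation (\<lambda>j. u j + \<epsilon>) v + e / 2"
      using pos_variation_shrink[of "e / 2" u v] e by auto
    \<comment> \<open>A geometric series with sum \<open>e / 2\<close>.\<close>
    define c where "c n = (e / 2) * (1 / 2) ^ Suc n" for n
    have c: "0 < c n" for n using e by (simp add: c_def)
    have "\<exists>\<delta>>0. pos_variation (?u n) (\<lambda>j. ?v n j + \<delta>) \<le> pos_variation (?u n) (?v n) + c n" for n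
      using pos_variation_enlarge[OF c, of "?u n" "?v n" n] by metis
    then obtain \<delta> where \<delta>: "\<And>n. 0 < \<delta> n"
        "\<And>n. pos_variation (?u n) (\<lambda>j. ?v n j + \<delta> n) \<le> pos_variation (?u n) (?v n) + c n"
      by metis
    let ?X = "product_topology (\<lambda>_. euclideanreal) J"
    \<comment> \<open>The closed box contains the shrunken half-open one and is still contained in
      the original, which the family covers.\<close>
    define K where "K = (\<Pi>\<^sub>E j\<in>J. {u j + \<epsilon>..v j})"
    define G where "G n = (\<Pi>\<^sub>E j\<in>J. {?u n j<..<?v n j + \<delta> n})" for n
    have "compactin ?X K"
      by (simp add: K_def compactin_PiE)
    moreover have "\<forall>U\<in>range G. openin ?X U"
      using J by (auto simp: G_def openin_PiE)
    moreover have "K \<subseteq> \<Union> (range G)"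
    proof
      fix x assume x: "x \<in> K"
      then have "x \<in> box_Ioc J u v" using \<epsilon> by (force simp: K_def box_Ioc_def PiE_iff)
      then obtain n where "x \<in> box_Ioc J (?u n) (?v n)" using Un by auto
      then have "x \<in> G n" using \<delta>(1)[of n] by (force simp: G_def box_Ioc_def PiE_iff)
      then show "x \<in> \<Union> (range G)" by auto
    qed
    ultimately obtain \<F> where \<F>: "finite \<F>" "\<F> \<subseteq> range G" "K \<subseteq> \<Union>\<F>"
      unfolding compactin_def by meson
    then obtain D where D: "finite D" "\<F> = G ` D"
      by (meson finite_subset_image subset_UNIV)
    have "(\<Sum>_\<in>{()}. pos_variation (\<lambda>j. u j + \<epsilon>) v) \<le> (\<Sum>n\<in>D. pos_variation (?u n) (\<lambda>j. ?v n j + \<delta> n))"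
    proof (rule pos_variation_mono)
      fix x
      have "(indicator (box_Ioc J (\<lambda>j. u j + \<epsilon>) v) x :: real) \<le> (\<Sum>n\<in>D. indicator (box_Ioc J (?u n) (\<lambda>j. ?v n j + \<delta> n)) x)"
      proof (cases "x \<in> box_Ioc J (\<lambda>j. u j + \<epsilon>) v")
        case True
        then have "x \<in> K" by (auto simp: K_def box_Ioc_def PiE_iff)
        then obtain n where n: "n \<in> D" "x \<in> G n" using \<F> D by auto
        then have "x \<in> box_Ioc J (?u n) (\<lambda>j. ?v n j + \<delta> n)"
          by (auto simp: G_def box_Ioc_def PiE_iff)
        then show ?thesis
          using member_le_sum[of n D "\<lambda>n. indicator (box_Ioc J (?u n) (\<lambda>j. ?v n j + \<delta> n)) x :: real"] n D
          by (simp add: indicator_def)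
      qed (auto intro!: sum_nonneg)
      then show "(\<Sum>_\<in>{()}. indicator (box_Ioc J (\<lambda>j. u j + \<epsilon>) v) x) \<le>
          (\<Sum>n\<in>D. indicator (box_Ioc J (?u n) (\<lambda>j. ?v n j + \<delta> n)) x :: real)" by simp
    qed
    also have "\<dots> \<le> (\<Sum>n\<in>D. pos_variation (?u n) (?v n) + c n)"
      by (intro sum_mono \<delta>)
    also have "\<dots> = (\<Sum>n\<in>D. pos_variation (?u n) (?v n)) + (\<Sum>n\<in>D. c n)"
      by (rule sum.distrib)
    also have "(\<Sum>n\<in>D. c n) \<le> (\<Sum>n. c n)"
      using D c unfolding c_def
      by (intro sum_le_suminf summable_mult) (auto intro: less_imp_le summable_ignore_initial_segment[of _ 1, simplified] simp: summable_geometric)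
    also have "(\<Sum>n. c n) = e / 2"
      unfolding c_def using power_half_series by (subst suminf_mult) (auto simp: sums_iff)
    finally have "pos_variation u v \<le> (\<Sum>n\<in>D. pos_variation (?u n) (?v n)) + e"
      using \<epsilon> by simp
    then have "ennreal (pos_variation u v) \<le> ennreal ((\<Sum>n\<in>D. pos_variation (?u n) (?v n)) + e)"
      by (rule ennreal_leI)
    also have "\<dots> = (\<Sum>n\<in>D. ennreal (pos_variation (?u n) (?v n))) + ennreal e"
      using e by (simp add: ennreal_plus sum_nonneg pos_variation_nonneg sum_ennreal)
    also have "(\<Sum>n\<in>D. ennreal (pos_variation (?u n) (?v n))) \<le> (\<Sum>n. ennreal (pos_variation (?u n) (?v n)))"
      using D by (intro sum_le_suminf) auto
    finally show "ennreal (pos_variation u v) \<le> (\<Sum>n. ennreal (pos_variation (?u n) (?v n))) + ennreal e"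
      by (simp add: add_right_mono)
  qed
qed

text \<open>Caratheodory's theorem gives a measure on the \<sigma>-algebra generated by the boxes.
  Half-spaces belong to it, so the identity into the product Borel space is measurable, and
  \<open>M\<close> is the image measure.\<close>

lemma ex_measure_pos_variation:
  "\<exists>M. finite_measure M \<and> sets M = sets (Pi\<^sub>M J (\<lambda>_. borel)) \<and>
    (\<forall>u v. (\<forall>j\<in>J. u j \<le> v j) \<longrightarrow> measure M (box_Ioc J u v) = pos_variation u v)"
proof -
  let ?G = "\<lambda>(u, v). box_Ioc J u v"
  let ?I = "ordered_corners J :: (('i \<Rightarrow> real) \<times> ('i \<Rightarrow> real)) set"
  define N where "N = extend_measure (J \<rightarrow>\<^sub>E UNIV) ?I ?G (\<lambda>(u, v). ennreal (pos_variation u v))"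
  have emeasure_N: "emeasure N (box_Ioc J u v) = ennreal (pos_variation u v)" if "\<forall>j\<in>J. u j \<le> v j" for u v
  proof -
    have "emeasure N (?G (u, v)) = (\<lambda>(u, v). ennreal (pos_variation u v)) (u, v)"
    proof (rule extend_measure_caratheodory[OF N_def _ semiring_box_Ioc[OF J]])
      show "(u, v) \<in> ?I" using that by simp
      show "(\<lambda>(u, v). ennreal (pos_variation u v)) i = 0" if "?G i = {}" for i
        using that by (auto simp: pos_variation_empty split: prod.splits)
      show "(\<lambda>(u, v). ennreal (pos_variation u v)) i = (\<lambda>(u, v). ennreal (pos_variation u v)) j" if "?G i = ?G j" for i j
      proof -
        have "pos_variation (fst i) (snd i) = pos_variation (fst j) (snd j)"
          using that by (intro pos_variation_cong) (simp add: case_prod_beta)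
        then show ?thesis by (simp add: case_prod_beta)
      qed
      fix A :: "nat \<Rightarrow> ('i \<Rightarrow> real) \<times> ('i \<Rightarrow> real)" and j
      assume "disjoint_family (?G \<circ> A)" "(\<Union>i. ?G (A i)) = ?G j"
      then show "(\<Sum>n. (\<lambda>(u, v). ennreal (pos_variation u v)) (A n)) = (\<lambda>(u, v). ennreal (pos_variation u v)) j"
        using pos_variation_suminf[of A "fst j" "snd j"] by (simp add: comp_def case_prod_beta)
    qed (auto simp: pos_variation_nonneg)
    then show ?thesis by simp
  qed
  have closed: "?G ` ?I \<subseteq> Pow (J \<rightarrow>\<^sub>E UNIV)" by (auto simp: box_Ioc_def PiE_iff)
  have space_N: "space N = J \<rightarrow>\<^sub>E UNIV"
    using closed by (simp add: N_def space_extend_measure)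
  have box_N: "box_Ioc J u v \<in> sets N" if "\<forall>j\<in>J. u j \<le> v j" for u v
  proof -
    have "box_Ioc J u v \<in> ?G ` ?I" using that by (auto intro!: image_eqI[where x = "(u, v)"])
    then show ?thesis using closed by (simp add: N_def sets_extend_measure sigma_sets.Basic)
  qed
  have le_nat: "\<exists>n::nat. \<forall>j\<in>J. \<bar>x j\<bar> < real n" for x
  proof -
    obtain n where "(\<Sum>j\<in>J. \<bar>x j\<bar>) < real n" using reals_Archimedean2 by blast
    moreover have "\<bar>x j\<bar> \<le> (\<Sum>j\<in>J. \<bar>x j\<bar>)" if "j \<in> J" for j
      using J that by (intro member_le_sum) auto
    ultimately show ?thesis by (meson le_less_trans)
  qed
  have ident: "(\<lambda>\<omega>. \<omega>) \<in> measurable N (Pi\<^sub>M J (\<lambda>_. borel))"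
  proof (rule measurable_PiM_single')
    fix i assume i: "i \<in> J"
    show "(\<lambda>\<omega>. \<omega> i) \<in> borel_measurable N"
      unfolding borel_measurable_iff_le
    proof
      fix a :: real
      \<comment> \<open>\<open>max (- real n) a\<close> keeps the corners ordered, as
        \<open>box_N\<close> demands; for \<open>a\<close> below \<open>- real n\<close> the box is
        empty.\<close>
      have "{w \<in> space N. w i \<le> a} = (\<Union>n::nat. box_Ioc J (\<lambda>_. - real n) ((\<lambda>_. real n)(i := max (- real n) a)))"
        (is "?L = ?R")
      proof
        show "?L \<subseteq> ?R"
        proof
          fix w assume w: "w \<in> ?L"
          obtain n where n: "\<forall>j\<in>J. \<bar>w j\<bar> < real n" using le_nat by blast
          then have "- real n < w j \<and> w j \<le> ((\<lambda>_. real n)(i := max (- real n) a)) j" if "j \<in> J" for j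
            using w bspec[OF n that] by (auto simp: abs_less_iff)
          then have "w \<in> box_Ioc J (\<lambda>_. - real n) ((\<lambda>_. real n)(i := max (- real n) a))"
            using w unfolding box_Ioc_def PiE_iff space_N by (simp del: fun_upd_apply)
          then show "w \<in> ?R" by blast
        qed
        show "?R \<subseteq> ?L"
        proof
          fix w assume "w \<in> ?R"
          then obtain n :: nat where w: "w \<in> box_Ioc J (\<lambda>_. - real n) ((\<lambda>_. real n)(i := max (- real n) a))" by auto
          then have "- real n < w i" "w i \<le> max (- real n) a" using i by (auto simp: box_Ioc_def PiE_iff dest!: bspec[of _ _ i])
          then show "w \<in> ?L" using w by (auto simp: box_Ioc_def PiE_iff space_N)
        qed
      qed
      also have "\<dots> \<in> sets N" by (intro sets.countable_UN image_subsetI box_N) auto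
      finally show "{w \<in> space N. w i \<le> a} \<in> sets N" .
    qed
  qed (auto simp: space_N)
  define M where "M = distr N (Pi\<^sub>M J (\<lambda>_. borel)) (\<lambda>\<omega>. \<omega>)"
  have box_M: "box_Ioc J u v \<in> sets (Pi\<^sub>M J (\<lambda>_. borel))" for u v
    unfolding box_Ioc_def using J by (intro sets_PiM_I_finite) auto
  have emeasure_M: "emeasure M (box_Ioc J u v) = ennreal (pos_variation u v)" if "\<forall>j\<in>J. u j \<le> v j" for u v
  proof -
    have "(\<lambda>\<omega>. \<omega>) -` box_Ioc J u v \<inter> space N = box_Ioc J u v"
      by (auto simp: space_N box_Ioc_def PiE_iff)
    then show ?thesis
      unfolding M_def using emeasure_N[OF that] by (simp add: emeasure_distr[OF ident box_M])
  qed
  have "emeasure N (space N) \<le> ennreal V"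
  proof -
    have "space N = (\<Union>n::nat. box_Ioc J (\<lambda>_. - real n) (\<lambda>_. real n))" (is "_ = (\<Union>n. ?B n)")
    proof
      show "space N \<subseteq> (\<Union>n. ?B n)"
      proof
        fix w assume w: "w \<in> space N"
        obtain n where n: "\<forall>j\<in>J. \<bar>w j\<bar> < real n" using le_nat by blast
        then have "w \<in> ?B n"
          using w by (auto simp: box_Ioc_def PiE_iff space_N abs_less_iff less_imp_le minus_less_iff)
        then show "w \<in> (\<Union>n. ?B n)" by auto
      qed
    qed (auto simp: box_Ioc_def PiE_iff space_N)
    also have "emeasure N \<dots> = (SUP n. emeasure N (?B n))"
    proof (intro SUP_emeasure_incseq[symmetric])
      show "range ?B \<subseteq> sets N" using box_N by auto
      have "{- real m<..real m} \<subseteq> {- real n<..real n}" if "m \<le> n" for m n using that by auto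
      then show "incseq ?B" unfolding incseq_def box_Ioc_def by (intro allI impI PiE_mono) blast
    qed
    also have "\<dots> \<le> ennreal V"
      by (intro SUP_least) (simp add: emeasure_N pos_variation_le ennreal_leI)
    finally show ?thesis .
  qed
  then have "finite_measure N" by (intro finite_measureI) (auto simp: top_unique)
  then have "finite_measure M" unfolding M_def using ident by (rule finite_measure.finite_measure_distr)
  moreover have "sets M = sets (Pi\<^sub>M J (\<lambda>_. borel))" by (simp add: M_def)
  moreover have "measure M (box_Ioc J u v) = pos_variation u v" if "\<forall>j\<in>J. u j \<le> v j" for u v
    using emeasure_M[OF that] by (simp add: measure_def pos_variation_nonneg)
  ultimately show ?thesis by blast
qed

end

lemma vitali_uminus: "vitali J (\<lambda>x. - g x) = vitali J g"
  by (simp add: vitali_def vitali_on_def quasi_volume_uminus)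

text \<open>On a grid through both corners the positive parts of the cell volumes of
  \<open>g\<close> and of \<open>- g\<close> differ by the cell volumes, so the difference of the
  two masses equals the quasi-volume before any limit is taken.\<close>

theorem signed_Lebesgue_Stieltjes:
  fixes g :: "('i \<Rightarrow> real) \<Rightarrow> real"
  assumes J: "finite J" "J \<noteq> {}" and V: "vitali J g < \<infinity>"
    and right_cont: "\<And>x i. i \<in> J \<Longrightarrow> ((\<lambda>t. g (restrict (x(i := t)) J)) \<longlongrightarrow> g (restrict x J)) (at_right (x i))"
  shows "\<exists>M1 M2. finite_measure M1 \<and> finite_measure M2 \<and>
    sets M1 = sets (Pi\<^sub>M J (\<lambda>_. borel)) \<and> sets M2 = sets (Pi\<^sub>M J (\<lambda>_. borel)) \<and>
    (\<forall>u v. (\<forall>j\<in>J. u j \<le> v j) \<longrightarrow>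
      quasi_volume J g u v = measure M1 (box_Ioc J u v) - measure M2 (box_Ioc J u v))"
proof -
  define C where "C = enn2real (vitali J g)"
  have C: "vitali J g \<le> ennreal C" "0 \<le> C"
    unfolding C_def using V ennreal_enn2real[of "vitali J g"] by simp_all
  interpret pos: bounded_vitali J g C
    using J C right_cont by unfold_locales auto
  interpret neg: bounded_vitali J "\<lambda>x. - g x" C
    using J C right_cont by unfold_locales (auto simp: vitali_uminus intro: tendsto_minus)
  have "pos.pos_variation u v - neg.pos_variation u v = quasi_volume J g u v" if uv: "\<forall>j\<in>J. u j \<le> v j" for u v
  proof (rule tendsto_unique[OF finite_subsets_at_top_neq_bot])
    let ?h = "\<lambda>F. pos.mass (pos.slices F) u v - neg.mass (neg.slices F) u v"
    show "(?h \<longlongrightarrow> pos.pos_variation u v - neg.pos_variation u v) (finite_subsets_at_top UNIV)"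
      by (intro tendsto_diff pos.pos_variation_tendsto neg.pos_variation_tendsto)
    have eq: "?h F = quasi_volume J g u v" if F: "finite F \<and> (SIGMA j:J. {u j, v j}) \<subseteq> F" for F
    proof -
      have "neg.slices F = pos.slices F" by (simp add: fun_eq_iff pos.slices_def neg.slices_def)
      then have "?h F = (\<Sum>p\<in>(\<Pi>\<^sub>E j\<in>J. pos.slices F j \<inter> {u j<..v j}). cell_volume J g (pos.slices F) p)"
        unfolding grid_mass_def by (simp add: cell_volume_uminus max_def flip: sum_subtractf)
          (intro sum.cong refl, simp)
      also have "\<dots> = quasi_volume J g u v"
        using J uv F
        by (intro quasi_volume_grid[symmetric] pos.finite_slices) (auto simp: pos.slices_def)
      finally show ?thesis .
    qed
    have "finite (SIGMA j:J. {u j, v j})" using J by simp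
    from eventually_mono[OF pos.eventually_grid[OF this] eq]
    have "eventually (\<lambda>F. ?h F = quasi_volume J g u v) (finite_subsets_at_top UNIV)" .
    then show "(?h \<longlongrightarrow> quasi_volume J g u v) (finite_subsets_at_top UNIV)"
      by (rule tendsto_eventually)
  qed
  then show ?thesis
    using pos.ex_measure_pos_variation neg.ex_measure_pos_variation by metis
qed

section \<open>Regularity of mixtures of product functions\<close>

text \<open>Like \<open>anchor_filter\<close>, it reads every value other than
  \<open>\<infinity>\<close> as minus infinity. One threshold \<open>N\<close> serves both
  ends.\<close>

definition beyond :: "('d \<Rightarrow> ereal) \<Rightarrow> 'd \<Rightarrow> real \<Rightarrow> real \<Rightarrow> bool" where
  "beyond a j N t \<longleftrightarrow> (if a j = \<infinity> then N \<le> t else t \<le> - N)"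

lemma eventually_anchor_filter:
  assumes "finite T"
  shows "eventually P (anchor_filter a T) \<longleftrightarrow> (\<exists>N. \<forall>y. (\<forall>j\<in>T. beyond a j N (y j)) \<longrightarrow> P y)"
proof
  let ?F = "\<lambda>j. if a j = \<infinity> then at_top else at_bot :: real filter"
  have ev: "eventually Q (?F j) \<longleftrightarrow> (\<exists>N. \<forall>t. beyond a j N t \<longrightarrow> Q t)" for Q j
  proof (cases "a j = \<infinity>")
    case False
    have "(\<exists>N. \<forall>t\<le>N. Q t) \<longleftrightarrow> (\<exists>N. \<forall>t\<le>- N. Q t)" by (metis minus_minus)
    then show ?thesis using False by (simp add: beyond_def eventually_at_bot_linorder)
  qed (simp add: beyond_def eventually_at_top_linorder)
  {
    assume "eventually P (anchor_filter a T)"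
    then obtain Q where Q: "\<forall>j\<in>T. eventually (Q j) (filtercomap (\<lambda>y. y j) (?F j))" "\<forall>y. (\<forall>j\<in>T. Q j y) \<longrightarrow> P y"
      unfolding anchor_filter_def eventually_INF_finite[OF assms] by blast
    have "\<exists>N. \<forall>y. beyond a j N (y j) \<longrightarrow> Q j y" if j: "j \<in> T" for j
    proof -
      obtain R where R: "eventually R (?F j)" "\<forall>y. R (y j) \<longrightarrow> Q j y"
        using Q(1) j unfolding eventually_filtercomap by blast
      then show ?thesis unfolding ev by blast
    qed
    then obtain N where N: "\<And>j y. j \<in> T \<Longrightarrow> beyond a j (N j) (y j) \<Longrightarrow> Q j y" by metis
    \<comment> \<open>The sum of the moduli is a threshold common to all coordinates.\<close>
    have "N j \<le> (\<Sum>j\<in>T. \<bar>N j\<bar>)" if "j \<in> T" for j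
      using member_le_sum[of j T "\<lambda>j. \<bar>N j\<bar>"] that assms by simp
    then have "beyond a j (\<Sum>j\<in>T. \<bar>N j\<bar>) t \<Longrightarrow> beyond a j (N j) t" if "j \<in> T" for j t
      using that by (force simp: beyond_def split: if_splits)
    then show "\<exists>N. \<forall>y. (\<forall>j\<in>T. beyond a j N (y j)) \<longrightarrow> P y"
      using N Q(2) by (intro exI[of _ "\<Sum>j\<in>T. \<bar>N j\<bar>"]) blast
  }
  assume "\<exists>N. \<forall>y. (\<forall>j\<in>T. beyond a j N (y j)) \<longrightarrow> P y"
  then obtain N where N: "\<forall>y. (\<forall>j\<in>T. beyond a j N (y j)) \<longrightarrow> P y" ..
  show "eventually P (anchor_filter a T)"
    unfolding anchor_filter_def eventually_INF_finite[OF assms]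
  proof (intro exI[of _ "\<lambda>j y. beyond a j N (y j)"] conjI ballI N)
    fix j
    show "eventually (\<lambda>y. beyond a j N (y j)) (filtercomap (\<lambda>y. y j) (?F j))"
      by (intro eventually_filtercomapI) (auto simp: ev)
  qed
qed

lemma anchor_filter_neq_bot: "finite T \<Longrightarrow> anchor_filter a T \<noteq> bot"
proof
  assume "finite T" "anchor_filter a T = bot"
  then have "eventually (\<lambda>_. False) (anchor_filter a T)" by simp
  then obtain N where N: "\<And>y. \<not> (\<forall>j\<in>T. beyond a j N (y j))"
    using \<open>finite T\<close> by (auto simp: eventually_anchor_filter)
  show False using N[of "\<lambda>j. if a j = \<infinity> then N else - N"] by (auto simp: beyond_def split: if_splits)
qed

lemma filterlim_anchor_filter:
  assumes "j \<in> T"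
  shows "filterlim (\<lambda>y. y j) (if a j = \<infinity> then at_top else at_bot) (anchor_filter a T)"
  unfolding filterlim_iff_le_filtercomap anchor_filter_def using assms by (rule INF_lower)

section \<open>Limit sections and linear combinations of functions satisfying (c)\<close>

lemma glue_restrict: "glue S (restrict x S) y = glue S x y"
  by (auto simp: glue_def vec_eq_iff)

lemma limit_section_eqI:
  assumes "((\<lambda>y. f (glue S x y)) \<longlongrightarrow> c) (anchor_filter a (- S))"
  shows "limit_section a S f x = c"
  unfolding limit_section_def using assms by (intro tendsto_Lim anchor_filter_neq_bot) auto

lemma limit_section_tendsto:
  assumes "limit_section_exists a S f"
  shows "((\<lambda>y. f (glue S x y)) \<longlongrightarrow> limit_section a S f x) (anchor_filter a (- S))"
proof -
  obtain c where c: "((\<lambda>y. f (glue S (restrict x S) y)) \<longlongrightarrow> c) (anchor_filter a (- S))"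
    using assms unfolding limit_section_exists_def by (metis UNIV_I restrict_PiE_iff)
  then show ?thesis by (simp add: glue_restrict limit_section_eqI)
qed

lemma limit_section_restrict: "limit_section a S f (restrict x S) = limit_section a S f x"
  by (simp add: limit_section_def glue_restrict)

lemma vitali_add_scaled_le:
  "vitali J (\<lambda>x. f x + r * g x) \<le> vitali J f + ennreal \<bar>r\<bar> * vitali J g"
  unfolding vitali_def vitali_on_def
proof (intro SUP_least, clarify, intro SUP_least)
  fix a b P assume ab: "\<forall>j\<in>J. a j < b j" and P: "P \<in> axis_splits J a b"
  have "(\<Sum>(u, v)\<in>P. \<bar>quasi_volume J (\<lambda>x. f x + r * g x) u v\<bar>) \<le>
      (\<Sum>(u, v)\<in>P. \<bar>quasi_volume J f u v\<bar> + \<bar>r\<bar> * \<bar>quasi_volume J g u v\<bar>)"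
    by (intro sum_mono) (auto simp: quasi_volume_add_scaled abs_mult intro: order_trans[OF abs_triangle_ineq])
  also have "\<dots> = (\<Sum>(u, v)\<in>P. \<bar>quasi_volume J f u v\<bar>) + \<bar>r\<bar> * (\<Sum>(u, v)\<in>P. \<bar>quasi_volume J g u v\<bar>)"
    by (simp add: sum.distrib sum_distrib_left case_prod_beta)
  finally have "ennreal (\<Sum>(u, v)\<in>P. \<bar>quasi_volume J (\<lambda>x. f x + r * g x) u v\<bar>) \<le>
      ennreal (\<Sum>(u, v)\<in>P. \<bar>quasi_volume J f u v\<bar>) + ennreal \<bar>r\<bar> * ennreal (\<Sum>(u, v)\<in>P. \<bar>quasi_volume J g u v\<bar>)"
    by (subst ennreal_mult[symmetric], (auto intro!: sum_nonneg)[2], subst ennreal_plus[symmetric])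
      (auto intro!: ennreal_leI sum_nonneg mult_nonneg_nonneg)
  also have "\<dots> \<le> (SUP (a, b)\<in>{(a, b). \<forall>j\<in>J. a j < b j}. SUP P\<in>axis_splits J a b. ennreal (\<Sum>(u, v)\<in>P. \<bar>quasi_volume J f u v\<bar>)) +
     ennreal \<bar>r\<bar> * (SUP (a, b)\<in>{(a, b). \<forall>j\<in>J. a j < b j}. SUP P\<in>axis_splits J a b. ennreal (\<Sum>(u, v)\<in>P. \<bar>quasi_volume J g u v\<bar>))"
    using ab P
    by (intro add_mono mult_left_mono; (intro SUP_upper2[of "(a, b)"])?; auto intro: SUP_upper)
  finally show "ennreal (\<Sum>(u, v)\<in>P. \<bar>quasi_volume J (\<lambda>x. f x + r * g x) u v\<bar>) \<le> \<dots>" .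
qed

text \<open>This is statement (c), named because it is closed under linear combinations; the class
  needs then to be examined for one nonnegative measure at a time.\<close>

definition st_regular :: "nat \<Rightarrow> (real ^ 'd::finite \<Rightarrow> real) \<Rightarrow> bool" where
  "st_regular s f \<longleftrightarrow> (\<forall>a\<in>anchors. hk_finite a f) \<and> right_continuous f \<and>
     (\<forall>a\<in>anchors. \<forall>S. card S > s \<longrightarrow> no_interaction a S f)"

lemma hk_finite_iff:
  "hk_finite a f \<longleftrightarrow> (\<forall>S. limit_section_exists a S f) \<and> (\<forall>S. S \<noteq> {} \<longrightarrow> vitali S (limit_section a S f) < \<infinity>)"
  by (auto simp: hk_finite_def hk_variation_def less_top[symmetric])

lemma st_regular_add_scaled:
  fixes f g :: "real ^ 'd::finite \<Rightarrow> real"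
  assumes "st_regular s f" "st_regular s g"
  shows "st_regular s (\<lambda>x. f x + r * g x)"
  unfolding st_regular_def
proof (intro conjI ballI allI impI)
  fix a :: "'d \<Rightarrow> ereal" assume a: "a \<in> anchors"
  have ex: "limit_section_exists a S f" "limit_section_exists a S g" for S
    using assms a by (auto simp: st_regular_def hk_finite_def)
  have lim: "((\<lambda>y. f (glue S x y) + r * g (glue S x y)) \<longlongrightarrow> limit_section a S f x + r * limit_section a S g x) (anchor_filter a (- S))" for S x
    by (intro tendsto_intros limit_section_tendsto ex)
  then have eq: "limit_section a S (\<lambda>x. f x + r * g x) = (\<lambda>x. limit_section a S f x + r * limit_section a S g x)" for S
    by (auto intro: limit_section_eqI)
  show "hk_finite a (\<lambda>x. f x + r * g x)"
    unfolding hk_finite_iff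
  proof (intro conjI allI impI)
    show "limit_section_exists a S (\<lambda>x. f x + r * g x)" for S
      using lim by (auto simp: limit_section_exists_def)
    fix S :: "'d set" assume "S \<noteq> {}"
    then have fin: "vitali S (limit_section a S f) < \<infinity>" "vitali S (limit_section a S g) < \<infinity>"
      using assms a by (auto simp: st_regular_def hk_finite_iff)
    have "vitali S (limit_section a S (\<lambda>x. f x + r * g x)) \<le>
        vitali S (limit_section a S f) + ennreal \<bar>r\<bar> * vitali S (limit_section a S g)"
      unfolding eq by (rule vitali_add_scaled_le)
    also have "\<dots> < \<infinity>" using fin by (simp add: ennreal_mult_less_top)
    finally show "vitali S (limit_section a S (\<lambda>x. f x + r * g x)) < \<infinity>" .
  qed
  show "no_interaction a S (\<lambda>x. f x + r * g x)" if "card S > s" for S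
    using assms a that by (simp add: no_interaction_def eq quasi_volume_add_scaled st_regular_def)
next
  show "right_continuous (\<lambda>x. f x + r * g x)"
    using assms unfolding st_regular_def right_continuous_def by (auto intro!: tendsto_intros)
qed

lemma st_regular_const:
  fixes c :: real
  shows "st_regular s (\<lambda>x :: real ^ 'd::finite. c)"
proof -
  have lim: "((\<lambda>y. (\<lambda>x :: real ^ 'd. c) (glue S x y)) \<longlongrightarrow> c) (anchor_filter a (- S))" for a S x
    by (rule tendsto_const)
  have eq: "limit_section a S (\<lambda>x :: real ^ 'd. c) = (\<lambda>x. c)" for a S
    by (auto intro: limit_section_eqI)
  have qv: "quasi_volume S (\<lambda>x. c) u v = 0" if "S \<noteq> {}" for S :: "'d set" and u v
  proof -
    have "quasi_volume S (\<lambda>x. 0 + c * (\<Prod>j\<in>S. 1)) u v = 0"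
      using that quasi_volume_prod[of S "\<lambda>_ _. 1" u v]
      unfolding quasi_volume_add_scaled by (simp add: quasi_volume_def card_gt_0_iff)
    then show ?thesis by simp
  qed
  have "vitali S (\<lambda>x. c) < \<infinity>" if "S \<noteq> {}" for S :: "'d set"
  proof -
    have "vitali S (\<lambda>x. c) \<le> 0"
      unfolding vitali_def vitali_on_def
    proof (intro SUP_least)
      fix ab show "(case ab of (a, b) \<Rightarrow> SUP P\<in>axis_splits S a b.
          ennreal (\<Sum>(u, v)\<in>P. \<bar>quasi_volume S (\<lambda>x. c) u v\<bar>)) \<le> 0"
        by (cases ab) (simp only: prod.case, rule SUP_least, simp add: qv[OF that])
    qed
    then show ?thesis by simp
  qed
  moreover have "S \<noteq> {}" if "s < card S" for S :: "'d set" using that by auto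
  ultimately show ?thesis
    using lim
    by (auto simp: st_regular_def hk_finite_iff no_interaction_def right_continuous_def eq qv limit_section_exists_def)
qed

lemma st_regular_sum:
  "(\<And>i. i \<in> I \<Longrightarrow> st_regular s (f i)) \<Longrightarrow> st_regular s (\<lambda>x. \<Sum>i\<in>I. f i x)"
proof (induction I rule: infinite_finite_induct)
  case (insert i I)
  then have "st_regular s (\<lambda>x. f i x + 1 * (\<Sum>i\<in>I. f i x))"
    by (intro st_regular_add_scaled) auto
  then show ?case using insert by simp
qed (auto intro: st_regular_const)

text \<open>\<open>D\<close> contains the coordinates in which a factor may vary. The end values do
  not depend on the parameter \<open>\<omega>\<close>, so they leave the integral in the limit. The
  variation bound is 2 because an index in both \<open>L\<close> and \<open>U\<close> gives the
  indicator of an interval, which rises and falls once.\<close>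

locale product_kernel = finite_measure M for M :: "'w measure" +
  fixes \<phi> :: "'d::finite \<Rightarrow> real \<Rightarrow> 'w \<Rightarrow> real" and top_val bot_val :: "'d \<Rightarrow> real" and D :: "'d set"
  assumes measurable_phi[measurable]: "\<And>j t. \<phi> j t \<in> borel_measurable M"
    and phi_nonneg: "\<And>j t \<omega>. 0 \<le> \<phi> j t \<omega>" and phi_le_1: "\<And>j t \<omega>. \<phi> j t \<omega> \<le> 1"
    and phi_right: "\<And>j t \<omega>. ((\<lambda>t. \<phi> j t \<omega>) \<longlongrightarrow> \<phi> j t \<omega>) (at_right t)"
    and phi_top: "\<And>j \<omega>. ((\<lambda>t. \<phi> j t \<omega>) \<longlongrightarrow> top_val j) at_top"
    and phi_bot: "\<And>j \<omega>. ((\<lambda>t. \<phi> j t \<omega>) \<longlongrightarrow> bot_val j) at_bot"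
    and phi_variation: "\<And>j \<omega> n p. strict_mono_on {1..n+1} p \<Longrightarrow>
      (\<Sum>k=1..n::nat. \<bar>\<phi> j (p (k + 1)) \<omega> - \<phi> j (p k) \<omega>\<bar>) \<le> 2"
    and phi_outside: "\<And>j t \<omega>. j \<notin> D \<Longrightarrow> \<phi> j t \<omega> = 1"
begin

definition mixture :: "real ^ 'd \<Rightarrow> real" where
  "mixture x = (\<integral>\<omega>. (\<Prod>j\<in>UNIV. \<phi> j (x $ j) \<omega>) \<partial>M)"

definition end_val :: "('d \<Rightarrow> ereal) \<Rightarrow> 'd \<Rightarrow> real" where
  "end_val a j = (if a j = \<infinity> then top_val j else bot_val j)"

definition mixture_section :: "('d \<Rightarrow> ereal) \<Rightarrow> 'd set \<Rightarrow> ('d \<Rightarrow> real) \<Rightarrow> real" where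
  "mixture_section a S x = (\<Prod>j\<in>- S. end_val a j) * (\<integral>\<omega>. (\<Prod>j\<in>S. \<phi> j (x j) \<omega>) \<partial>M)"

lemma prod_phi_bounds: "0 \<le> (\<Prod>j\<in>S. \<phi> j (x j) \<omega>)" "(\<Prod>j\<in>S. \<phi> j (x j) \<omega>) \<le> 1"
  using phi_nonneg phi_le_1 by (auto intro: prod_nonneg prod_le_1)

lemma end_val_bounds: "0 \<le> end_val a j" "end_val a j \<le> 1"
proof -
  have "0 \<le> top_val j" "0 \<le> bot_val j"
    using tendsto_lowerbound[OF phi_top] tendsto_lowerbound[OF phi_bot] phi_nonneg by auto
  moreover have "top_val j \<le> 1" "bot_val j \<le> 1"
    using tendsto_upperbound[OF phi_top] tendsto_upperbound[OF phi_bot] phi_le_1 by auto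
  ultimately show "0 \<le> end_val a j" "end_val a j \<le> 1" by (auto simp: end_val_def)
qed

lemma integrable_bounded: "f \<in> borel_measurable M \<Longrightarrow> (\<And>\<omega>. \<bar>f \<omega>\<bar> \<le> B) \<Longrightarrow> integrable M f" for f :: "'w \<Rightarrow> real"
  by (rule integrable_const_bound[of _ B]) auto

lemma integrable_prod_phi: "integrable M (\<lambda>\<omega>. \<Prod>j\<in>S. \<phi> j (x j) \<omega>)"
  using prod_phi_bounds by (intro integrable_bounded[of _ 1]) auto

text \<open>Dominated convergence for a single factor, in the mean. It is applied along sequences,
  and the joint limit in several coordinates is later assembled from these one-variable
  limits.\<close>

lemma phi_end_dist:
  "((\<lambda>t. \<integral>\<omega>. \<bar>\<phi> j t \<omega> - end_val a j\<bar> \<partial>M) \<longlongrightarrow> 0) (if a j = \<infinity> then at_top else at_bot)"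
proof -
  have dist: "norm \<bar>\<phi> j t \<omega> - end_val a j\<bar> \<le> 1" for t \<omega>
    using phi_nonneg[of j t \<omega>] phi_le_1[of j t \<omega>] end_val_bounds[of a j] by auto
  have seq: "(\<lambda>n. \<integral>\<omega>. \<bar>\<phi> j (X n) \<omega> - end_val a j\<bar> \<partial>M) \<longlonglongrightarrow> 0"
    if X: "filterlim X (if a j = \<infinity> then at_top else at_bot) sequentially" for X :: "nat \<Rightarrow> real"
  proof -
    have "((\<lambda>t. \<phi> j t \<omega>) \<longlongrightarrow> end_val a j) (if a j = \<infinity> then at_top else at_bot)" for \<omega>
      using phi_top phi_bot by (auto simp: end_val_def)
    then have "(\<lambda>n. \<phi> j (X n) \<omega>) \<longlonglongrightarrow> end_val a j" for \<omega>
      using X by (rule filterlim_compose)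
    then have "(\<lambda>n. \<bar>\<phi> j (X n) \<omega> - end_val a j\<bar>) \<longlonglongrightarrow> 0" for \<omega>
      by (simp add: tendsto_rabs_zero LIM_zero)
    then have "(\<lambda>n. \<integral>\<omega>. \<bar>\<phi> j (X n) \<omega> - end_val a j\<bar> \<partial>M) \<longlonglongrightarrow> (\<integral>\<omega>. 0 \<partial>M)"
      using dist by (intro integral_dominated_convergence[where w = "\<lambda>_. 1"]) auto
    then show ?thesis by simp
  qed
  show ?thesis
  proof (cases "a j = \<infinity>")
    case True
    then show ?thesis using seq by (auto intro: tendsto_at_topI_sequentially)
  next
    case False
    have "((\<lambda>t. \<integral>\<omega>. \<bar>\<phi> j (- t) \<omega> - end_val a j\<bar> \<partial>M) \<longlongrightarrow> 0) at_top"
    proof (rule tendsto_at_topI_sequentially)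
      fix X :: "nat \<Rightarrow> real" assume "filterlim X at_top sequentially"
      then have "filterlim (\<lambda>n. - X n) at_bot sequentially" by (simp add: filterlim_uminus_at_bot)
      then show "(\<lambda>n. \<integral>\<omega>. \<bar>\<phi> j (- X n) \<omega> - end_val a j\<bar> \<partial>M) \<longlonglongrightarrow> 0" using seq False by simp
    qed
    then show ?thesis using False by (simp add: filterlim_at_bot_mirror)
  qed
qed

text \<open>For factors in [0, 1] a difference of products is at most the sum of the differences of
  the factors, so the joint limit follows from \<open>phi_end_dist\<close> in each
  coordinate.\<close>

lemma mixture_tendsto_section:
  "((\<lambda>y. mixture (glue S x y)) \<longlongrightarrow> mixture_section a S x) (anchor_filter a (- S))"
proof -
  let ?e = "\<lambda>y. \<Sum>j\<in>- S. \<integral>\<omega>. \<bar>\<phi> j (y j) \<omega> - end_val a j\<bar> \<partial>M"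
  have int: "integrable M (\<lambda>\<omega>. \<bar>\<phi> j (y j) \<omega> - end_val a j\<bar>)" for j y
    using phi_nonneg[of j "y j"] phi_le_1[of j "y j"] end_val_bounds[of a j]
    by (intro integrable_bounded[of _ 1]) (auto simp: abs_le_iff add_increasing2 diff_le_eq intro: order_trans)
  have bound: "norm (mixture (glue S x y) - mixture_section a S x) \<le> ?e y" for y
  proof -
    have split: "(\<Prod>j\<in>UNIV. \<phi> j (glue S x y $ j) \<omega>) = (\<Prod>j\<in>S. \<phi> j (x j) \<omega>) * (\<Prod>j\<in>- S. \<phi> j (y j) \<omega>)" for \<omega>
    proof -
      have "(\<Prod>j\<in>UNIV. \<phi> j (glue S x y $ j) \<omega>) = (\<Prod>j\<in>S \<union> - S. \<phi> j (glue S x y $ j) \<omega>)" by simp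
      also have "\<dots> = (\<Prod>j\<in>S. \<phi> j (glue S x y $ j) \<omega>) * (\<Prod>j\<in>- S. \<phi> j (glue S x y $ j) \<omega>)"
        by (rule prod.union_disjoint) auto
      finally show ?thesis by (simp add: glue_def)
    qed
    have "mixture (glue S x y) - mixture_section a S x =
        (\<integral>\<omega>. (\<Prod>j\<in>S. \<phi> j (x j) \<omega>) * ((\<Prod>j\<in>- S. \<phi> j (y j) \<omega>) - (\<Prod>j\<in>- S. end_val a j)) \<partial>M)"
    proof -
      have "integrable M (\<lambda>\<omega>. (\<Prod>j\<in>S. \<phi> j (x j) \<omega>) * (\<Prod>j\<in>- S. \<phi> j (y j) \<omega>))"
        using integrable_prod_phi[of "\<lambda>j. glue S x y $ j" UNIV] by (simp add: split)
      then show ?thesis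
        using integrable_prod_phi[of x S]
        by (simp add: mixture_def mixture_section_def split right_diff_distrib mult.commute)
    qed
    also have "norm \<dots> \<le> (\<integral>\<omega>. norm ((\<Prod>j\<in>S. \<phi> j (x j) \<omega>) * ((\<Prod>j\<in>- S. \<phi> j (y j) \<omega>) - (\<Prod>j\<in>- S. end_val a j))) \<partial>M)"
      by (rule integral_norm_bound)
    also have "\<dots> \<le> (\<integral>\<omega>. (\<Sum>j\<in>- S. \<bar>\<phi> j (y j) \<omega> - end_val a j\<bar>) \<partial>M)"
    proof (rule integral_mono)
      show le: "norm ((\<Prod>j\<in>S. \<phi> j (x j) \<omega>) * ((\<Prod>j\<in>- S. \<phi> j (y j) \<omega>) - (\<Prod>j\<in>- S. end_val a j))) \<le>
          (\<Sum>j\<in>- S. \<bar>\<phi> j (y j) \<omega> - end_val a j\<bar>)" for \<omega>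
      proof -
        have "norm ((\<Prod>j\<in>- S. \<phi> j (y j) \<omega>) - (\<Prod>j\<in>- S. end_val a j)) \<le> (\<Sum>j\<in>- S. norm (\<phi> j (y j) \<omega> - end_val a j))"
          using phi_nonneg phi_le_1 end_val_bounds by (intro norm_prod_diff) auto
        moreover have "\<bar>\<Prod>j\<in>S. \<phi> j (x j) \<omega>\<bar> \<le> 1" using prod_phi_bounds[of x \<omega> S] by simp
        ultimately show ?thesis
          using mult_mono[of "\<bar>\<Prod>j\<in>S. \<phi> j (x j) \<omega>\<bar>" 1 "\<bar>(\<Prod>j\<in>- S. \<phi> j (y j) \<omega>) - (\<Prod>j\<in>- S. end_val a j)\<bar>"
              "\<Sum>j\<in>- S. \<bar>\<phi> j (y j) \<omega> - end_val a j\<bar>"]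
          by (simp add: abs_mult)
      qed
      show sum_int: "integrable M (\<lambda>\<omega>. \<Sum>j\<in>- S. \<bar>\<phi> j (y j) \<omega> - end_val a j\<bar>)"
        using int by (intro Bochner_Integration.integrable_sum)
      show "integrable M (\<lambda>\<omega>. norm ((\<Prod>j\<in>S. \<phi> j (x j) \<omega>) * ((\<Prod>j\<in>- S. \<phi> j (y j) \<omega>) - (\<Prod>j\<in>- S. end_val a j))))"
        by (rule Bochner_Integration.integrable_bound[OF sum_int])
          (use le in \<open>auto intro!: order_trans[OF _ abs_ge_self]\<close>)
    qed
    also have "\<dots> = ?e y"
      using int by (intro Bochner_Integration.integral_sum)
    finally show ?thesis .
  qed
  have "(?e \<longlongrightarrow> (\<Sum>j\<in>- S. 0)) (anchor_filter a (- S))"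
    by (intro tendsto_sum filterlim_compose[OF phi_end_dist filterlim_anchor_filter])
  then have "(?e \<longlongrightarrow> 0) (anchor_filter a (- S))" by simp
  then have "((\<lambda>y. mixture (glue S x y) - mixture_section a S x) \<longlongrightarrow> 0) (anchor_filter a (- S))"
    by (rule Lim_null_comparison[OF always_eventually[OF allI[OF bound]]])
  then show ?thesis by (simp add: LIM_zero_iff)
qed

lemma quasi_volume_mixture_section:
  "quasi_volume S (mixture_section a S) u v =
    (\<Prod>j\<in>- S. end_val a j) * (\<integral>\<omega>. (\<Prod>j\<in>S. \<phi> j (v j) \<omega> - \<phi> j (u j) \<omega>) \<partial>M)"
proof -
  have "quasi_volume S (mixture_section a S) u v = (\<Prod>j\<in>- S. end_val a j) *
     (\<Sum>R\<in>Pow S. \<integral>\<omega>. (-1) ^ card (S - R) * (\<Prod>j\<in>S. \<phi> j (if j \<in> R then v j else u j) \<omega>) \<partial>M)"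
    by (simp add: quasi_volume_Pow mixture_section_def sum_distrib_left mult.left_commute cong: prod.cong)
  also have "(\<Sum>R\<in>Pow S. \<integral>\<omega>. (-1) ^ card (S - R) * (\<Prod>j\<in>S. \<phi> j (if j \<in> R then v j else u j) \<omega>) \<partial>M) =
     (\<integral>\<omega>. (\<Sum>R\<in>Pow S. (-1) ^ card (S - R) * (\<Prod>j\<in>S. \<phi> j (if j \<in> R then v j else u j) \<omega>)) \<partial>M)"
    by (intro Bochner_Integration.integral_sum[symmetric] integrable_mult_right integrable_prod_phi)
  also have "\<dots> = (\<integral>\<omega>. (\<Prod>j\<in>S. \<phi> j (v j) \<omega> - \<phi> j (u j) \<omega>) \<partial>M)"
    using quasi_volume_prod[of S "\<lambda>j t. \<phi> j t \<omega>" u v for \<omega>]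
    by (simp add: quasi_volume_Pow cong: prod.cong)
  finally show ?thesis .
qed

text \<open>Under the integral, the sum over the rectangles of a split of the products of increments
  factors into one-variable variations, each at most 2; this gives the factor
  \<open>2 ^ card S\<close>.\<close>

lemma vitali_mixture_section: "vitali S (mixture_section a S) < \<infinity>"
proof -
  have "(\<Sum>(u, v)\<in>P. \<bar>quasi_volume S (mixture_section a S) u v\<bar>) \<le> 2 ^ card S * measure M (space M)"
    if P: "P \<in> axis_splits S c d" for P c d
  proof -
    obtain p and n :: "'d \<Rightarrow> nat" where pn: "P = (\<lambda>k. (\<lambda>j\<in>S. p j (k j), \<lambda>j\<in>S. p j (k j + 1))) ` (\<Pi>\<^sub>E j\<in>S. {1..n j}) \<and>
        (\<forall>j\<in>S. p j 1 = c j \<and> p j (n j + 1) = d j \<and> strict_mono_on {1..n j + 1} (p j))"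
      using P unfolding axis_splits_def by blast
    note P_eq = conjunct1[OF pn]
    have p: "strict_mono_on {1..n j + 1} (p j)" if "j \<in> S" for j using pn that by blast
    let ?K = "\<Pi>\<^sub>E j\<in>S. {1..n j}"
    let ?d = "\<lambda>j k \<omega>. \<bar>\<phi> j (p j (k + 1)) \<omega> - \<phi> j (p j k) \<omega>\<bar>"
    have d: "?d j k \<omega> \<le> 1" for j k \<omega>
      using phi_nonneg[of j "p j (k+1)" \<omega>] phi_le_1[of j "p j (k+1)" \<omega>] phi_nonneg[of j "p j k" \<omega>] phi_le_1[of j "p j k" \<omega>] by linarith
    have int: "integrable M (\<lambda>\<omega>. \<Prod>j\<in>S. ?d j (k j) \<omega>)" for k
      using d by (intro integrable_bounded[of _ 1]) (auto simp: abs_prod intro!: prod_le_1)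
    have finK: "finite ?K" by (intro finite_PiE) auto
    have "(\<Sum>(u, v)\<in>P. \<bar>quasi_volume S (mixture_section a S) u v\<bar>) \<le>
        (\<Sum>k\<in>?K. \<bar>quasi_volume S (mixture_section a S) (\<lambda>j\<in>S. p j (k j)) (\<lambda>j\<in>S. p j (k j + 1))\<bar>)"
      unfolding P_eq using finK by (intro order_trans[OF sum_image_le]) (auto simp: comp_def)
    also have "\<dots> \<le> (\<Sum>k\<in>?K. \<integral>\<omega>. (\<Prod>j\<in>S. ?d j (k j) \<omega>) \<partial>M)"
    proof (rule sum_mono)
      fix k
      have "\<bar>quasi_volume S (mixture_section a S) (\<lambda>j\<in>S. p j (k j)) (\<lambda>j\<in>S. p j (k j + 1))\<bar> =
          (\<Prod>j\<in>- S. end_val a j) * \<bar>\<integral>\<omega>. (\<Prod>j\<in>S. \<phi> j (p j (k j + 1)) \<omega> - \<phi> j (p j (k j)) \<omega>) \<partial>M\<bar>"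
        using end_val_bounds by (simp add: quasi_volume_mixture_section abs_mult prod_nonneg cong: prod.cong)
      also have "\<dots> \<le> 1 * (\<integral>\<omega>. \<bar>\<Prod>j\<in>S. \<phi> j (p j (k j + 1)) \<omega> - \<phi> j (p j (k j)) \<omega>\<bar> \<partial>M)"
        using end_val_bounds by (intro mult_mono integral_abs_bound prod_le_1) auto
      finally show "\<bar>quasi_volume S (mixture_section a S) (\<lambda>j\<in>S. p j (k j)) (\<lambda>j\<in>S. p j (k j + 1))\<bar> \<le>
          (\<integral>\<omega>. (\<Prod>j\<in>S. ?d j (k j) \<omega>) \<partial>M)" by (simp add: abs_prod)
    qed
    also have "\<dots> = (\<integral>\<omega>. (\<Sum>k\<in>?K. \<Prod>j\<in>S. ?d j (k j) \<omega>) \<partial>M)"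
      using int by (intro Bochner_Integration.integral_sum[symmetric])
    also have "\<dots> = (\<integral>\<omega>. (\<Prod>j\<in>S. \<Sum>k\<in>{1..n j}. ?d j k \<omega>) \<partial>M)"
      by (subst prod_sum_PiE) auto
    also have "\<dots> \<le> (\<integral>\<omega>. 2 ^ card S \<partial>M)"
    proof (rule integral_mono)
      have le: "(\<Prod>j\<in>S. \<Sum>k\<in>{1..n j}. ?d j k \<omega>) \<le> 2 ^ card S" for \<omega>
      proof -
        have "(\<Prod>j\<in>S. \<Sum>k\<in>{1..n j}. ?d j k \<omega>) \<le> (\<Prod>j\<in>S. 2)"
          by (intro prod_mono conjI sum_nonneg abs_ge_zero phi_variation p)
        then show ?thesis by simp
      qed
      then show "(\<Prod>j\<in>S. \<Sum>k\<in>{1..n j}. ?d j k \<omega>) \<le> 2 ^ card S" for \<omega> .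
      show "integrable M (\<lambda>\<omega>. \<Prod>j\<in>S. \<Sum>k\<in>{1..n j}. ?d j k \<omega>)"
        using le by (intro integrable_bounded[of _ "2 ^ card S"]) (auto simp: abs_of_nonneg prod_nonneg sum_nonneg)
    qed simp
    finally show ?thesis by (simp add: mult.commute)
  qed
  then have "vitali S (mixture_section a S) \<le> ennreal (2 ^ card S * measure M (space M))"
    unfolding vitali_def vitali_on_def by (auto intro!: SUP_least ennreal_leI)
  then show ?thesis by (auto simp: le_less_trans)
qed

lemma right_continuous_mixture: "right_continuous mixture"
  unfolding right_continuous_def
proof (intro allI)
  fix x :: "real ^ 'd" and j
  show "((\<lambda>t. mixture (\<chi> i. if i = j then t else x $ i)) \<longlongrightarrow> mixture x) (at_right (x $ j))"
    unfolding tendsto_at_iff_sequentially comp_def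
  proof (intro allI impI)
    fix X :: "nat \<Rightarrow> real" assume A: "\<forall>n. X n \<in> {x $ j<..} - {x $ j}" "X \<longlonglongrightarrow> x $ j"
    have "x $ j < X n \<and> X n \<noteq> x $ j" for n using spec[OF A(1), of n] by auto
    with A(2) have X: "filterlim X (at_right (x $ j)) sequentially"
      by (simp add: filterlim_at)
    have "(\<lambda>n. \<phi> i ((\<chi> i. if i = j then X n else x $ i) $ i) \<omega>) \<longlonglongrightarrow> \<phi> i (x $ i) \<omega>" for i \<omega>
      using filterlim_compose[OF phi_right X] by (cases "i = j") auto
    then have "(\<lambda>n. \<Prod>i\<in>UNIV. \<phi> i ((\<chi> i. if i = j then X n else x $ i) $ i) \<omega>) \<longlonglongrightarrow> (\<Prod>i\<in>UNIV. \<phi> i (x $ i) \<omega>)" for \<omega>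
      by (intro tendsto_prod)
    then show "(\<lambda>n. mixture (\<chi> i. if i = j then X n else x $ i)) \<longlonglongrightarrow> mixture x"
      unfolding mixture_def using prod_phi_bounds
      by (intro integral_dominated_convergence[where w = "\<lambda>_. 1"]) auto
  qed
qed

lemma st_regular_mixture:
  assumes "card D \<le> s"
  shows "st_regular s mixture"
proof -
  have eq: "limit_section a S mixture = mixture_section a S" for a S
    by (intro ext limit_section_eqI mixture_tendsto_section)
  have "no_interaction a S mixture" if "s < card S" for a S
  proof -
    have "\<not> S \<subseteq> D" using that assms card_mono[of D S] by auto
    then obtain j where j: "j \<in> S" "j \<notin> D" by auto
    then have "(\<Prod>j\<in>S. \<phi> j (v j) \<omega> - \<phi> j (u j) \<omega>) = 0" for u v \<omega>
      by (intro prod_zero bexI[of _ j]) (auto simp: phi_outside)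
    then have "quasi_volume S (mixture_section a S) u v = 0" for u v
      by (simp only: quasi_volume_mixture_section) simp
    then show ?thesis by (simp add: no_interaction_def eq)
  qed
  moreover have "limit_section_exists a S mixture" for a S
    unfolding limit_section_exists_def using mixture_tendsto_section by blast
  ultimately show ?thesis
    using vitali_mixture_section right_continuous_mixture
    by (auto simp: st_regular_def hk_finite_iff eq)
qed

end

section \<open>Functions of the class are regular\<close>

text \<open>Written with exceptions, so that the factor is 1 for a coordinate in neither set and the
  product can run over all coordinates.\<close>

definition basis_kernel :: "'d set \<Rightarrow> 'd set \<Rightarrow> 'd \<Rightarrow> real \<Rightarrow> ('d \<Rightarrow> real) \<times> ('d \<Rightarrow> real) \<Rightarrow> real" where
  "basis_kernel L U j t \<omega> =
     (if j \<in> L \<and> t < fst \<omega> j then 0 else 1) * (if j \<in> U \<and> snd \<omega> j \<le> t then 0 else 1)"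

lemma basis_fun_eq_prod: "basis_fun L U l u x = (\<Prod>j\<in>UNIV. basis_kernel L U j (x $ j) (l, u))"
proof -
  have "(\<Prod>j\<in>L. if x $ j \<ge> l j then 1 else 0) = (\<Prod>j\<in>UNIV. if j \<in> L \<and> x $ j < l j then 0 else 1 :: real)"
    by (rule prod.mono_neutral_cong_left) (auto simp: not_le)
  moreover have "(\<Prod>j\<in>U. if x $ j < u j then 1 else 0) = (\<Prod>j\<in>UNIV. if j \<in> U \<and> u j \<le> x $ j then 0 else 1 :: real)"
    by (rule prod.mono_neutral_cong_left) (auto simp: not_le)
  ultimately show ?thesis
    unfolding basis_fun_def basis_kernel_def prod.distrib fst_conv snd_conv by (simp only:)
qed

lemma sum_abs_increments_le_1:
  fixes f :: "real \<Rightarrow> real"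
  assumes mono: "\<And>s t. s \<le> t \<Longrightarrow> f s \<le> f t" and bounds: "\<And>t. 0 \<le> f t" "\<And>t. f t \<le> 1"
    and p: "strict_mono_on {1..n+1} p"
  shows "(\<Sum>k=1..n::nat. \<bar>f (p (k + 1)) - f (p k)\<bar>) \<le> 1"
proof -
  have "(\<Sum>k=1..n. \<bar>f (p (k + 1)) - f (p k)\<bar>) = (\<Sum>k=1..n. f (p (Suc k)) - f (p k))"
  proof (intro sum.cong refl)
    fix k assume "k \<in> {1..n}"
    then have "p k < p (Suc k)" by (intro strict_mono_onD[OF p]) auto
    then show "\<bar>f (p (k + 1)) - f (p k)\<bar> = f (p (Suc k)) - f (p k)"
      using mono[of "p k" "p (Suc k)"] by simp
  qed
  also have "\<dots> = f (p (Suc n)) - f (p 1)"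
    by (rule sum_Suc_diff) simp
  also have "\<dots> \<le> 1" using bounds[of "p (Suc n)"] bounds[of "p 1"] by simp
  finally show ?thesis .
qed

lemma product_kernel_basis:
  fixes L U :: "'d::finite set"
  assumes "finite_measure M" and sets: "sets M = sets (param_space L U)"
  shows "product_kernel M (basis_kernel L U) (\<lambda>j. if j \<in> U then 0 else 1) (\<lambda>j. if j \<in> L then 0 else 1) (L \<union> U)"
proof -
  interpret finite_measure M by fact
  show ?thesis
  proof
    fix j :: 'd and t :: real
    have fst_M: "(\<lambda>\<omega>. fst \<omega> j) \<in> borel_measurable M" if "j \<in> L"
      unfolding measurable_cong_sets[OF sets refl] param_space_def
      by (rule measurable_compose[OF measurable_fst measurable_component_singleton[OF that]])
    have snd_M: "(\<lambda>\<omega>. snd \<omega> j) \<in> borel_measurable M" if "j \<in> U"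
      unfolding measurable_cong_sets[OF sets refl] param_space_def
      by (rule measurable_compose[OF measurable_snd measurable_component_singleton[OF that]])
    have "(\<lambda>\<omega>. if j \<in> L \<and> t < fst \<omega> j then 0 else 1 :: real) \<in> borel_measurable M"
      by (cases "j \<in> L") (auto intro!: measurable_If borel_measurable_less simp: fst_M pred_def[symmetric])
    moreover have "(\<lambda>\<omega>. if j \<in> U \<and> snd \<omega> j \<le> t then 0 else 1 :: real) \<in> borel_measurable M"
      by (cases "j \<in> U") (auto intro!: measurable_If borel_measurable_le simp: snd_M pred_def[symmetric])
    ultimately show "basis_kernel L U j t \<in> borel_measurable M"
      unfolding basis_kernel_def[abs_def] by (rule borel_measurable_times)
    fix \<omega> :: "('d \<Rightarrow> real) \<times> ('d \<Rightarrow> real)"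
    show "0 \<le> basis_kernel L U j t \<omega>" "basis_kernel L U j t \<omega> \<le> 1" by (auto simp: basis_kernel_def)
    \<comment> \<open>Both indicators depend on \<open>t\<close> only through conditions of the form
      \<open>t < b\<close>, whose truth value is constant just to the right of
      \<open>t\<close>.\<close>
    have ev_le: "eventually (\<lambda>s. t < b \<longleftrightarrow> s < b) (at_right t)" for b
    proof (cases "t < b")
      case True
      then show ?thesis by (intro eventually_at_rightI[of t b]) auto
    qed (auto intro!: eventually_at_rightI[of t "t + 1"])
    have "eventually (\<lambda>s. (t < fst \<omega> j \<longleftrightarrow> s < fst \<omega> j) \<and> (t < snd \<omega> j \<longleftrightarrow> s < snd \<omega> j)) (at_right t)"
      by (intro eventually_conj ev_le)
    then have "eventually (\<lambda>s. basis_kernel L U j s \<omega> = basis_kernel L U j t \<omega>) (at_right t)"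
      by eventually_elim (auto simp: basis_kernel_def not_less[symmetric])
    then show "((\<lambda>s. basis_kernel L U j s \<omega>) \<longlongrightarrow> basis_kernel L U j t \<omega>) (at_right t)"
      by (rule tendsto_eventually)
    have "eventually (\<lambda>s. fst \<omega> j \<le> s \<and> snd \<omega> j \<le> s) at_top"
      by (intro eventually_conj eventually_ge_at_top)
    then have "eventually (\<lambda>s. basis_kernel L U j s \<omega> = (if j \<in> U then 0 else 1)) at_top"
      by eventually_elim (auto simp: basis_kernel_def)
    then show "((\<lambda>s. basis_kernel L U j s \<omega>) \<longlongrightarrow> (if j \<in> U then 0 else 1)) at_top"
      by (rule tendsto_eventually)
    have "eventually (\<lambda>s. s < fst \<omega> j \<and> s < snd \<omega> j) at_bot"
      by (intro eventually_conj eventually_gt_at_bot)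
    then have "eventually (\<lambda>s. basis_kernel L U j s \<omega> = (if j \<in> L then 0 else 1)) at_bot"
      by eventually_elim (auto simp: basis_kernel_def)
    then show "((\<lambda>s. basis_kernel L U j s \<omega>) \<longlongrightarrow> (if j \<in> L then 0 else 1)) at_bot"
      by (rule tendsto_eventually)
    show "basis_kernel L U j t \<omega> = 1" if "j \<notin> L \<union> U"
      using that by (simp add: basis_kernel_def)
    fix n :: nat and p :: "nat \<Rightarrow> real" assume p: "strict_mono_on {1..n+1} p"
    define A where "A s = (if j \<in> L \<and> s < fst \<omega> j then 0 else 1 :: real)" for s
    \<comment> \<open>The kernel is \<open>A * (1 - B)\<close> with \<open>A\<close> and
      \<open>B\<close> nondecreasing and valued in 0 and 1, so its increments are bounded by theirs,
      and each contributes at most 1 in total.\<close>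
    define B where "B s = (if j \<in> U \<and> snd \<omega> j \<le> s then 1 else 0 :: real)" for s
    have "(\<Sum>k=1..n. \<bar>basis_kernel L U j (p (k + 1)) \<omega> - basis_kernel L U j (p k) \<omega>\<bar>) \<le>
        (\<Sum>k=1..n. \<bar>A (p (k + 1)) - A (p k)\<bar> + \<bar>B (p (k + 1)) - B (p k)\<bar>)"
      by (intro sum_mono) (auto simp: basis_kernel_def A_def B_def)
    also have "\<dots> \<le> 1 + 1"
      unfolding sum.distrib
      by (intro add_mono sum_abs_increments_le_1 p) (auto simp: A_def B_def)
    finally show "(\<Sum>k=1..n. \<bar>basis_kernel L U j (p (k + 1)) \<omega> - basis_kernel L U j (p k) \<omega>\<bar>) \<le> 2" by simp
  qed
qed

lemma st_regular_integral_basis: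
  fixes L U :: "'d::finite set"
  assumes "finite_measure M" "sets M = sets (param_space L U)" "card L + card U \<le> s"
  shows "st_regular s (\<lambda>x. \<integral>(l, u). basis_fun L U l u x \<partial>M)"
proof -
  interpret product_kernel M "basis_kernel L U" "\<lambda>j. if j \<in> U then 0 else 1" "\<lambda>j. if j \<in> L then 0 else 1" "L \<union> U"
    by (rule product_kernel_basis) fact+
  have "(\<lambda>x. \<integral>(l, u). basis_fun L U l u x \<partial>M) = mixture"
    by (simp add: mixture_def[abs_def] basis_fun_eq_prod case_prod_unfold)
  moreover have "card (L \<union> U) \<le> s" using card_Un_le[of L U] assms(3) by simp
  ultimately show ?thesis using st_regular_mixture by simp
qed

lemma st_class_imp_regular:
  fixes f :: "real ^ 'd::finite \<Rightarrow> real"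
  assumes "f \<in> st_class s"
  shows "st_regular s f"
proof -
  let ?I = "{(L :: 'd set, U :: 'd set). 0 < card L + card U \<and> card L + card U \<le> s}"
  obtain c \<nu> where \<nu>: "\<And>L U. 0 < card L + card U \<Longrightarrow> card L + card U \<le> s \<Longrightarrow>
        finite_signed_measure (param_space L U) (\<nu> L U)"
      and f: "\<And>x. f x = c + (\<Sum>(L, U)\<in>?I. signed_integral (param_space L U) (\<nu> L U) (\<lambda>(l, u). basis_fun L U l u x))"
    using assms unfolding st_class_def by blast
  have "st_regular s (\<lambda>x. signed_integral (param_space L U) (\<nu> L U) (\<lambda>(l, u). basis_fun L U l u x))"
    if "0 < card L + card U" "card L + card U \<le> s" for L U
  proof -
    have fin: "finite_measure (jordan_pos (param_space L U) (\<nu> L U))" "finite_measure (jordan_neg (param_space L U) (\<nu> L U))"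
      using \<nu>[OF that] by (auto simp: jordan_neg_def intro: finite_measure_jordan_pos finite_signed_measure_uminus)
    have "st_regular s (\<lambda>x. (\<integral>(l, u). basis_fun L U l u x \<partial>jordan_pos (param_space L U) (\<nu> L U)) +
        (- 1) * (\<integral>(l, u). basis_fun L U l u x \<partial>jordan_neg (param_space L U) (\<nu> L U)))"
      using fin that by (intro st_regular_add_scaled st_regular_integral_basis) (auto simp: jordan_neg_def)
    then show ?thesis by (simp add: signed_integral_def)
  qed
  then have "st_regular s (\<lambda>x. \<Sum>i\<in>?I. case i of (L, U) \<Rightarrow>
      signed_integral (param_space L U) (\<nu> L U) (\<lambda>(l, u). basis_fun L U l u x))"
    by (intro st_regular_sum) auto
  then have "st_regular s (\<lambda>x. c + 1 * (\<Sum>(L, U)\<in>?I.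
      signed_integral (param_space L U) (\<nu> L U) (\<lambda>(l, u). basis_fun L U l u x)))"
    by (intro st_regular_add_scaled st_regular_const)
  moreover have "f = (\<lambda>x. c + 1 * (\<Sum>(L, U)\<in>?I.
      signed_integral (param_space L U) (\<nu> L U) (\<lambda>(l, u). basis_fun L U l u x)))"
    by (simp add: fun_eq_iff f)
  ultimately show ?thesis by simp
qed

section \<open>Faces and components\<close>

locale anchored =
  fixes a :: "'d::finite \<Rightarrow> ereal" and f :: "real ^ 'd \<Rightarrow> real"
  assumes hk: "hk_finite a f" and right_cont_f: "right_continuous f"
begin

abbreviation face :: "'d set \<Rightarrow> ('d \<Rightarrow> real) \<Rightarrow> real" where
  "face S \<equiv> limit_section a S f"

text \<open>The anchored decomposition of ANOVA type: formally the quasi-volume of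
  \<open>face T\<close> over the box spanned by the anchor at infinity and \<open>x\<close>.\<close>

definition component :: "'d set \<Rightarrow> ('d \<Rightarrow> real) \<Rightarrow> real" where
  "component T x = (\<Sum>R\<in>Pow T. (-1) ^ card (T - R) * face R x)"

lemma face_tendsto: "((\<lambda>y. f (glue S x y)) \<longlongrightarrow> face S x) (anchor_filter a (- S))"
  using hk by (intro limit_section_tendsto) (auto simp: hk_finite_def)

lemma vitali_face: "T \<noteq> {} \<Longrightarrow> vitali T (face T) < \<infinity>"
  using hk by (auto simp: hk_finite_iff)

lemma face_cong: "(\<And>j. j \<in> S \<Longrightarrow> x j = y j) \<Longrightarrow> face S x = face S y"
  by (metis limit_section_restrict restrict_ext)

lemma component_cong: "(\<And>j. j \<in> S \<Longrightarrow> x j = y j) \<Longrightarrow> component S x = component S y"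
  unfolding component_def by (intro sum.cong refl arg_cong2[of _ _ _ _ "(*)"] face_cong) auto

lemma face_UNIV: "face UNIV x = f (\<chi> j. x j)"
  by (rule limit_section_eqI) (simp add: glue_def)

lemma face_eq_sum_component: "face S x = (\<Sum>T\<in>Pow S. component T x)"
proof -
  have sgn: "(-1) ^ card (T - R) = (-1) ^ card T * ((-1) ^ card R :: real)" if "R \<subseteq> T" for R T :: "'d set"
    using that card_mono[of T R]
    by (simp add: card_Diff_subset finite_subset neg_one_power_add_eq_neg_one_power_diff flip: power_add)
  \<comment> \<open>\<open>inclusion_exclusion_symmetric\<close> inverts sums with sign
    \<open>(-1) ^ card R\<close>; the extra \<open>(-1) ^ card T\<close> brings
    \<open>component\<close> into that form.\<close>
  have "face S x = (\<Sum>T\<in>Pow S. (-1) ^ card T * ((-1) ^ card T * component T x))"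
  proof (rule inclusion_exclusion_symmetric)
    fix T :: "'d set"
    show "(-1) ^ card T * component T x = (\<Sum>R\<in>Pow T. (-1) ^ card R * face R x)"
      unfolding component_def sum_distrib_left
      by (intro sum.cong refl) (auto simp: sgn)
  qed simp
  then show ?thesis by (simp add: mult.assoc[symmetric] flip: power_add)
qed

text \<open>A limit of a face is a face: a threshold for the joint limit in all coordinates outside
  \<open>R\<close> still works when those outside \<open>T\<close> go first. The filter is over all
  of \<open>T\<close>, so that every corner of a box is treated with the same one.\<close>

lemma face_iterated_limit:
  assumes "R \<subseteq> T" "0 < e"
  shows "eventually (\<lambda>z. \<bar>face T (\<lambda>j. if j \<in> R then x j else z j) - face R x\<bar> \<le> e) (anchor_filter a T)"
proof -
  have "eventually (\<lambda>y. dist (f (glue R x y)) (face R x) < e) (anchor_filter a (- R))"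
    by (rule tendstoD[OF face_tendsto assms(2)])
  then obtain N where N: "\<And>y. (\<forall>j\<in>- R. beyond a j N (y j)) \<Longrightarrow> \<bar>f (glue R x y) - face R x\<bar> < e"
    by (auto simp: eventually_anchor_filter dist_real_def)
  have "\<bar>face T (\<lambda>j. if j \<in> R then x j else z j) - face R x\<bar> \<le> e" if z: "\<forall>j\<in>T. beyond a j N (z j)" for z
  proof (rule tendsto_upperbound)
    let ?x = "\<lambda>j. if j \<in> R then x j else z j"
    show "((\<lambda>y. \<bar>f (glue T ?x y) - face R x\<bar>) \<longlongrightarrow> \<bar>face T ?x - face R x\<bar>) (anchor_filter a (- T))"
      by (intro tendsto_intros face_tendsto)
    have "\<bar>f (glue T ?x y) - face R x\<bar> \<le> e" if y: "\<forall>j\<in>- T. beyond a j N (y j)" for y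
    proof -
      have "glue T ?x y = glue R x (\<lambda>j. if j \<in> T then z j else y j)"
        using assms(1) by (auto simp: glue_def vec_eq_iff)
      then show ?thesis using N[of "\<lambda>j. if j \<in> T then z j else y j"] z y by (auto intro: less_imp_le)
    qed
    then show "eventually (\<lambda>y. \<bar>f (glue T ?x y) - face R x\<bar> \<le> e) (anchor_filter a (- T))"
      by (auto simp: eventually_anchor_filter)
  qed (simp add: anchor_filter_neq_bot)
  then show ?thesis by (auto simp: eventually_anchor_filter)
qed

lemma quasi_volume_tendsto_component:
  "((\<lambda>z. quasi_volume T (face T) z x) \<longlongrightarrow> component T x) (anchor_filter a T)"
  unfolding quasi_volume_Pow[OF finite] component_def
proof (intro tendsto_sum tendsto_mult tendsto_const)
  fix R assume "R \<in> Pow T"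
  have "((\<lambda>z. face T (\<lambda>j. if j \<in> R then x j else z j)) \<longlongrightarrow> face R x) (anchor_filter a T)"
  proof (rule tendstoI)
    fix e :: real assume "0 < e"
    then have "eventually (\<lambda>z. \<bar>face T (\<lambda>j. if j \<in> R then x j else z j) - face R x\<bar> \<le> e / 2) (anchor_filter a T)"
      using \<open>R \<in> Pow T\<close> by (intro face_iterated_limit) auto
    then show "eventually (\<lambda>z. dist (face T (\<lambda>j. if j \<in> R then x j else z j)) (face R x) < e) (anchor_filter a T)"
      by eventually_elim (use \<open>0 < e\<close> in \<open>simp add: dist_real_def\<close>)
  qed
  then show "((\<lambda>z. face T (\<lambda>j\<in>T. if j \<in> R then x j else z j)) \<longlongrightarrow> face R x) (anchor_filter a T)"
    by (simp add: limit_section_restrict)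
qed

text \<open>The component is a limit of quasi-volumes over boxes between \<open>z\<close> and
  \<open>x\<close>. If both lie beyond \<open>N\<close> in one coordinate, the box is far out and
  \<open>quasi_volume_tail\<close> applies.\<close>

lemma component_tail:
  assumes "T \<noteq> {}" "0 < \<eta>"
  shows "\<exists>N. \<forall>x. (\<exists>j\<in>T. beyond a j N (x j)) \<longrightarrow> \<bar>component T x\<bar> \<le> \<eta>"
proof -
  obtain N where N: "\<And>u v. (\<And>j. j \<in> T \<Longrightarrow> u j \<le> v j) \<Longrightarrow> \<exists>j\<in>T. v j \<le> - N \<or> N \<le> u j \<Longrightarrow>
      \<bar>quasi_volume T (face T) u v\<bar> \<le> \<eta>"
    using quasi_volume_tail[OF finite assms(1) vitali_face[OF assms(1)] assms(2)] by blast
  have "\<bar>component T x\<bar> \<le> \<eta>" if far: "\<exists>j\<in>T. beyond a j N (x j)" for x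
  proof (rule tendsto_upperbound)
    show "((\<lambda>z. \<bar>quasi_volume T (face T) z x\<bar>) \<longlongrightarrow> \<bar>component T x\<bar>) (anchor_filter a T)"
      by (intro tendsto_rabs quasi_volume_tendsto_component)
    have "\<bar>quasi_volume T (face T) z x\<bar> \<le> \<eta>" if z: "\<forall>j\<in>T. beyond a j N (z j)" for z
    proof -
      obtain j where j: "j \<in> T" "beyond a j N (x j)" using far by auto
      then have "max (z j) (x j) \<le> - N \<or> N \<le> min (z j) (x j)"
        using z by (force simp: beyond_def split: if_splits)
      then have "\<bar>quasi_volume T (face T) (\<lambda>j. min (z j) (x j)) (\<lambda>j. max (z j) (x j))\<bar> \<le> \<eta>"
        using j by (intro N) auto
      then show ?thesis
        by (subst quasi_volume_sort) (auto simp: abs_mult power_abs)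
    qed
    then show "eventually (\<lambda>z. \<bar>quasi_volume T (face T) z x\<bar> \<le> \<eta>) (anchor_filter a T)"
      by (auto simp: eventually_anchor_filter)
  qed (simp add: anchor_filter_neq_bot)
  then show ?thesis by blast
qed

text \<open>The convergence to a face is uniform, since the components not supported on the face have
  uniformly small tails. This carries right-continuity over from \<open>f\<close> to its faces.\<close>

lemma face_uniform_limit:
  assumes "0 < e"
  shows "\<exists>y. \<forall>x. \<bar>f (glue S x y) - face S x\<bar> \<le> e"
proof -
  \<comment> \<open>The number of components, which share the error \<open>e\<close>
    equally.\<close>
  define K where "K = real (card (Pow (UNIV :: 'd set)))"
  have K: "0 < K" by (simp add: K_def card_Pow)
  then have "0 < e / K" using assms by simp
  then have "\<exists>N. \<forall>x. (\<exists>j\<in>T. beyond a j N (x j)) \<longrightarrow> \<bar>component T x\<bar> \<le> e / K" if "T \<noteq> {}" for T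
    using component_tail that by blast
  then obtain N where N: "\<And>T x. T \<noteq> {} \<Longrightarrow> \<exists>j\<in>T. beyond a j (N T) (x j) \<Longrightarrow> \<bar>component T x\<bar> \<le> e / K"
    by metis
  define N0 where "N0 = (\<Sum>T\<in>UNIV. \<bar>N T\<bar>)"
  have N0: "N T \<le> N0" for T
    unfolding N0_def using member_le_sum[of T UNIV "\<lambda>T. \<bar>N T\<bar>"] by simp
  define y where "y j = (if a j = \<infinity> then N0 else - N0)" for j
  have y: "beyond a j (N T) (y j)" for j T
    using N0 by (auto simp: beyond_def y_def)
  have "\<bar>f (glue S x y) - face S x\<bar> \<le> e" for x
  proof -
    define w where "w j = (if j \<in> S then x j else y j)" for j
    have "f (glue S x y) = (\<Sum>T\<in>Pow UNIV. component T w)"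
      using face_eq_sum_component[of UNIV w] by (simp add: face_UNIV glue_def w_def)
    moreover have "face S x = (\<Sum>T\<in>Pow S. component T w)"
      unfolding face_eq_sum_component by (intro sum.cong refl component_cong) (auto simp: w_def)
    \<comment> \<open>Only components whose index set leaves \<open>S\<close> remain, and each has a
      coordinate that \<open>y\<close> places beyond its threshold.\<close>
    ultimately have "f (glue S x y) - face S x = (\<Sum>T\<in>Pow UNIV - Pow S. component T w)"
      by (simp add: sum_diff)
    also have "\<bar>\<dots>\<bar> \<le> (\<Sum>T\<in>Pow UNIV - Pow S. \<bar>component T w\<bar>)"
      by (rule sum_abs)
    also have "\<dots> \<le> (\<Sum>T\<in>Pow UNIV - Pow S. e / K)"
    proof (rule sum_mono)
      fix T assume "T \<in> Pow UNIV - Pow S"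
      then obtain j where "j \<in> T" "j \<notin> S" by auto
      then show "\<bar>component T w\<bar> \<le> e / K" using y by (intro N) (auto simp: w_def)
    qed
    also have "\<dots> \<le> (\<Sum>T\<in>Pow (UNIV :: 'd set). e / K)"
      using assms K by (intro sum_mono2) auto
    also have "\<dots> = e" using K by (simp add: K_def)
    finally show ?thesis .
  qed
  then show ?thesis by blast
qed

lemma face_right_cont:
  assumes i: "i \<in> S"
  shows "((\<lambda>t. face S (x(i := t))) \<longlongrightarrow> face S x) (at_right (x i))"
proof (rule tendstoI)
  fix e :: real assume e: "0 < e"
  then obtain y where y: "\<And>x. \<bar>f (glue S x y) - face S x\<bar> \<le> e / 4"
    using face_uniform_limit[of "e / 4"] by auto
  have glue_upd: "(\<chi> k. if k = i then t else glue S x y $ k) = glue S (x(i := t)) y" for t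
    using i by (auto simp: glue_def vec_eq_iff)
  have "((\<lambda>t. f (\<chi> k. if k = i then t else glue S x y $ k)) \<longlongrightarrow> f (glue S x y)) (at_right (glue S x y $ i))"
    using right_cont_f unfolding right_continuous_def by blast
  moreover have "glue S x y $ i = x i" using i by (simp add: glue_def)
  ultimately have "((\<lambda>t. f (glue S (x(i := t)) y)) \<longlongrightarrow> f (glue S x y)) (at_right (x i))"
    by (simp add: glue_upd)
  then have "eventually (\<lambda>t. dist (f (glue S (x(i := t)) y)) (f (glue S x y)) < e / 4) (at_right (x i))"
    using e by (intro tendstoD) auto
  then show "eventually (\<lambda>t. dist (face S (x(i := t))) (face S x) < e) (at_right (x i))"
  proof eventually_elim
    case (elim t)
    then show ?case using y[of x] y[of "x(i := t)"] e unfolding dist_real_def by linarith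
  qed
qed

text \<open>The region between \<open>x\<close> and the anchor. Its open and closed ends are
  inherited from the half-open boxes, and agree with the conditions \<open>x < u\<close> and
  \<open>l \<le> x\<close> of the class.\<close>

definition orthant :: "'d set \<Rightarrow> ('d \<Rightarrow> real) \<Rightarrow> ('d \<Rightarrow> real) set" where
  "orthant T x = (\<Pi>\<^sub>E j\<in>T. if a j = \<infinity> then {x j<..} else {..x j})"

lemma eventually_corner_beyond:
  "eventually (\<lambda>n. \<forall>j\<in>T. if a j = \<infinity> then x j < real n else - real n < x j) sequentially"
proof (rule eventually_ball_finite)
  show "\<forall>j\<in>T. eventually (\<lambda>n. if a j = \<infinity> then x j < real n else - real n < x j) sequentially"
  proof
    fix j
    obtain n0 :: nat where "\<bar>x j\<bar> < real n0" using reals_Archimedean2 by blast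
    then show "eventually (\<lambda>n. if a j = \<infinity> then x j < real n else - real n < x j) sequentially"
      unfolding eventually_sequentially by (intro exI[of _ n0]) auto
  qed
qed simp

text \<open>A sequence tending to the anchor, in place of the filter: continuity of measures from
  below is a statement about sequences.\<close>

abbreviation corner :: "nat \<Rightarrow> 'd \<Rightarrow> real" where
  "corner n j \<equiv> if a j = \<infinity> then real n else - real n"

lemma corner_tendsto_component:
  "(\<lambda>n. quasi_volume T (face T) (corner n) x) \<longlonglongrightarrow> component T x"
proof (rule filterlim_compose[OF quasi_volume_tendsto_component])
  show "filterlim corner (anchor_filter a T) sequentially"
    unfolding filterlim_def le_filter_def eventually_filtermap
  proof (intro allI impI)
    fix P assume "eventually P (anchor_filter a T)"
    then obtain N where N: "\<And>y. \<forall>j\<in>T. beyond a j N (y j) \<Longrightarrow> P y"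
      by (auto simp: eventually_anchor_filter)
    obtain n0 :: nat where "N < real n0" using reals_Archimedean2 by blast
    then show "eventually (\<lambda>n. P (corner n)) sequentially"
      unfolding eventually_sequentially by (intro exI[of _ n0] allI impI N) (auto simp: beyond_def)
  qed
qed

lemma corner_quasi_volume:
  assumes "\<forall>j\<in>T. if a j = \<infinity> then x j < real n else - real n < x j"
  shows "quasi_volume T (face T) (corner n) x = (-1) ^ card {j \<in> T. a j = \<infinity>} *
    quasi_volume T (face T) (\<lambda>j. min (corner n j) (x j)) (\<lambda>j. max (corner n j) (x j))"
proof -
  have "{j \<in> T. x j < corner n j} = {j \<in> T. a j = \<infinity>}"
    using assms by (auto split: if_splits)
  then show ?thesis by (subst quasi_volume_sort) auto
qed

lemma component_eq_0:
  assumes "no_interaction a T f"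
  shows "component T x = 0"
proof (rule LIMSEQ_unique[OF corner_tendsto_component])
  have qv0: "quasi_volume T (face T) v w = 0" if "\<And>j. j \<in> T \<Longrightarrow> v j < w j" for v w
    using assms that unfolding no_interaction_def by blast
  have "eventually (\<lambda>n. quasi_volume T (face T) (corner n) x = 0) sequentially"
    using eventually_corner_beyond[of T x]
  proof eventually_elim
    case (elim n)
    \<comment> \<open>\<open>no_interaction\<close> concerns strictly ordered corners; this is why
      the inequalities of \<open>eventually_corner_beyond\<close> are strict.\<close>
    then have "min (corner n j) (x j) < max (corner n j) (x j)" if "j \<in> T" for j
      using that by (auto split: if_splits dest!: bspec[of _ _ j])
    then have "quasi_volume T (face T) (\<lambda>j. min (corner n j) (x j)) (\<lambda>j. max (corner n j) (x j)) = 0"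
      by (rule qv0)
    then show ?case by (simp only: corner_quasi_volume[OF elim])
  qed
  then show "(\<lambda>n. quasi_volume T (face T) (corner n) x) \<longlonglongrightarrow> 0"
    by (rule tendsto_eventually)
qed

text \<open>The boxes between \<open>corner n\<close> and \<open>x\<close> increase to the orthant,
  so their measures converge. What remains is the orientation sign, one factor -1 for each
  coordinate anchored at plus infinity.\<close>

lemma component_eq_measure:
  assumes T: "T \<noteq> {}"
  shows "\<exists>M1 M2. finite_measure M1 \<and> finite_measure M2 \<and>
    sets M1 = sets (Pi\<^sub>M T (\<lambda>_. borel)) \<and> sets M2 = sets (Pi\<^sub>M T (\<lambda>_. borel)) \<and>
    (\<forall>x. component T x = measure M1 (orthant T x) - measure M2 (orthant T x))"
proof -
  obtain M1 M2 where M: "finite_measure M1" "finite_measure M2"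
      "sets M1 = sets (Pi\<^sub>M T (\<lambda>_. borel))" "sets M2 = sets (Pi\<^sub>M T (\<lambda>_. borel))"
      and qv: "\<And>u v. \<forall>j\<in>T. u j \<le> v j \<Longrightarrow>
        quasi_volume T (face T) u v = measure M1 (box_Ioc T u v) - measure M2 (box_Ioc T u v)"
    using signed_Lebesgue_Stieltjes[of T "face T"] T vitali_face face_right_cont
    by (auto simp: limit_section_restrict)
  define \<sigma> :: real where "\<sigma> = (-1) ^ card {j \<in> T. a j = \<infinity>}"
  have comp: "component T x = \<sigma> * (measure M1 (orthant T x) - measure M2 (orthant T x))" for x
  proof (rule LIMSEQ_unique[OF corner_tendsto_component])
    define B where "B n = (\<Pi>\<^sub>E j\<in>T. if a j = \<infinity> then {x j<..real n} else {- real n<..x j})" for n :: nat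
    have B_sets: "B n \<in> sets (Pi\<^sub>M T (\<lambda>_. borel))" for n
      unfolding B_def by (intro sets_PiM_I_finite) auto
    have inc: "incseq B"
      unfolding incseq_def B_def
    proof (intro allI impI PiE_mono)
      fix m n :: nat and j assume "m \<le> n"
      then show "(if a j = \<infinity> then {x j<..real m} else {- real m<..x j}) \<subseteq>
          (if a j = \<infinity> then {x j<..real n} else {- real n<..x j})" by auto
    qed
    have Un: "(\<Union>n. B n) = orthant T x"
    proof
      show "(\<Union>n. B n) \<subseteq> orthant T x"
        unfolding B_def orthant_def by (intro UN_least PiE_mono) auto
      show "orthant T x \<subseteq> (\<Union>n. B n)"
      proof
        fix t assume t: "t \<in> orthant T x"
        obtain n :: nat where n: "\<forall>j\<in>T. if a j = \<infinity> then t j < real n else - real n < t j"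
          using eventually_happens'[OF sequentially_bot eventually_corner_beyond[of T t]] by blast
        have "t \<in> B n"
          unfolding B_def
        proof (rule PiE_I)
          fix j assume j: "j \<in> T"
          then show "t j \<in> (if a j = \<infinity> then {x j<..real n} else {- real n<..x j})"
            using PiE_mem[OF t[unfolded orthant_def] j] bspec[OF n j] by (auto split: if_splits)
        qed (use t in \<open>auto simp: orthant_def PiE_iff extensional_def\<close>)
        then show "t \<in> (\<Union>n. B n)" by auto
      qed
    qed
    have lim: "(\<lambda>n. measure K (B n)) \<longlonglongrightarrow> measure K (orthant T x)"
      if "finite_measure K" "sets K = sets (Pi\<^sub>M T (\<lambda>_. borel))" for K
      using finite_measure.finite_Lim_measure_incseq[OF that(1) _ inc] B_sets that(2) Un by auto
    have "(\<lambda>n. \<sigma> * (measure M1 (B n) - measure M2 (B n))) \<longlonglongrightarrow> \<sigma> * (measure M1 (orthant T x) - measure M2 (orthant T x))"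
      by (intro tendsto_intros lim M)
    moreover have "eventually (\<lambda>n. \<sigma> * (measure M1 (B n) - measure M2 (B n)) = quasi_volume T (face T) (corner n) x) sequentially"
      using eventually_corner_beyond[of T x]
    proof eventually_elim
      case (elim n)
      have "box_Ioc T (\<lambda>j. min (corner n j) (x j)) (\<lambda>j. max (corner n j) (x j)) = B n"
        unfolding box_Ioc_def B_def
      proof (rule PiE_cong)
        fix j assume "j \<in> T"
        then show "{min (corner n j) (x j)<..max (corner n j) (x j)} = (if a j = \<infinity> then {x j<..real n} else {- real n<..x j})"
          using bspec[OF elim] by (auto split: if_splits)
      qed
      then show ?case
        unfolding corner_quasi_volume[OF elim] \<sigma>_def by (subst qv) auto
    qed
    ultimately show "(\<lambda>n. quasi_volume T (face T) (corner n) x) \<longlonglongrightarrow> \<sigma> * (measure M1 (orthant T x) - measure M2 (orthant T x))"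
      by (rule Lim_transform_eventually)
  qed
  \<comment> \<open>The sign is absorbed by exchanging the two measures.\<close>
  have "\<sigma> = 1 \<or> \<sigma> = -1" unfolding \<sigma>_def by (cases "even (card {j \<in> T. a j = \<infinity>})") auto
  then show ?thesis
  proof
    assume "\<sigma> = 1"
    then show ?thesis using M comp by (intro exI[of _ M1] exI[of _ M2]) auto
  next
    assume "\<sigma> = -1"
    then show ?thesis using M comp by (intro exI[of _ M2] exI[of _ M1]) auto
  qed
qed

end

section \<open>Representation by signed measures\<close>

lemma signed_integral_cong:
  "(\<And>z. z \<in> space M \<Longrightarrow> h z = k z) \<Longrightarrow> signed_integral M \<nu> h = signed_integral M \<nu> k"
  unfolding signed_integral_def jordan_neg_def
  by (intro arg_cong2[of _ _ _ _ "(-)"] Bochner_Integration.integral_cong refl) auto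

lemma space_param_space: "space (param_space L U) = (L \<rightarrow>\<^sub>E UNIV) \<times> (U \<rightarrow>\<^sub>E UNIV)"
  by (simp add: param_space_def space_pair_measure space_PiM)

lemma basis_fun_eq_indicator:
  fixes L U :: "'d::finite set"
  assumes "z \<in> space (param_space L U)"
  shows "(\<lambda>(l, u). basis_fun L U l u x) z =
    indicator ((\<Pi>\<^sub>E j\<in>L. {..x $ j}) \<times> (\<Pi>\<^sub>E j\<in>U. {x $ j<..})) z"
proof -
  obtain l u where z: "z = (l, u)" by (cases z)
  have prod_bool: "(\<Prod>j\<in>S. if P j then 1 else 0 :: real) = of_bool (\<forall>j\<in>S. P j)" for S :: "'d set" and P
    by (cases "\<forall>j\<in>S. P j") (auto intro!: prod_zero)
  show ?thesis
    using assms by (auto simp: z basis_fun_def prod_bool indicator_def space_param_space PiE_iff)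
qed

context anchored begin

text \<open>The coordinates of \<open>T\<close> anchored at plus infinity form \<open>U\<close>, the
  others \<open>L\<close>. The measure of \<open>T\<close> is carried to the parameter space of this
  one pair; every other pair, in particular every overlapping one, receives zero.\<close>

lemma in_st_class:
  assumes no_int: "\<And>S. s < card S \<Longrightarrow> no_interaction a S f"
  shows "f \<in> st_class s"
proof -
  define Top where "Top = {j. a j = \<infinity>}"
  define rep where "rep T K1 K2 \<longleftrightarrow> finite_measure K1 \<and> finite_measure K2 \<and>
      sets K1 = sets (Pi\<^sub>M T (\<lambda>_. borel)) \<and> sets K2 = sets (Pi\<^sub>M T (\<lambda>_. borel)) \<and>
      (\<forall>x. component T x = measure K1 (orthant T x) - measure K2 (orthant T x))" for T K1 K2
  have "\<exists>K. T \<noteq> {} \<longrightarrow> rep T (fst K) (snd K)" for T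
  proof (cases "T = {}")
    case False
    then obtain K1 K2 where "rep T K1 K2"
      using component_eq_measure unfolding rep_def by meson
    then show ?thesis by (intro exI[of _ "(K1, K2)"]) simp
  qed simp
  then obtain K0 where K0: "\<And>T. T \<noteq> {} \<Longrightarrow> rep T (fst (K0 T)) (snd (K0 T))"
    by metis
  define K1 K2 where "K1 T = fst (K0 T)" and "K2 T = snd (K0 T)" for T
  have K: "finite_measure (K1 T)" "finite_measure (K2 T)"
      "sets (K1 T) = sets (Pi\<^sub>M T (\<lambda>_. borel))" "sets (K2 T) = sets (Pi\<^sub>M T (\<lambda>_. borel))"
      "component T x = measure (K1 T) (orthant T x) - measure (K2 T) (orthant T x)" if "T \<noteq> {}" for T x
    using K0[OF that] unfolding rep_def K1_def K2_def by blast+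
  define adm where "adm L U \<longleftrightarrow> L \<inter> Top = {} \<and> U \<subseteq> Top \<and> L \<union> U \<noteq> {}" for L U
  define split where "split L U t = (restrict t L, restrict t U)" for L U :: "'d set" and t :: "'d \<Rightarrow> real"
  define N where "N K L U = (if adm L U then distr (K (L \<union> U)) (param_space L U) (split L U)
      else null_measure (param_space L U))" for K :: "'d set \<Rightarrow> ('d \<Rightarrow> real) measure" and L U
  define B where "B L U x = (\<Pi>\<^sub>E j\<in>L. {..x $ j}) \<times> (\<Pi>\<^sub>E j\<in>U. {x $ j<..})" for L U :: "'d set" and x :: "real ^ 'd"
  have B_sets: "B L U x \<in> sets (param_space L U)" for L U x
    unfolding B_def param_space_def by (intro pair_measureI sets_PiM_I_finite) auto
  have split_meas: "split L U \<in> measurable K (param_space L U)"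
    if "sets K = sets (Pi\<^sub>M (L \<union> U) (\<lambda>_. borel))" for K L U
    unfolding split_def param_space_def measurable_cong_sets[OF that refl]
    by (intro measurable_Pair measurable_restrict_subset) auto
  have N_sets: "sets (N K L U) = sets (param_space L U)" for K L U
    by (simp add: N_def)
  have N_fin: "finite_measure (N K L U)"
    if "\<And>T. T \<noteq> {} \<Longrightarrow> finite_measure (K T)" "\<And>T. T \<noteq> {} \<Longrightarrow> sets (K T) = sets (Pi\<^sub>M T (\<lambda>_. borel))" for K L U
  proof (cases "adm L U")
    case True
    then have "L \<union> U \<noteq> {}" by (simp add: adm_def)
    then have "finite_measure (distr (K (L \<union> U)) (param_space L U) (split L U))"
      by (intro finite_measure.finite_measure_distr split_meas that)
    then show ?thesis using True by (simp add: N_def)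
  qed (auto simp: N_def intro!: finite_measureI)
  have N_measure: "measure (N K L U) (B L U x) = (if adm L U then measure (K (L \<union> U)) (orthant (L \<union> U) (\<lambda>j. x $ j)) else 0)"
    if "\<And>T. T \<noteq> {} \<Longrightarrow> sets (K T) = sets (Pi\<^sub>M T (\<lambda>_. borel))" for K L U x
  proof (cases "adm L U")
    case True
    then have sets: "sets (K (L \<union> U)) = sets (Pi\<^sub>M (L \<union> U) (\<lambda>_. borel))"
      using that by (simp add: adm_def)
    have "space (K (L \<union> U)) = (L \<union> U) \<rightarrow>\<^sub>E UNIV"
      using sets_eq_imp_space_eq[OF sets] by (simp add: space_PiM)
    \<comment> \<open>For an admissible pair the sides \<open>{..x $ j}\<close> sit on the
      coordinates anchored at minus infinity and the sides \<open>{x $ j<..}\<close> on the rest,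
      which is the shape of \<open>orthant\<close>.\<close>
    then have "split L U -` B L U x \<inter> space (K (L \<union> U)) = orthant (L \<union> U) (\<lambda>j. x $ j)"
      using True by (fastforce simp: split_def B_def orthant_def adm_def Top_def PiE_iff split: if_splits)
    then show ?thesis
      using True by (simp add: N_def measure_distr[OF split_meas[OF sets] B_sets])
  qed (simp add: N_def)
  define \<nu> where "\<nu> L U A = measure (N K1 L U) A - measure (N K2 L U) A" for L U A
  have \<nu>_integral: "signed_integral (param_space L U) (\<nu> L U) (\<lambda>(l, u). basis_fun L U l u x) =
      (if adm L U then component (L \<union> U) (\<lambda>j. x $ j) else 0)" for L U x
  proof -
    have N_meas:
      "measure (N K1 L U) (B L U x) = (if adm L U then measure (K1 (L \<union> U)) (orthant (L \<union> U) (\<lambda>j. x $ j)) else 0)"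
      "measure (N K2 L U) (B L U x) = (if adm L U then measure (K2 (L \<union> U)) (orthant (L \<union> U) (\<lambda>j. x $ j)) else 0)"
      by (rule N_measure, erule K)+
    have "signed_integral (param_space L U) (\<nu> L U) (\<lambda>(l, u). basis_fun L U l u x) =
        signed_integral (param_space L U) (\<nu> L U) (indicator (B L U x))"
      unfolding B_def by (intro signed_integral_cong basis_fun_eq_indicator)
    also have "\<dots> = measure (N K1 L U) (B L U x) - measure (N K2 L U) (B L U x)"
      unfolding \<nu>_def using K by (intro signed_integral_indicator N_fin N_sets B_sets) auto
    also have "\<dots> = (if adm L U then component (L \<union> U) (\<lambda>j. x $ j) else 0)"
    proof (cases "adm L U")
      case True
      then have "L \<union> U \<noteq> {}" by (simp add: adm_def)
      then show ?thesis unfolding N_meas if_P[OF True] by (rule K(5)[symmetric])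
    qed (simp add: N_meas)
    finally show ?thesis .
  qed
  let ?I = "{(L :: 'd set, U :: 'd set). 0 < card L + card U \<and> card L + card U \<le> s}"
  let ?T = "{T :: 'd set. 0 < card T \<and> card T \<le> s}"
  have "f x = component {} (\<lambda>_. 0) + (\<Sum>(L, U)\<in>?I.
      signed_integral (param_space L U) (\<nu> L U) (\<lambda>(l, u). basis_fun L U l u x))" for x
  proof -
    let ?x = "\<lambda>j. x $ j"
    have "f x = (\<Sum>T\<in>Pow UNIV. component T ?x)"
      using face_eq_sum_component[of UNIV ?x] by (simp add: face_UNIV vec_nth_inverse)
    \<comment> \<open>Components of order above \<open>s\<close> vanish. The one of the empty set is
      constant and will be the constant term of the representation.\<close>
    also have "\<dots> = (\<Sum>T\<in>insert {} ?T. component T ?x)"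
    proof (rule sum.mono_neutral_right)
      show "\<forall>T\<in>Pow UNIV - insert {} ?T. component T ?x = 0"
      proof
        fix T assume "T \<in> Pow UNIV - insert {} ?T"
        then have "s < card T" by (auto simp: card_gt_0_iff)
        then show "component T ?x = 0" by (intro component_eq_0 no_int)
      qed
    qed auto
    also have "\<dots> = component {} ?x + (\<Sum>T\<in>?T. component T ?x)"
      by (subst sum.insert) auto
    also have "component {} ?x = component {} (\<lambda>_. 0)"
      by (rule component_cong) simp
    also have "(\<Sum>T\<in>?T. component T ?x) = (\<Sum>(L, U)\<in>{(L, U). (L, U) \<in> ?I \<and> adm L U}. component (L \<union> U) ?x)"
    proof (rule sum.reindex_bij_witness[where i = "\<lambda>(L, U). L \<union> U" and j = "\<lambda>T. (T - Top, T \<inter> Top)"])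
      fix T assume T: "T \<in> ?T"
      have un: "(T - Top) \<union> (T \<inter> Top) = T" by auto
      then show "(\<lambda>(L, U). L \<union> U) (T - Top, T \<inter> Top) = T" by simp
      have "card (T - Top) + card (T \<inter> Top) = card T"
        by (subst card_Un_disjoint[symmetric]) (auto simp: un)
      then show "(T - Top, T \<inter> Top) \<in> {(L, U). (L, U) \<in> ?I \<and> adm L U}"
        using T by (auto simp: adm_def card_gt_0_iff)
      show "(case (T - Top, T \<inter> Top) of (L, U) \<Rightarrow> component (L \<union> U) ?x) = component T ?x"
        by (simp add: un)
    next
      fix b assume b: "b \<in> {(L, U). (L, U) \<in> ?I \<and> adm L U}"
      then obtain L U where LU: "b = (L, U)" "(L, U) \<in> ?I" "adm L U" by auto
      then show "(\<lambda>T. (T - Top, T \<inter> Top)) ((\<lambda>(L, U). L \<union> U) b) = b" by (auto simp: adm_def)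
      have "card (L \<union> U) = card L + card U"
        using LU by (intro card_Un_disjoint) (auto simp: adm_def)
      then show "(\<lambda>(L, U). L \<union> U) b \<in> ?T" using LU by simp
    qed
    also have "\<dots> = (\<Sum>(L, U)\<in>?I. if adm L U then component (L \<union> U) ?x else 0)"
      by (rule sum.mono_neutral_cong_left) (auto split: if_splits)
    finally show ?thesis by (simp add: \<nu>_integral)
  qed
  moreover have "finite_signed_measure (param_space L U) (\<nu> L U)" for L U
    unfolding \<nu>_def[abs_def] using K by (intro finite_signed_measure_diff N_fin N_sets) auto
  ultimately show ?thesis
    unfolding st_class_def by blast
qed

end

theorem proposition3:
  fixes f :: "real ^ 'd::finite \<Rightarrow> real" and s :: nat
  assumes "s \<ge> 1"
  shows "(f \<in> st_class s \<longleftrightarrow>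
            (\<exists>a\<in>anchors. hk_finite a f \<and> right_continuous f \<and>
               (\<forall>S. card S > s \<longrightarrow> no_interaction a S f))) \<and>
         (f \<in> st_class s \<longleftrightarrow>
            (\<forall>a\<in>anchors. hk_finite a f) \<and> right_continuous f \<and>
            (\<forall>a\<in>anchors. \<forall>S. card S > s \<longrightarrow> no_interaction a S f))"
proof -
  have all: "st_regular s f" if "f \<in> st_class s"
    using that by (rule st_class_imp_regular)
  have some: "f \<in> st_class s"
    if "hk_finite a f" "right_continuous f" "\<forall>S. s < card S \<longrightarrow> no_interaction a S f" for a
  proof -
    interpret anchored a f using that by unfold_locales
    show ?thesis using that by (intro in_st_class) auto
  qed
  \<comment> \<open>Passing from all anchors to some anchor requires that there is one.\<close>
  have anchor: "(\<lambda>_. \<infinity>) \<in> (anchors :: ('d \<Rightarrow> ereal) set)"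
    by (auto simp: anchors_def)
  show ?thesis
    using all some anchor unfolding st_regular_def by blast
qed

end
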